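(* Suppose that $n$ is even. (a) If $n=2$, then $$r(H_{8})\cong \mathbb{Z}[x,y,z]/\langle y^2-1,\ x^2-y^{2},\ zx-zy,\ z-zy,\ z^2-x-y-xy-1\rangle .$$ (b) If $n>2$ and $m:=\frac n2$, then $r(H_{2n^2})$ is isomorphic to the quotient ring of the ring $\mathbb{Z}[x,y,z]$ modulo the ideal $I$ generated by the following elements: $$x^{n}-1,\qquad x^2-y^{2},\qquad zx-zy,$$ $$z^{m}-z^{m}y^{m}+\sum_{i=1}^{\lfloor\frac{m}{2}\rfloor}(-1)^{i}\binom{m-i}{i}y^{i}z^{m-2i}-\sum_{i=1}^{\lfloor\frac{m}{2}\rfloor}(-1)^{i}\binom{m-i}{i}y^{m+i}z^{m-2i}-xF_{m-1}(y,z)+xy^{m}F_{m-1}(y,z),$$ $$z^{m+1}-z^{m-1}y^{m+1}+\sum_{i=1}^{\lfloor\frac{m+1}{2}\rfloor}(-1)^{i}\binom{m+1-i}{i}y^{i}z^{m+1-2i}-\sum_{i=1}^{\lfloor\frac{m-1}{2}\rfloor}(-1)^{i}\binom{m-1-i}{i}y^{m+1+i}z^{m-1-2i}-xF_{m}(y,z)+xy^{m+1}F_{m-2}(y,z).$$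
   Context: Let $n>1$ and let $k$ be a field containing a primitive $n$-th root of unity $q$, with $\operatorname{char} k\nmid 2n^2$. The Hopf algebra $H_{2n^2}$ is the associative unital $k$-algebra generated by $x,y,z$ with relations $$x^n=1,\quad y^n=1,\quad xy=yx,\quad zx=yz,\quad zy=xz,\quad z^2=\frac1n\sum_{i,j=0}^{n-1}q^{-ij}x^iy^j,$$ and with $\Delta(x)=x\otimes x$, $\Delta(y)=y\otimes y$, $\Delta(z)=\frac1n\sum_{i,j=0}^{n-1}q^{-ij}x^iz\otimes y^jz$, $\epsilon(x)=\epsilon(y)=\epsilon(z)=1$, $S(x)=x^{-1}$, $S(y)=y^{-1}$, $S(z)=z$. It is semisimple of dimension $2n^2$; $H_8$ denotes the case $n=2$. The Grothendieck ring (which here equals the Green ring) $r(H_{2n^2})$ is the abelian group generated by isomorphism classes $[M]$ of finite dimensional $H_{2n^2}$-modules modulo the relations $[M\oplus N]=[M]+[N]$, with multiplication $[M][N]=[M\otimes N]$, where $H_{2n^2}$ acts on $M\otimes N$ through $\Delta$. The polynomials $F_t(y,z)\in\mathbb{Z}[y,z]$ are defined by $F_0=0$, $F_1=1$, $F_2=z$ and $F_{t+2}=zF_{t+1}-yF_t$ for $t\ge1$. Here $\lfloor\cdot\rfloor$ is the floor function. In the polynomial ring $\mathbb{Z}[x,y,z]$ the letters $x,y,z$ are commuting indeterminates (not the generators of $H_{2n^2}$), and $\langle\cdots\rangle$ denotes the ideal generated by the listed elements.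
   Formalization: The field k is additionally assumed to contain a square root of q; without it the claim fails for every even n (e.g. n=2, k=Q, q=-1: r(H_8) has rank 4, but the quotient in (a) has rank 5). *)

theory Defs
  imports
    "HOL-Library.Poly_Mapping"
    "HOL-Library.Product_Plus"
    "HOL-Algebra.Algebra"
    "HOL-Algebra.Algebraic_Closure_Type"
    "Jordan_Normal_Form.Matrix"
begin

datatype letter = Lx | Ly | Lz

subsection \<open>The free algebra on three generators\<close>

text \<open>
  Words form a monoid under concatenation, written additively because the convolution product on
  \<open>word \<Rightarrow>\<^sub>0 'k\<close> from \<open>HOL-Library.Poly_Mapping\<close> expects an additive monoid
  of exponents. Hence the type \<open>word \<Rightarrow>\<^sub>0 'k\<close> with its \<open>ring_1\<close> structure is
  the free associative unital algebra \<open>k\<langle>x,y,z\<rangle>\<close>.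
\<close>

datatype word = Word (letters: "letter list")

instantiation word :: monoid_add
begin
definition "0 = Word []"
definition "u + v = Word (letters u @ letters v)"
instance by standard (auto simp: zero_word_def plus_word_def)
end

type_synonym 'k free_alg = "word \<Rightarrow>\<^sub>0 'k"

text \<open>
  \<open>(word \<times> word) \<Rightarrow>\<^sub>0 'k\<close> is \<open>k\<langle>x,y,z\<rangle> \<otimes> k\<langle>x,y,z\<rangle>\<close>, the
  pair \<open>(u, v)\<close> standing for \<open>u \<otimes> v\<close>; multiplication is componentwise.
\<close>

type_synonym 'k free_alg2 = "(word \<times> word) \<Rightarrow>\<^sub>0 'k"

definition scal :: "'k::field \<Rightarrow> ('m::monoid_add \<Rightarrow>\<^sub>0 'k)" where
  "scal c = Poly_Mapping.single 0 c"

definition word_elt :: "word \<Rightarrow> 'k::field free_alg" where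
  "word_elt w = Poly_Mapping.single w 1"

abbreviation fx :: "'k::field free_alg" where "fx \<equiv> word_elt (Word [Lx])"
abbreviation fy :: "'k::field free_alg" where "fy \<equiv> word_elt (Word [Ly])"
abbreviation fz :: "'k::field free_alg" where "fz \<equiv> word_elt (Word [Lz])"

definition tens :: "'k::field free_alg \<Rightarrow> 'k free_alg \<Rightarrow> 'k free_alg2" where
  "tens f g = (\<Sum>u\<in>Poly_Mapping.keys f. \<Sum>v\<in>Poly_Mapping.keys g. Poly_Mapping.single (u, v) (Poly_Mapping.lookup f u * Poly_Mapping.lookup g v))"

text \<open>
  The algebra homomorphism from the free algebra into an algebra with structure map \<open>sc\<close>
  that sends each generator \<open>l\<close> to \<open>\<phi> l\<close>.
\<close>

definition free_ext :: "('k::field \<Rightarrow> 'b::ring_1) \<Rightarrow> (letter \<Rightarrow> 'b) \<Rightarrow> 'k free_alg \<Rightarrow> 'b" where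
  "free_ext sc \<phi> f = (\<Sum>w\<in>Poly_Mapping.keys f. sc (Poly_Mapping.lookup f w) * prod_list (map \<phi> (letters w)))"

text \<open>
  The map induced on a quotient by a map that is constant on cosets.
\<close>

definition on_coset :: "('a \<Rightarrow> 'b) \<Rightarrow> 'a set \<Rightarrow> 'b" where
  "on_coset \<phi> a = the_elem (\<phi> ` a)"

subsection \<open>The bialgebra \<open>H\<close>\<close>

text \<open>
  The parameters are \<open>n\<close> and the primitive \<open>n\<close>-th root of unity \<open>q\<close>. The relations
  \<open>a = b\<close> are encoded as the elements \<open>a - b\<close>.
\<close>

definition H_rels :: "nat \<Rightarrow> 'k::field \<Rightarrow> 'k free_alg set" where
  "H_rels n q =
    {fx ^ n - 1, fy ^ n - 1, fx * fy - fy * fx, fz * fx - fy * fz, fz * fy - fx * fz,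
     fz ^ 2 - scal (1 / of_nat n) *
       (\<Sum>i<n. \<Sum>j<n. scal (inverse q ^ (i * j)) * fx ^ i * fy ^ j)}"

definition H_ideal :: "nat \<Rightarrow> 'k::field \<Rightarrow> 'k free_alg set" where
  "H_ideal n q = Idl\<^bsub>ring_of_type_algebra\<^esub> (H_rels n q)"

definition H_alg :: "nat \<Rightarrow> 'k::field \<Rightarrow> 'k free_alg set ring" where
  "H_alg n q = ring_of_type_algebra Quot H_ideal n q"

definition H_cls :: "nat \<Rightarrow> 'k::field \<Rightarrow> 'k free_alg \<Rightarrow> 'k free_alg set" where
  "H_cls n q f = H_ideal n q +>\<^bsub>ring_of_type_algebra\<^esub> f"

text \<open>
  For \<open>H = F / I\<close> one has \<open>H \<otimes> H = (F \<otimes> F) / (I \<otimes> F + F \<otimes> I)\<close>, and the denominator is the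
  two-sided ideal generated by the elements \<open>r \<otimes> 1\<close> and \<open>1 \<otimes> r\<close> with \<open>r\<close> in \<open>I\<close>.
\<close>

definition HH_ideal :: "nat \<Rightarrow> 'k::field \<Rightarrow> 'k free_alg2 set" where
  "HH_ideal n q = Idl\<^bsub>ring_of_type_algebra\<^esub>
     ((\<lambda>r. tens r 1) ` H_ideal n q \<union> (\<lambda>r. tens 1 r) ` H_ideal n q)"

definition HH_cls :: "nat \<Rightarrow> 'k::field \<Rightarrow> 'k free_alg2 \<Rightarrow> 'k free_alg2 set" where
  "HH_cls n q t = HH_ideal n q +>\<^bsub>ring_of_type_algebra\<^esub> t"

primrec comult_gen :: "nat \<Rightarrow> 'k::field \<Rightarrow> letter \<Rightarrow> 'k free_alg2" where
  "comult_gen n q Lx = tens fx fx"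
| "comult_gen n q Ly = tens fy fy"
| "comult_gen n q Lz = scal (1 / of_nat n) *
     (\<Sum>i<n. \<Sum>j<n. scal (inverse q ^ (i * j)) * tens (fx ^ i * fz) (fy ^ j * fz))"

definition comult :: "nat \<Rightarrow> 'k::field \<Rightarrow> 'k free_alg set \<Rightarrow> 'k free_alg2 set" where
  "comult n q = on_coset (\<lambda>f. HH_cls n q (free_ext scal (comult_gen n q) f))"

definition counit :: "'k::field free_alg set \<Rightarrow> 'k" where
  "counit = on_coset (free_ext (\<lambda>c. c) (\<lambda>_. 1))"

subsection \<open>Finite dimensional modules\<close>

text \<open>
  A module structure on \<open>k\<^sup>d\<close> is the pair of \<open>d\<close> and the action of \<open>H\<close>, that is, a
  homomorphism of \<open>k\<close>-algebras from \<open>H\<close> to the \<open>d \<times> d\<close> matrices. Every finite dimensional module is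
  isomorphic to such a one. The value \<open>d = 0\<close> is allowed and gives the zero module.
\<close>

type_synonym 'k hmod = "nat \<times> ('k free_alg set \<Rightarrow> 'k mat)"

definition is_hmod :: "nat \<Rightarrow> 'k::field \<Rightarrow> 'k hmod \<Rightarrow> bool" where
  "is_hmod n q M \<longleftrightarrow> (case M of (d, \<rho>) \<Rightarrow>
     \<rho> \<in> Ring.ring_hom (H_alg n q) (ring_mat TYPE('k) d ()) \<and>
     (\<forall>c. \<forall>h\<in>carrier (H_alg n q).
        \<rho> (H_cls n q (scal c) \<otimes>\<^bsub>H_alg n q\<^esub> h) = c \<cdot>\<^sub>m \<rho> h))"

definition hmod_iso :: "nat \<Rightarrow> 'k::field \<Rightarrow> 'k hmod \<Rightarrow> 'k hmod \<Rightarrow> bool" where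
  "hmod_iso n q M N \<longleftrightarrow> (case (M, N) of ((d, \<rho>), (e, \<sigma>)) \<Rightarrow>
     d = e \<and> (\<exists>P\<in>carrier_mat d d. invertible_mat P \<and>
       (\<forall>h\<in>carrier (H_alg n q). P * \<rho> h = \<sigma> h * P)))"

definition hmod_sum :: "'k::field hmod \<Rightarrow> 'k hmod \<Rightarrow> 'k hmod" where
  "hmod_sum M N = (case (M, N) of ((d, \<rho>), (e, \<sigma>)) \<Rightarrow>
     (d + e, \<lambda>h. four_block_mat (\<rho> h) (0\<^sub>m d e) (0\<^sub>m e d) (\<sigma> h)))"

definition kron_mat :: "'k::field mat \<Rightarrow> 'k mat \<Rightarrow> 'k mat" where
  "kron_mat A B = mat (dim_row A * dim_row B) (dim_col A * dim_col B)
     (\<lambda>(i, j). A $$ (i div dim_row B, j div dim_col B) * B $$ (i mod dim_row B, j mod dim_col B))"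

text \<open>
  \<open>tens_act\<close> lets \<open>u \<otimes> v\<close> act on \<open>k\<^sup>d \<otimes> k\<^sup>e\<close> by the Kronecker product of the actions of
  \<open>u\<close> and \<open>v\<close>; it induces the action of \<open>H \<otimes> H\<close>, and the tensor product of modules is the
  restriction of that action along the comultiplication. The linear combination is taken entrywise
  since \<open>'k mat\<close> is not a type-class monoid.
\<close>

definition tens_act :: "nat \<Rightarrow> 'k::field \<Rightarrow> 'k hmod \<Rightarrow> 'k hmod \<Rightarrow> 'k free_alg2 \<Rightarrow> 'k mat" where
  "tens_act n q M N t = (case (M, N) of ((d, \<rho>), (e, \<sigma>)) \<Rightarrow>
     mat (d * e) (d * e) (\<lambda>ij. \<Sum>(u, v)\<in>Poly_Mapping.keys t. Poly_Mapping.lookup t (u, v) *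
       kron_mat (\<rho> (H_cls n q (word_elt u))) (\<sigma> (H_cls n q (word_elt v))) $$ ij))"

definition hmod_tensor :: "nat \<Rightarrow> 'k::field \<Rightarrow> 'k hmod \<Rightarrow> 'k hmod \<Rightarrow> 'k hmod" where
  "hmod_tensor n q M N =
     (fst M * fst N, \<lambda>h. on_coset (tens_act n q M N) (comult n q h))"

definition hmod_triv :: "'k::field hmod" where
  "hmod_triv = (1, \<lambda>h. mat 1 1 (\<lambda>_. counit h))"

subsection \<open>The Grothendieck ring\<close>

definition hmod_class :: "nat \<Rightarrow> 'k::field \<Rightarrow> 'k hmod \<Rightarrow> 'k hmod set" where
  "hmod_class n q M = {N. is_hmod n q N \<and> hmod_iso n q M N}"

definition iso_classes :: "nat \<Rightarrow> 'k::field \<Rightarrow> 'k hmod set set" where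
  "iso_classes n q = {hmod_class n q M | M. is_hmod n q M}"

definition class_tensor ::
    "nat \<Rightarrow> 'k::field \<Rightarrow> 'k hmod set \<Rightarrow> 'k hmod set \<Rightarrow> 'k hmod set" where
  "class_tensor n q A B = (\<Union>M\<in>A. \<Union>N\<in>B. hmod_class n q (hmod_tensor n q M N))"

text \<open>
  The free abelian group on the isomorphism classes, with the biadditive extension of the tensor
  product.
\<close>

definition free_green :: "nat \<Rightarrow> 'k::field \<Rightarrow> ('k hmod set \<Rightarrow>\<^sub>0 int) ring" where
  "free_green n q = \<lparr>
     carrier = {a. Poly_Mapping.keys a \<subseteq> iso_classes n q},
     monoid.mult = (\<lambda>a b. \<Sum>A\<in>Poly_Mapping.keys a. \<Sum>B\<in>Poly_Mapping.keys b.
       Poly_Mapping.single (class_tensor n q A B) (Poly_Mapping.lookup a A * Poly_Mapping.lookup b B)),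
     one = Poly_Mapping.single (hmod_class n q hmod_triv) 1,
     ring.zero = 0,
     add = (+)\<rparr>"

definition green_rels :: "nat \<Rightarrow> 'k::field \<Rightarrow> ('k hmod set \<Rightarrow>\<^sub>0 int) set" where
  "green_rels n q =
     {Poly_Mapping.single (hmod_class n q (hmod_sum M N)) 1
        - (Poly_Mapping.single (hmod_class n q M) 1 + Poly_Mapping.single (hmod_class n q N) 1)
      | M N. is_hmod n q M \<and> is_hmod n q N}"

text \<open>
  The quotient by the additive subgroup generated by the relations; this subgroup is an ideal
  because the tensor product distributes over direct sums.
\<close>

definition green_ring :: "nat \<Rightarrow> 'k::field \<Rightarrow> ('k hmod set \<Rightarrow>\<^sub>0 int) set ring" where
  "green_ring n q =
     free_green n q Quot generate (add_monoid (free_green n q)) (green_rels n q)"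

subsection \<open>The polynomial ring in three commuting indeterminates\<close>

type_synonym zpoly = "(letter \<Rightarrow>\<^sub>0 nat) \<Rightarrow>\<^sub>0 int"

definition zvar :: "letter \<Rightarrow> zpoly" where
  "zvar l = Poly_Mapping.single (Poly_Mapping.single l 1) 1"

abbreviation px :: zpoly where "px \<equiv> zvar Lx"
abbreviation py :: zpoly where "py \<equiv> zvar Ly"
abbreviation pz :: zpoly where "pz \<equiv> zvar Lz"

definition zpoly_quot :: "zpoly set \<Rightarrow> zpoly set ring" where
  "zpoly_quot S = ring_of_type_algebra Quot (Idl\<^bsub>ring_of_type_algebra\<^esub> S)"

fun F_poly :: "nat \<Rightarrow> zpoly" where
  "F_poly 0 = 0"
| "F_poly (Suc 0) = 1"
| "F_poly (Suc (Suc 0)) = pz"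
| "F_poly (Suc (Suc (Suc t))) = pz * F_poly (Suc (Suc t)) - py * F_poly (Suc t)"

subsection \<open>Primitive roots of unity\<close>

definition primitive_root_of_unity :: "nat \<Rightarrow> 'k::field \<Rightarrow> bool" where
  "primitive_root_of_unity n q \<longleftrightarrow> q ^ n = 1 \<and> (\<forall>i. 0 < i \<and> i < n \<longrightarrow> q ^ i \<noteq> 1)"

text \<open>
  A one-dimensional module on which \<open>x = y = q\<^sup>i\<close> has \<open>z\<^sup>2 = q\<^bsup>i*i\<^esup>\<close>. For even \<open>n\<close> the
  two such modules for odd \<open>i\<close> exist over \<open>k\<close> precisely when \<open>q\<close> has a square root in \<open>k\<close>, and
  this is needed for the Grothendieck ring to have rank \<open>2 * n + n * (n - 1) / 2\<close>.
\<close>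

end

theory Submission
  imports Defs "Jordan_Normal_Form.Char_Poly"
begin

text \<open>
  On the weight space \<open>x = q\<^sup>a\<close>, \<open>y = q\<^sup>b\<close> one has \<open>z\<^sup>2 = q\<^bsup>ab\<^esup>\<close>, and \<open>z\<close> exchanges the weights \<open>(a, b)\<close>
  and \<open>(b, a)\<close>. Hence every module is a direct sum of one-dimensional modules of weight \<open>(a, a)\<close> with
  \<open>z = \<plusminus>p\<^bsup>aa\<^esup>\<close>, where \<open>p\<^sup>2 = q\<close>, and of two-dimensional modules with weights \<open>(a, b)\<close> and \<open>(b, a)\<close>.
  Counting dimensions of weight spaces, and on the weights \<open>(a, a)\<close> the difference of the two
  eigenspaces of \<open>z\<close>, identifies the Grothendieck ring with a ring of functions: after a discrete
  Fourier transform these counts become complex-valued ring homomorphisms. The polynomial ring maps onto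
  the same ring of functions. Writing \<open>w\<^sub>t\<close> for the polynomial that represents the module of
  weights \<open>(0, t)\<close> and \<open>(t, 0)\<close>, the last two relations say \<open>w\<^sub>t = y\<^sup>t w\<^bsub>n-t\<^esub>\<close> for \<open>t = m\<close> and \<open>t = m + 1\<close>;
  they propagate to all \<open>t\<close> along the recursion for \<open>w\<^sub>t\<close> and cut a spanning set of the
  quotient down to one element per simple module.
\<close>

text \<open>Neither ring is mapped to the other. Both are quotients by the kernel of a map into
  functions on \<open>point\<close>, and both maps have the image \<open>char_span\<close>; the ring
  laws of the Green ring are inherited from functions and never checked by hand. Each kernel is
  found by the same squeeze: modulo the relations every element is an integer combination indexed by
  \<open>Simp\<close>, and the characters of \<open>Simp\<close> are independent. The functions are
  complex-valued although k is arbitrary, since in positive characteristic values in k would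
  determine multiplicities only modulo that characteristic. The root of unity used for the Fourier
  transform is therefore a complex one, unrelated to q. Complete reducibility is produced rather
  than quoted: a nonzero matrix entry of a weight idempotent singles out a column and a row, which
  embed a simple module and project onto it. Before that, the comultiplication has to respect the
  relations for tensor products to make sense. The only hard relation is the one for the square of
  z; it holds because the twist in \<open>comult_gen\<close> and the right-hand side of that
  relation are values of one bimultiplicative element, \<open>bichar\<close>.\<close>

lemma poly_mapping_sum_single:
  "f = (\<Sum>k\<in>Poly_Mapping.keys f. Poly_Mapping.single k (Poly_Mapping.lookup f k))"
  by (rule poly_mapping_eqI)
    (simp add: lookup_sum lookup_single when_def in_keys_iff)

lemma poly_mapping_induct_sum [case_names zero single add]:
  assumes "P 0" and "\<And>k c. P (Poly_Mapping.single k c)"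
    and "\<And>f g. P f \<Longrightarrow> P g \<Longrightarrow> P (f + g)"
  shows "P (f :: 'a \<Rightarrow>\<^sub>0 'b::comm_monoid_add)"
proof -
  have "P (\<Sum>k\<in>A. Poly_Mapping.single k (Poly_Mapping.lookup f k))" if "finite A" for A
    using that by induction (auto intro: assms)
  then show ?thesis
    using poly_mapping_sum_single[of f] by (metis finite_keys)
qed

text \<open>Cancellation can make the support of \<open>f + g\<close> smaller than the union of the
  supports. All three sums are therefore taken over that union, where \<open>F k 0 = 0\<close> kills
  the extra terms. The maps below that are defined by sums over keys get their additivity from
  here.\<close>

lemma sum_keys_add:
  fixes F :: "'a \<Rightarrow> 'c::comm_monoid_add \<Rightarrow> 'b::comm_monoid_add"
  assumes "\<And>k. F k 0 = 0" and "\<And>k c d. F k (c + d) = F k c + F k d"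
  shows "(\<Sum>k\<in>Poly_Mapping.keys (f + g). F k (Poly_Mapping.lookup (f + g) k)) =
    (\<Sum>k\<in>Poly_Mapping.keys f. F k (Poly_Mapping.lookup f k)) +
    (\<Sum>k\<in>Poly_Mapping.keys g. F k (Poly_Mapping.lookup g k))"
proof -
  let ?A = "Poly_Mapping.keys f \<union> Poly_Mapping.keys g"
  have ext: "(\<Sum>k\<in>Poly_Mapping.keys h. F k (Poly_Mapping.lookup h k)) = (\<Sum>k\<in>?A. F k (Poly_Mapping.lookup h k))"
    if "Poly_Mapping.keys h \<subseteq> ?A" for h
    using that by (intro sum.mono_neutral_left) (auto simp: in_keys_iff assms(1))
  show ?thesis
    using keys_add[of f g]
    by (subst (1 2 3) ext) (auto simp: lookup_add assms(2) sum.distrib)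
qed

lemma sum_keys_single:
  assumes "F k 0 = 0"
  shows "(\<Sum>k\<in>Poly_Mapping.keys (Poly_Mapping.single k c). F k (Poly_Mapping.lookup (Poly_Mapping.single k c) k)) = F k c"
  using assms by (cases "c = 0") auto

subsection \<open>Two-sided ideals of type-class rings\<close>

lemma ring_of_type_algebra_simps [simp]:
  "carrier ring_of_type_algebra = UNIV"
  "a \<otimes>\<^bsub>ring_of_type_algebra\<^esub> b = a * b"
  "a \<oplus>\<^bsub>ring_of_type_algebra\<^esub> b = a + b"
  "\<one>\<^bsub>ring_of_type_algebra\<^esub> = 1"
  "\<zero>\<^bsub>ring_of_type_algebra\<^esub> = 0"
  by (simp_all add: ring_of_type_algebra_def)

lemma ring_ring_of_type_algebra: "ring (ring_of_type_algebra :: 'a::ring_1 ring)"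
proof -
  have "\<exists>y. x + y = 0" for x :: 'a
    using add.right_inverse by blast
  then show ?thesis
    unfolding ring_of_type_algebra_def using add.right_inverse
    by unfold_locales (auto simp: algebra_simps Units_def)
qed

lemma a_inv_ring_of_type_algebra [simp]:
  fixes a :: "'a::ring_1"
  shows "\<ominus>\<^bsub>ring_of_type_algebra\<^esub> a = - a"
proof -
  interpret ring "ring_of_type_algebra :: 'a ring" by (rule ring_ring_of_type_algebra)
  show ?thesis
    using minus_equality[of "- a" a] by simp
qed

text \<open>Ideals as plain sets, in rings that need not be commutative, with a congruence that can
  be chained in calculations. \<open>two_sided_ideal_iff_ideal\<close> connects them with the ideals
  of HOL-Algebra.\<close>

locale two_sided_ideal =
  fixes I :: "'a::ring_1 set"
  assumes zero [simp, intro]: "0 \<in> I"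
    and add: "a \<in> I \<Longrightarrow> b \<in> I \<Longrightarrow> a + b \<in> I"
    and left: "a \<in> I \<Longrightarrow> r * a \<in> I"
    and right: "a \<in> I \<Longrightarrow> a * r \<in> I"
begin

definition eqv :: "'a \<Rightarrow> 'a \<Rightarrow> bool" (infix \<open>\<doteq>\<close> 50) where
  "a \<doteq> b \<longleftrightarrow> a - b \<in> I"

lemma uminus: "a \<in> I \<Longrightarrow> - a \<in> I"
  using left[of a "-1"] by simp

lemma diff: "a \<in> I \<Longrightarrow> b \<in> I \<Longrightarrow> a - b \<in> I"
  using add[of a "- b"] uminus by simp

lemma eqv_refl [simp]: "a \<doteq> a"
  by (simp add: eqv_def)

lemma eqv_sym: "a \<doteq> b \<Longrightarrow> b \<doteq> a"
  unfolding eqv_def using uminus by fastforce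

lemma eqv_trans [trans]: "a \<doteq> b \<Longrightarrow> b \<doteq> c \<Longrightarrow> a \<doteq> c"
  unfolding eqv_def using add by fastforce

lemma eq_eqv_trans [trans]: "a = b \<Longrightarrow> b \<doteq> c \<Longrightarrow> a \<doteq> c"
  and eqv_eq_trans [trans]: "a \<doteq> b \<Longrightarrow> b = c \<Longrightarrow> a \<doteq> c"
  by simp_all

lemma eqv_add: "a \<doteq> b \<Longrightarrow> c \<doteq> d \<Longrightarrow> a + c \<doteq> b + d"
  unfolding eqv_def using add[of "a - b" "c - d"] by (simp add: algebra_simps)

lemma eqv_diff: "a \<doteq> b \<Longrightarrow> c \<doteq> d \<Longrightarrow> a - c \<doteq> b - d"
  unfolding eqv_def using diff[of "a - b" "c - d"] by (simp add: algebra_simps)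

lemma eqv_mult: "a \<doteq> b \<Longrightarrow> c \<doteq> d \<Longrightarrow> a * c \<doteq> b * d"
  unfolding eqv_def using add[OF right[of "a - b" c] left[of "c - d" b]] by (simp add: algebra_simps)

lemma eqv_left: "a \<doteq> b \<Longrightarrow> c * a \<doteq> c * b"
  and eqv_right: "a \<doteq> b \<Longrightarrow> a * c \<doteq> b * c"
  by (simp_all add: eqv_mult)

lemma eqv_power: "a \<doteq> b \<Longrightarrow> a ^ k \<doteq> b ^ k"
  by (induction k) (auto intro: eqv_mult)

lemma eqv_sum: "(\<And>i. i \<in> A \<Longrightarrow> f i \<doteq> g i) \<Longrightarrow> sum f A \<doteq> sum g A"
  by (induction A rule: infinite_finite_induct) (auto intro: eqv_add)

lemma eqv_power_mod:
  assumes "a ^ n \<doteq> 1" shows "a ^ k \<doteq> a ^ (k mod n)"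
proof -
  have "a ^ k = (a ^ n) ^ (k div n) * a ^ (k mod n)"
    by (simp flip: power_mult power_add)
  also have "\<dots> \<doteq> 1 ^ (k div n) * a ^ (k mod n)"
    by (intro eqv_mult eqv_power assms eqv_refl)
  finally show ?thesis by simp
qed

lemma eqv_comm_power:
  assumes "a * b \<doteq> b * c" shows "a ^ k * b \<doteq> b * c ^ k"
proof (induction k)
  case (Suc k)
  have "a ^ Suc k * b = a * (a ^ k * b)" by (simp add: mult.assoc)
  also have "\<dots> \<doteq> a * (b * c ^ k)" by (intro eqv_mult Suc eqv_refl)
  also have "\<dots> = (a * b) * c ^ k" by (simp add: mult.assoc)
  also have "\<dots> \<doteq> (b * c) * c ^ k" by (intro eqv_mult assms eqv_refl)
  finally show ?case by (simp add: mult.assoc)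
qed simp

lemma eqv_power_mult:
  assumes "a * b \<doteq> b * a" shows "(a * b) ^ k \<doteq> a ^ k * b ^ k"
proof (induction k)
  case (Suc k)
  have "(a * b) ^ Suc k = a * b * (a * b) ^ k" by simp
  also have "\<dots> \<doteq> a * b * (a ^ k * b ^ k)" by (intro eqv_mult Suc eqv_refl)
  also have "\<dots> = a * (b * a ^ k) * b ^ k" by (simp add: mult.assoc)
  also have "\<dots> \<doteq> a * (a ^ k * b) * b ^ k"
    by (intro eqv_mult eqv_refl eqv_sym[OF eqv_comm_power] assms)
  finally show ?case by (simp add: mult.assoc)
qed simp

end

lemma two_sided_ideal_iff_ideal:
  "two_sided_ideal I \<longleftrightarrow> ideal I (ring_of_type_algebra :: 'a::ring_1 ring)"
proof
  assume "two_sided_ideal I"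
  then interpret two_sided_ideal I .
  show "ideal I (ring_of_type_algebra :: 'a ring)"
    by (intro idealI ring_ring_of_type_algebra subgroup.intro)
      (auto simp: add left right uminus a_inv_ring_of_type_algebra[unfolded a_inv_def, simplified])
next
  assume "ideal I (ring_of_type_algebra :: 'a ring)"
  then interpret ideal I "ring_of_type_algebra :: 'a ring" .
  show "two_sided_ideal I"
    using additive_subgroup.zero_closed[OF additive_subgroup_axioms]
      additive_subgroup.a_closed[OF additive_subgroup_axioms] I_l_closed I_r_closed
    by unfold_locales auto
qed

lemma two_sided_ideal_genideal: "two_sided_ideal (Idl\<^bsub>ring_of_type_algebra\<^esub> S)"
  unfolding two_sided_ideal_iff_ideal
  by (rule ring.genideal_ideal[OF ring_ring_of_type_algebra]) simp

lemma subset_genideal: "S \<subseteq> Idl\<^bsub>ring_of_type_algebra\<^esub> S"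
  by (rule ring.genideal_self[OF ring_ring_of_type_algebra]) simp

lemma genideal_subset:
  assumes "two_sided_ideal J" "S \<subseteq> J" shows "Idl\<^bsub>ring_of_type_algebra\<^esub> S \<subseteq> J"
  using assms unfolding two_sided_ideal_iff_ideal
  by (intro ring.genideal_minimal[OF ring_ring_of_type_algebra])

lemma coset_ring_of_type_algebra:
  "I +>\<^bsub>ring_of_type_algebra\<^esub> a = {h + a | h. h \<in> I}"
  by (auto simp: a_r_coset_def' r_coset_def)

context two_sided_ideal
begin

lemma mem_coset: "b \<in> I +>\<^bsub>ring_of_type_algebra\<^esub> a \<longleftrightarrow> b \<doteq> a"
  by (auto simp: coset_ring_of_type_algebra eqv_def intro!: exI[of _ "b - a"])

lemma coset_eq_iff: "I +>\<^bsub>ring_of_type_algebra\<^esub> a = I +>\<^bsub>ring_of_type_algebra\<^esub> b \<longleftrightarrow> a \<doteq> b"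
  unfolding set_eq_iff mem_coset using eqv_trans eqv_sym eqv_refl by metis

lemma on_coset_eq:
  assumes "\<And>b. b \<doteq> a \<Longrightarrow> \<phi> b = \<phi> a"
  shows "on_coset \<phi> (I +>\<^bsub>ring_of_type_algebra\<^esub> a) = \<phi> a"
proof -
  have "\<phi> ` (I +>\<^bsub>ring_of_type_algebra\<^esub> a) = {\<phi> a}"
  proof (intro equalityI subsetI)
    fix y assume "y \<in> \<phi> ` (I +>\<^bsub>ring_of_type_algebra\<^esub> a)"
    then obtain b where "b \<doteq> a" "y = \<phi> b" by (auto simp: mem_coset)
    then show "y \<in> {\<phi> a}" using assms[of b] by simp
  qed (use mem_coset[of a a] in auto)
  then show ?thesis by (simp add: on_coset_def)
qed

end

subsection \<open>Roots of unity\<close>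

lemma primitive_root_power_eq_iff:
  assumes "primitive_root_of_unity n (q :: 'k::field)" "n > 0"
  shows "q ^ a = q ^ b \<longleftrightarrow> a mod n = b mod n"
proof -
  have q: "q ^ n = 1" "q \<noteq> 0"
    using assms by (auto simp: primitive_root_of_unity_def zero_power)
  have md: "q ^ k = q ^ (k mod n)" for k
  proof -
    have "q ^ k = (q ^ n) ^ (k div n) * q ^ (k mod n)"
      by (simp flip: power_mult power_add)
    then show ?thesis by (simp add: q)
  qed
  have lt: "i = j" if "q ^ i = q ^ j" "i \<le> j" "j < n" for i j
  proof (rule ccontr)
    assume "i \<noteq> j"
    have "q ^ j = q ^ i * q ^ (j - i)" using that(2) by (metis le_add_diff_inverse power_add)
    then have "q ^ (j - i) = 1" using that q by simp
    moreover have "0 < j - i" "j - i < n" using that \<open>i \<noteq> j\<close> by auto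
    ultimately show False using assms(1) by (auto simp: primitive_root_of_unity_def)
  qed
  have "a mod n = b mod n" if "q ^ (a mod n) = q ^ (b mod n)"
    using lt[OF that] lt[OF that[symmetric]] assms(2)
    by (metis mod_less_divisor nat_le_linear)
  then show ?thesis using md by metis
qed

text \<open>A geometric sum whose ratio \<open>r\<close>, morally q to the power a - b, is an n-th
  root of unity. The factor \<open>inverse q\<close> avoids truncated subtraction of
  exponents.\<close>

lemma primitive_root_orthogonality:
  assumes "primitive_root_of_unity n (q :: 'k::field)" "n > 0"
  shows "(\<Sum>i<n. q ^ (i * a) * inverse q ^ (i * b)) = (if a mod n = b mod n then of_nat n else 0)"
proof -
  have q: "q ^ n = 1" "q \<noteq> 0"
    using assms by (auto simp: primitive_root_of_unity_def zero_power)
  define r where "r = q ^ a * inverse q ^ b"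
  have r1: "r = 1 \<longleftrightarrow> a mod n = b mod n"
    using primitive_root_power_eq_iff[OF assms, of a b] q
    by (auto simp: r_def field_simps)
  have rn: "r ^ n = 1"
    unfolding r_def power_mult_distrib power_mult[symmetric] mult.commute[of _ n]
    by (simp add: power_mult q power_inverse)
  have "(\<Sum>i<n. q ^ (i * a) * inverse q ^ (i * b)) = (\<Sum>i<n. r ^ i)"
    unfolding r_def power_mult_distrib power_mult[symmetric] mult.commute[of _ a] mult.commute[of _ b] ..
  also have "\<dots> = (if r = 1 then of_nat n else 0)"
    using geometric_sum[of r n] rn by auto
  finally show ?thesis using r1 by simp
qed

subsection \<open>The free algebra and its tensor square\<close>

lemma scal_0 [simp]: "scal 0 = 0"
  and scal_1 [simp]: "scal 1 = 1"
  and scal_add: "scal (a + b) = scal a + scal b"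
  and scal_mult: "scal (a * b) = scal a * scal b"
  by (simp_all add: scal_def single_add mult_single)

lemma scal_mult_single: "scal c * Poly_Mapping.single k d = Poly_Mapping.single k (c * d)"
  by (simp add: scal_def mult_single)

lemma scal_commute: "scal c * f = f * scal c"
  by (induction f rule: poly_mapping_induct_sum)
    (simp_all add: scal_def mult_single algebra_simps)

lemma scal_left_commute: "f * (scal c * g) = scal c * (f * g)"
  by (metis mult.assoc scal_commute)

lemma scal_sum: "scal (sum f A) = (\<Sum>i\<in>A. scal (f i))"
  by (induction A rule: infinite_finite_induct) (simp_all add: scal_add)

lemma single_eq_scal_mult: "Poly_Mapping.single w c = scal c * word_elt w"
  by (simp add: word_elt_def scal_mult_single)

lemma word_elt_append: "word_elt (Word (u @ v)) = word_elt (Word u) * word_elt (Word v)"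
  by (simp add: word_elt_def mult_single plus_word_def)

lemma word_elt_Nil [simp]: "word_elt (Word []) = 1"
  by (simp add: word_elt_def flip: zero_word_def)

lemma free_alg_induct [case_names scal gen add mult]:
  assumes scal: "\<And>c. P (scal c)" and gen: "\<And>l. P (word_elt (Word [l]))"
    and add: "\<And>f g. P f \<Longrightarrow> P g \<Longrightarrow> P (f + g)"
    and mult: "\<And>f g. P f \<Longrightarrow> P g \<Longrightarrow> P (f * g)"
  shows "P (f :: 'k::field free_alg)"
proof (induction f rule: poly_mapping_induct_sum)
  case zero
  then show ?case using scal[of 0] by simp
next
  case (single w c)
  have "P (word_elt (Word ls))" for ls
  proof (induction ls)
    case Nil
    then show ?case using scal[of 1] by simp
  next
    case (Cons l ls)
    have "P (word_elt (Word [l]) * word_elt (Word ls))" by (rule mult[OF gen Cons])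
    then show ?case by (metis append_Cons append_Nil word_elt_append)
  qed
  then show ?case
    using mult[OF scal] by (metis single_eq_scal_mult word.exhaust)
qed (rule add)

text \<open>The exponent monoids are left open to cover the free algebra and its tensor square
  alike. The instances are the two embeddings of the former into the latter and the
  comultiplication; all of them commute with \<open>bichar\<close>.\<close>

locale algebra_hom =
  fixes h :: "('m::monoid_add \<Rightarrow>\<^sub>0 'k::field) \<Rightarrow> ('n::monoid_add \<Rightarrow>\<^sub>0 'k)"
  assumes hom_add: "h (f + g) = h f + h g"
    and hom_mult: "h (f * g) = h f * h g"
    and hom_scal: "h (scal c) = scal c"
begin

lemma hom_0: "h 0 = 0" using hom_scal[of 0] by simp
lemma hom_1: "h 1 = 1" using hom_scal[of 1] by simp
lemma hom_uminus: "h (- f) = - h f" using hom_add[of "- f" f] hom_0 by (simp add: add_eq_0_iff)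
lemma hom_diff: "h (f - g) = h f - h g" using hom_add[of f "- g"] hom_uminus by simp
lemma hom_power: "h (f ^ k) = h f ^ k" by (induction k) (simp_all add: hom_1 hom_mult)
lemma hom_sum: "h (sum f A) = (\<Sum>i\<in>A. h (f i))"
  by (induction A rule: infinite_finite_induct) (simp_all add: hom_0 hom_add)

end

lemma tens_0 [simp]: "tens 0 g = 0" "tens f 0 = 0"
  by (simp_all add: tens_def)

lemma tens_add_left: "tens (f + f') g = tens f g + tens f' g"
  unfolding tens_def
  by (rule sum_keys_add[where F = "\<lambda>u c. \<Sum>v\<in>Poly_Mapping.keys g. Poly_Mapping.single (u, v) (c * Poly_Mapping.lookup g v)"])
    (simp_all add: single_add distrib_right sum.distrib)

lemma tens_add_right: "tens f (g + g') = tens f g + tens f g'"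
  unfolding tens_def sum.distrib[symmetric]
  by (rule sum.cong[OF refl],
      rule sum_keys_add[where F = "\<lambda>v c. Poly_Mapping.single (_, v) (Poly_Mapping.lookup f _ * c)"])
    (simp_all add: single_add distrib_left)

lemma tens_single: "tens (Poly_Mapping.single u a) (Poly_Mapping.single v b) = Poly_Mapping.single (u, v) (a * b)"
  by (cases "a = 0"; cases "b = 0") (simp_all add: tens_def)

text \<open>Bilinearity reduces the four arguments to monomials one after the other.\<close>

lemma tens_mult: "tens f g * tens f' g' = tens (f * f') (g * g')"
proof -
  have 1: "tens (Poly_Mapping.single u a) (Poly_Mapping.single v b) * tens (Poly_Mapping.single u' a') g'
      = tens (Poly_Mapping.single u a * Poly_Mapping.single u' a') (Poly_Mapping.single v b * g')"
    for u v u' a b a'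
    by (induction g' rule: poly_mapping_induct_sum)
      (simp_all add: tens_single mult_single tens_add_right algebra_simps)
  have 2: "tens (Poly_Mapping.single u a) (Poly_Mapping.single v b) * tens f' g'
      = tens (Poly_Mapping.single u a * f') (Poly_Mapping.single v b * g')" for u v a b
    by (induction f' rule: poly_mapping_induct_sum) (simp_all add: 1 tens_add_left algebra_simps)
  have 3: "tens (Poly_Mapping.single u a) g * tens f' g'
      = tens (Poly_Mapping.single u a * f') (g * g')" for u a
    by (induction g rule: poly_mapping_induct_sum) (simp_all add: 2 tens_add_right algebra_simps)
  show ?thesis
    by (induction f rule: poly_mapping_induct_sum) (simp_all add: 3 tens_add_left algebra_simps)
qed

lemma tens_scal: "tens (scal c) 1 = scal c" "tens 1 (scal c) = scal c"
  by (simp_all add: scal_def tens_single zero_prod_def flip: single_one)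

lemma tens_1_1 [simp]: "tens 1 1 = 1"
  using tens_scal(1)[of 1] by simp

interpretation tens_left: algebra_hom "\<lambda>f. tens f 1"
  by unfold_locales (simp_all add: tens_add_left tens_mult tens_scal)

interpretation tens_right: algebra_hom "\<lambda>f. tens 1 f"
  by unfold_locales (simp_all add: tens_add_right tens_mult tens_scal)

lemma tens_split: "tens f g = tens f 1 * tens 1 g"
  by (simp add: tens_mult)

lemma tens_power: "tens f g ^ k = tens (f ^ k) (g ^ k)"
  by (induction k) (simp_all add: tens_mult)

subsection \<open>Homomorphisms out of the free algebra\<close>

text \<open>Scalars have to be central for the extension to be multiplicative. The two instances are
  \<open>scal\<close>, used for the comultiplication, and the identity of the field, used for the
  counit.\<close>

locale structure_map =
  fixes sc :: "'k::field \<Rightarrow> 'b::ring_1"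
  assumes sc_add: "sc (a + b) = sc a + sc b" and sc_mult: "sc (a * b) = sc a * sc b"
    and sc_1: "sc 1 = 1" and sc_central: "sc c * x = x * sc c"
begin

lemma sc_0: "sc 0 = 0"
  using sc_add[of 0 0] by simp

lemma free_ext_add: "free_ext sc \<phi> (f + g) = free_ext sc \<phi> f + free_ext sc \<phi> g"
  unfolding free_ext_def
  by (rule sum_keys_add[where F = "\<lambda>w c. sc c * prod_list (map \<phi> (letters w))"])
    (simp_all add: sc_0 sc_add distrib_right)

lemma free_ext_single:
  "free_ext sc \<phi> (Poly_Mapping.single w c) = sc c * prod_list (map \<phi> (letters w))"
  using sum_keys_single[of "\<lambda>w c. sc c * prod_list (map \<phi> (letters w))" w c]
  by (simp add: free_ext_def sc_0)

lemma free_ext_0: "free_ext sc \<phi> 0 = 0"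
  by (simp add: free_ext_def)

lemma free_ext_scal: "free_ext sc \<phi> (scal c) = sc c"
  by (simp add: scal_def free_ext_single zero_word_def)

lemma free_ext_gen: "free_ext sc \<phi> (word_elt (Word [l])) = \<phi> l"
  by (simp add: word_elt_def free_ext_single sc_1)

lemma free_ext_mult: "free_ext sc \<phi> (f * g) = free_ext sc \<phi> f * free_ext sc \<phi> g"
proof -
  have 1: "free_ext sc \<phi> (Poly_Mapping.single w c * g) = free_ext sc \<phi> (Poly_Mapping.single w c) * free_ext sc \<phi> g" for w c
  proof (induction g rule: poly_mapping_induct_sum)
    case (single w' c')
    have "sc c * sc c' * (a * b) = sc c * a * (sc c' * b)" for a b
      by (metis mult.assoc sc_central)
    then show ?case
      by (simp add: mult_single free_ext_single plus_word_def sc_mult)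
  qed (simp_all add: free_ext_0 free_ext_add distrib_left)
  show ?thesis
    by (induction f rule: poly_mapping_induct_sum) (simp_all add: 1 free_ext_0 free_ext_add distrib_right)
qed

end

interpretation scal: structure_map "scal :: 'k::field \<Rightarrow> ('m::monoid_add \<Rightarrow>\<^sub>0 'k)"
  by unfold_locales (rule scal_add scal_mult scal_1 scal_commute)+

interpretation ground: structure_map "\<lambda>c::'k::field. c"
  by unfold_locales (simp_all add: mult.commute)

subsection \<open>The bicharacter element\<close>

text \<open>
  The element \<open>bichar n q U W\<close> acts as \<open>q\<^bsup>ab\<^esup>\<close> where \<open>U = q\<^sup>a\<close> and \<open>W = q\<^sup>b\<close>, so it is multiplicative in
  either argument. Both \<open>z\<^sup>2\<close> and the twist in \<open>\<Delta>(z)\<close> are of this form.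
\<close>

definition bichar ::
    "nat \<Rightarrow> 'k::field \<Rightarrow> ('m::monoid_add \<Rightarrow>\<^sub>0 'k) \<Rightarrow> ('m \<Rightarrow>\<^sub>0 'k) \<Rightarrow> ('m \<Rightarrow>\<^sub>0 'k)" where
  "bichar n q U W = scal (1 / of_nat n) * (\<Sum>i<n. \<Sum>j<n. scal (inverse q ^ (i * j)) * U ^ i * W ^ j)"

lemma (in algebra_hom) hom_bichar: "h (bichar n q U W) = bichar n q (h U) (h W)"
  by (simp add: bichar_def hom_mult hom_sum hom_power hom_scal)

text \<open>Translation by \<open>i\<close> permutes the residues modulo n.\<close>

lemma sum_shift_mod:
  fixes n :: nat
  assumes "n > 0" shows "(\<Sum>k<n. g ((i + k) mod n)) = (\<Sum>s<n. g s :: 'a::comm_monoid_add)"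
proof (rule sum.reindex_bij_betw)
  have "inj_on (\<lambda>k. (i + k) mod n) {..<n}"
  proof (rule linorder_inj_onI)
    fix a b assume ab: "a < b" "a \<in> {..<n}" "b \<in> {..<n}"
    show "(i + a) mod n \<noteq> (i + b) mod n"
    proof
      assume "(i + a) mod n = (i + b) mod n"
      then have "n dvd (i + b) - (i + a)"
        using ab by (metis mod_eq_dvd_iff_nat add_le_cancel_left less_imp_le)
      then have "n \<le> b - a" using ab by (intro dvd_imp_le) auto
      then show False using ab by auto
    qed
  qed auto
  moreover have "(\<lambda>k. (i + k) mod n) ` {..<n} \<subseteq> {..<n}" using assms by auto
  ultimately show "bij_betw (\<lambda>k. (i + k) mod n) {..<n} {..<n}"
    by (simp add: bij_betw_def endo_inj_surj)
qed

locale algebra_ideal = two_sided_ideal I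
  for I :: "('m::monoid_add \<Rightarrow>\<^sub>0 'k::field) set" +
  fixes n :: nat and q :: 'k
  assumes prim: "primitive_root_of_unity n q" and n_pos: "n > 0" and n_nz: "(of_nat n :: 'k) \<noteq> 0"
begin

lemma q_nz: "q \<noteq> 0" and q_n: "q ^ n = 1"
  using prim n_pos by (auto simp: primitive_root_of_unity_def zero_power)

text \<open>The coefficient \<open>inverse q ^ (i * j)\<close> is symmetric in i and j.\<close>

lemma bichar_sym:
  assumes "U * W \<doteq> W * U" shows "bichar n q U W \<doteq> bichar n q W U"
proof -
  have "bichar n q U W \<doteq> scal (1 / of_nat n) * (\<Sum>i<n. \<Sum>j<n. scal (inverse q ^ (i * j)) * (W ^ j * U ^ i))"
    unfolding bichar_def mult.assoc
    by (rule eqv_mult[OF eqv_refl], intro eqv_sum, rule eqv_mult[OF eqv_refl])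
      (meson assms eqv_comm_power eqv_sym)
  also have "\<dots> = scal (1 / of_nat n) * (\<Sum>j<n. \<Sum>i<n. scal (inverse q ^ (i * j)) * (W ^ j * U ^ i))"
    by (subst sum.swap) simp
  finally show ?thesis
    by (simp add: bichar_def mult.assoc mult.commute)
qed

text \<open>This moves the twist past z, which exchanges x and y, and past elements that commute
  with both arguments.\<close>

lemma bichar_commute:
  assumes "U * a \<doteq> a * U'" "W * a \<doteq> a * W'"
  shows "bichar n q U W * a \<doteq> a * bichar n q U' W'"
proof -
  have "U ^ i * W ^ j * a \<doteq> a * (U' ^ i * W' ^ j)" for i j
  proof -
    have "U ^ i * W ^ j * a = U ^ i * (W ^ j * a)" by (simp add: mult.assoc)
    also have "\<dots> \<doteq> U ^ i * (a * W' ^ j)" by (intro eqv_mult eqv_refl eqv_comm_power assms)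
    also have "\<dots> = U ^ i * a * W' ^ j" by (simp add: mult.assoc)
    also have "\<dots> \<doteq> a * U' ^ i * W' ^ j" by (intro eqv_mult eqv_refl eqv_comm_power assms)
    finally show ?thesis by (simp add: mult.assoc)
  qed
  then have "scal (1 / of_nat n) * (\<Sum>i<n. \<Sum>j<n. scal (inverse q ^ (i * j)) * (U ^ i * W ^ j * a)) \<doteq>
      scal (1 / of_nat n) * (\<Sum>i<n. \<Sum>j<n. scal (inverse q ^ (i * j)) * (a * (U' ^ i * W' ^ j)))"
    by (intro eqv_mult[OF eqv_refl] eqv_sum)
  moreover have "bichar n q U W * a = scal (1 / of_nat n) * (\<Sum>i<n. \<Sum>j<n. scal (inverse q ^ (i * j)) * (U ^ i * W ^ j * a))"
    by (simp add: bichar_def sum_distrib_right mult.assoc)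
  moreover have "a * bichar n q U' W' = scal (1 / of_nat n) * (\<Sum>i<n. \<Sum>j<n. scal (inverse q ^ (i * j)) * (a * (U' ^ i * W' ^ j)))"
    by (simp add: bichar_def sum_distrib_left mult.assoc scal_left_commute[of a])
  ultimately show ?thesis by simp
qed

text \<open>The product is a convolution: with s = i + k modulo n, the summation over i becomes an
  orthogonality relation that forces l = j and yields a factor n, which cancels one of the two
  factors 1/n.\<close>

lemma bichar_mult_right:
  assumes U: "U ^ n \<doteq> 1" and XW: "W * U \<doteq> U * W" and WW: "W * W' \<doteq> W' * W"
  shows "bichar n q U W * bichar n q U W' \<doteq> bichar n q U (W * W')"
proof -
  let ?c = "1 / of_nat n :: 'k"
  define p where "p = inverse q"
  have p: "p ^ n = 1" "q ^ k * p ^ k = 1" for k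
    using q_n q_nz by (simp_all add: p_def power_inverse)
  have pm: "p ^ ((a mod n) * b) = p ^ (a * b)" for a b
  proof -
    have "p ^ a = (p ^ n) ^ (a div n) * p ^ (a mod n)" by (simp flip: power_mult power_add)
    then show ?thesis by (simp add: p power_mult)
  qed
  let ?T = "\<lambda>i j k l. U ^ i * W ^ j * (U ^ k * W' ^ l)"
  let ?G = "\<lambda>j l s. U ^ s * (W ^ j * W' ^ l)"
  have T: "?T i j k l \<doteq> ?G j l ((i + k) mod n)" for i j k l
  proof -
    have "?T i j k l = U ^ i * (W ^ j * U ^ k) * W' ^ l" by (simp add: mult.assoc)
    also have "\<dots> \<doteq> U ^ i * (U ^ k * W ^ j) * W' ^ l"
    proof (rule eqv_mult[OF eqv_mult[OF eqv_refl] eqv_refl])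
      have "U ^ k * W \<doteq> W * U ^ k" by (meson eqv_comm_power eqv_sym XW)
      then show "W ^ j * U ^ k \<doteq> U ^ k * W ^ j" by (meson eqv_comm_power eqv_sym)
    qed
    also have "\<dots> = U ^ (i + k) * (W ^ j * W' ^ l)" by (simp add: mult.assoc power_add)
    also have "\<dots> \<doteq> ?G j l ((i + k) mod n)" by (intro eqv_mult eqv_refl eqv_power_mod U)
    finally show ?thesis .
  qed
  have "bichar n q U W * bichar n q U W' =
      (scal ?c * scal ?c) * (\<Sum>i<n. \<Sum>j<n. \<Sum>k<n. \<Sum>l<n. scal (p ^ (i * j) * p ^ (k * l)) * ?T i j k l)"
  proof -
    have 1: "scal a * f * g * (scal b * f' * g') = scal (a * b) * (f * g * (f' * g'))" for a b and f g f' g' :: "'m \<Rightarrow>\<^sub>0 'k"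
      using scal_left_commute[of "f * g" b "f' * g'"] by (simp add: mult.assoc scal_mult)
    have 2: "scal ?c * A * (scal ?c * B) = (scal ?c * scal ?c) * (A * B)" for A B :: "'m \<Rightarrow>\<^sub>0 'k"
      using scal_left_commute[of A ?c B] by (simp add: mult.assoc)
    have 3: "(\<Sum>i<n. \<Sum>j<n. f i j) * (\<Sum>k<n. \<Sum>l<n. g k l) = (\<Sum>i<n. \<Sum>j<n. \<Sum>k<n. \<Sum>l<n. f i j * g k l)"
      for f g :: "_ \<Rightarrow> _ \<Rightarrow> 'm \<Rightarrow>\<^sub>0 'k"
      unfolding sum_distrib_right unfolding sum_distrib_left ..
    show ?thesis
      unfolding bichar_def 2 3 1 p_def ..
  qed
  also have "\<dots> \<doteq> (scal ?c * scal ?c) * (\<Sum>i<n. \<Sum>j<n. \<Sum>k<n. \<Sum>l<n. scal (p ^ (i * j) * p ^ (k * l)) * ?G j l ((i + k) mod n))"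
    by (intro eqv_mult eqv_sum eqv_refl T)
  \<comment> \<open>The index \<open>s\<close> replaces \<open>(i + k) mod n\<close>. The change in
    the exponent of \<open>p\<close> is compensated by \<open>q ^ (i * l)\<close>, because
    \<open>p\<close> is the inverse of \<open>q\<close>.\<close>
  also have "\<dots> = (scal ?c * scal ?c) * (\<Sum>i<n. \<Sum>j<n. \<Sum>l<n. \<Sum>s<n. scal (q ^ (i * l) * p ^ (i * j) * p ^ (s * l)) * ?G j l s)"
  proof -
    have "(\<Sum>k<n. \<Sum>l<n. scal (p ^ (i * j) * p ^ (k * l)) * ?G j l ((i + k) mod n)) =
      (\<Sum>l<n. \<Sum>s<n. scal (q ^ (i * l) * p ^ (i * j) * p ^ (s * l)) * ?G j l s)" for i j
    proof -
      have "(\<Sum>k<n. scal (p ^ (i * j) * p ^ (k * l)) * ?G j l ((i + k) mod n)) =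
        (\<Sum>s<n. scal (q ^ (i * l) * p ^ (i * j) * p ^ (s * l)) * ?G j l s)" for l
      proof -
        have "p ^ (i * j) * p ^ (k * l) = q ^ (i * l) * p ^ (i * j) * p ^ (((i + k) mod n) * l)" for k
          using p(2)[of "i * l"] by (simp add: pm distrib_right power_add) algebra
        then show ?thesis
          using sum_shift_mod[OF n_pos, of "\<lambda>s. scal (q ^ (i * l) * p ^ (i * j) * p ^ (s * l)) * ?G j l s" i]
          by (simp only:)
      qed
      then show ?thesis by (subst sum.swap) simp
    qed
    then show ?thesis by simp
  qed
  also have "\<dots> = (scal ?c * scal ?c) * (\<Sum>j<n. \<Sum>l<n. \<Sum>s<n. \<Sum>i<n. scal (q ^ (i * l) * p ^ (i * j) * p ^ (s * l)) * ?G j l s)"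
  proof -
    have swap: "(\<Sum>i<n. \<Sum>j<n. \<Sum>l<n. \<Sum>s<n. f i j l s) = (\<Sum>j<n. \<Sum>l<n. \<Sum>s<n. \<Sum>i<n. f i j l s)"
      for f :: "_ \<Rightarrow> _ \<Rightarrow> _ \<Rightarrow> _ \<Rightarrow> 'm \<Rightarrow>\<^sub>0 'k"
    proof -
      have "(\<Sum>i<n. \<Sum>j<n. \<Sum>l<n. \<Sum>s<n. f i j l s) = (\<Sum>j<n. \<Sum>i<n. \<Sum>l<n. \<Sum>s<n. f i j l s)"
        by (rule sum.swap)
      also have "\<dots> = (\<Sum>j<n. \<Sum>l<n. \<Sum>i<n. \<Sum>s<n. f i j l s)"
        by (rule sum.cong[OF refl], rule sum.swap)
      also have "\<dots> = (\<Sum>j<n. \<Sum>l<n. \<Sum>s<n. \<Sum>i<n. f i j l s)"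
        by (rule sum.cong[OF refl], rule sum.cong[OF refl], rule sum.swap)
      finally show ?thesis .
    qed
    show ?thesis by (rule arg_cong[where f = "(*) _"], rule swap)
  qed
  also have "\<dots> = (scal ?c * scal ?c) * (\<Sum>j<n. \<Sum>l<n. \<Sum>s<n. scal ((if l = j then of_nat n else 0) * p ^ (s * l)) * ?G j l s)"
    using primitive_root_orthogonality[OF prim n_pos]
    by (intro arg_cong2[of _ _ _ _ "(*)"] sum.cong refl)
      (simp add: p_def flip: sum_distrib_right scal_sum)
  also have "\<dots> = (scal ?c * scal ?c) * (\<Sum>j<n. \<Sum>s<n. scal (of_nat n * p ^ (s * j)) * ?G j j s)"
  proof -
    have "(\<Sum>l<n. \<Sum>s<n. scal ((if l = j then of_nat n else 0) * p ^ (s * l)) * ?G j l s) =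
       (\<Sum>l<n. if l = j then \<Sum>s<n. scal (of_nat n * p ^ (s * j)) * ?G j j s else 0)" for j
      by (intro sum.cong) auto
    then show ?thesis by simp
  qed
  also have "\<dots> = scal ?c * (\<Sum>j<n. \<Sum>s<n. scal (p ^ (s * j)) * ?G j j s)"
  proof -
    have "scal ?c * (scal (of_nat n * a) * g) = scal a * g" for a and g :: "'m \<Rightarrow>\<^sub>0 'k"
      using n_nz by (simp flip: mult.assoc scal_mult)
    then show ?thesis by (simp add: mult.assoc sum_distrib_left)
  qed
  also have "\<dots> \<doteq> scal ?c * (\<Sum>j<n. \<Sum>s<n. scal (p ^ (s * j)) * (U ^ s * (W * W') ^ j))"
    by (intro eqv_mult eqv_sum eqv_refl eqv_sym[OF eqv_power_mult] WW)
  also have "\<dots> = bichar n q U (W * W')"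
    unfolding bichar_def p_def by (subst sum.swap) (simp add: mult.assoc)
  finally show ?thesis .
qed

text \<open>The mirror image of \<open>bichar_mult_right\<close>, obtained through
  \<open>bichar_sym\<close>.\<close>

lemma bichar_mult_left:
  assumes W: "W ^ n \<doteq> 1" and XW: "U * W \<doteq> W * U" and XW': "U' * W \<doteq> W * U'" and UU: "U * U' \<doteq> U' * U"
  shows "bichar n q U W * bichar n q U' W \<doteq> bichar n q (U * U') W"
proof -
  have "U * U' * W \<doteq> W * (U * U')"
  proof -
    have "U * U' * W = U * (U' * W)" by (simp add: mult.assoc)
    also have "\<dots> \<doteq> U * (W * U')" by (intro eqv_mult eqv_refl XW')
    also have "\<dots> = U * W * U'" by (simp add: mult.assoc)
    also have "\<dots> \<doteq> W * U * U'" by (intro eqv_mult eqv_refl XW)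
    finally show ?thesis by (simp add: mult.assoc)
  qed
  moreover have "bichar n q U W * bichar n q U' W \<doteq> bichar n q W U * bichar n q W U'"
    by (intro eqv_mult bichar_sym XW XW')
  moreover have "bichar n q W U * bichar n q W U' \<doteq> bichar n q W (U * U')"
    by (intro bichar_mult_right W XW UU)
  ultimately show ?thesis
    by (meson bichar_sym eqv_sym eqv_trans)
qed

end

subsection \<open>Comultiplication and counit\<close>

abbreviation Delta :: "nat \<Rightarrow> 'k::field \<Rightarrow> 'k free_alg \<Rightarrow> 'k free_alg2" where
  "Delta n q \<equiv> free_ext scal (comult_gen n q)"

interpretation Delta: algebra_hom "Delta n q"
  by unfold_locales (rule scal.free_ext_add scal.free_ext_mult scal.free_ext_scal)+

lemma comult_gen_Lz: "comult_gen n q Lz = bichar n q (tens fx 1) (tens 1 fy) * tens fz fz"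
  by (simp add: bichar_def tens_power tens_mult sum_distrib_right mult.assoc)

lemma Delta_gen: "Delta n q fx = tens fx fx" "Delta n q fy = tens fy fy"
    "Delta n q fz = bichar n q (tens fx 1) (tens 1 fy) * tens fz fz"
  using comult_gen_Lz[of n q] by (simp_all add: scal.free_ext_gen)

lemma H_rels_bichar:
  "H_rels n q = {fx ^ n - 1, fy ^ n - 1, fx * fy - fy * fx, fz * fx - fy * fz, fz * fy - fx * fz,
     fz ^ 2 - bichar n q fx fy}"
  by (simp add: H_rels_def bichar_def)

locale hopf_data =
  fixes n :: nat and q p :: "'k::field"
  assumes n_gt_1: "n > 1" and q_prim: "primitive_root_of_unity n q"
    and two_nz: "(2 :: 'k) \<noteq> 0" and of_nat_n_nz: "(of_nat n :: 'k) \<noteq> 0"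
    and p_sq: "p\<^sup>2 = q" and even_n: "even n"
begin

sublocale H: algebra_ideal "H_ideal n q" n q
  using two_sided_ideal_genideal q_prim n_gt_1 of_nat_n_nz
  by (simp add: H_ideal_def algebra_ideal_def algebra_ideal_axioms_def)

sublocale HH: algebra_ideal "HH_ideal n q" n q
  using two_sided_ideal_genideal q_prim n_gt_1 of_nat_n_nz
  by (simp add: HH_ideal_def algebra_ideal_def algebra_ideal_axioms_def)

lemma H_rels_eqv:
  "H.eqv (fx ^ n) 1" "H.eqv (fy ^ n) 1" "H.eqv (fx * fy) (fy * fx)" "H.eqv (fz * fx) (fy * fz)"
  "H.eqv (fz * fy) (fx * fz)" "H.eqv (fz ^ 2) (bichar n q fx fy)"
  unfolding H.eqv_def unfolding H_ideal_def
  by (rule subsetD[OF subset_genideal], simp add: H_rels_bichar)+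

lemma HH_eqv_tens:
  assumes "H.eqv f f'" "H.eqv g g'" shows "HH.eqv (tens f g) (tens f' g')"
proof -
  have "tens (f - f') 1 \<in> HH_ideal n q" "tens 1 (g - g') \<in> HH_ideal n q"
    using assms unfolding HH_ideal_def H.eqv_def
    by (auto intro!: subsetD[OF subset_genideal])
  then have "HH.eqv (tens f 1) (tens f' 1)" "HH.eqv (tens 1 g) (tens 1 g')"
    by (simp_all add: HH.eqv_def tens_left.hom_diff tens_right.hom_diff)
  then show ?thesis
    unfolding tens_split[of f g] tens_split[of f' g'] by (rule HH.eqv_mult)
qed

text \<open>Moving Z = z \<otimes> z past the second twist turns \<open>?B U W'\<close> into
  \<open>?B W U'\<close>, since z exchanges x and y in each tensor factor. Together with the square
  of Z, which is \<open>?B U W * ?B U' W'\<close>, each of U, U' is paired exactly once with each of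
  W, W', and bimultiplicativity collects the four factors into
  \<open>?B (U * U') (W * W')\<close>.\<close>

lemma Delta_z_sq: "HH.eqv (Delta n q fz ^ 2) (bichar n q (Delta n q fx) (Delta n q fy))"
proof -
  let ?x = "fx :: 'k free_alg" and ?y = "fy :: 'k free_alg" and ?z = "fz :: 'k free_alg"
  let ?B = "bichar n q"
  define U where "U = tens ?x 1"
  define W where "W = tens ?y 1"
  define U' where "U' = tens 1 ?x"
  define W' where "W' = tens 1 ?y"
  define Z where "Z = tens ?z ?z"
  note defs = U_def W_def U'_def W'_def Z_def
  have pow: "HH.eqv (U ^ n) 1" "HH.eqv (W ^ n) 1" "HH.eqv (U' ^ n) 1" "HH.eqv (W' ^ n) 1"
    using HH_eqv_tens[OF H_rels_eqv(1) H.eqv_refl[of 1]] HH_eqv_tens[OF H_rels_eqv(2) H.eqv_refl[of 1]]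
      HH_eqv_tens[OF H.eqv_refl[of 1] H_rels_eqv(1)] HH_eqv_tens[OF H.eqv_refl[of 1] H_rels_eqv(2)]
    by (simp_all add: defs tens_power)
  have UW: "HH.eqv (U * W) (W * U)" "HH.eqv (U' * W') (W' * U')"
    using HH_eqv_tens[OF H_rels_eqv(3) H.eqv_refl[of 1]] HH_eqv_tens[OF H.eqv_refl[of 1] H_rels_eqv(3)]
    by (simp_all add: defs tens_mult)
  have comm: "U * U' = U' * U" "U * W' = W' * U" "W * U' = U' * W" "W * W' = W' * W"
    by (simp_all add: defs tens_mult)
  have comm': "HH.eqv (U * U') (U' * U)" "HH.eqv (U * W') (W' * U)" "HH.eqv (W * U') (U' * W)" "HH.eqv (W * W') (W' * W)"
    by (simp_all add: comm)
  note c = UW comm' UW[THEN HH.eqv_sym] comm'[THEN HH.eqv_sym] HH.eqv_refl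
  have ZU: "HH.eqv (W * Z) (Z * U)" "HH.eqv (U' * Z) (Z * W')"
    using HH_eqv_tens[OF H.eqv_sym[OF H_rels_eqv(4)] H.eqv_refl[of ?z]]
      HH_eqv_tens[OF H.eqv_refl[of ?z] H.eqv_sym[OF H_rels_eqv(5)]]
    by (simp_all add: defs tens_mult)
  have ZZ: "HH.eqv (Z * Z) (?B U W * ?B U' W')"
    using HH_eqv_tens[OF H_rels_eqv(6) H_rels_eqv(6)]
    unfolding tens_split[of "bichar n q ?x ?y" "bichar n q ?x ?y"]
    by (simp add: defs tens_mult power2_eq_square tens_left.hom_bichar tens_right.hom_bichar)
  have "Delta n q fz ^ 2 = ?B U W' * (Z * ?B U W') * Z"
    by (simp add: Delta_gen defs power2_eq_square mult.assoc)
  also have "HH.eqv \<dots> (?B U W' * (?B W U' * Z) * Z)"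
    by (rule HH.eqv_mult[OF HH.eqv_mult[OF HH.eqv_refl] HH.eqv_refl],
        rule HH.eqv_sym, rule HH.bichar_commute[OF ZU])
  also have "\<dots> = ?B U W' * ?B W U' * (Z * Z)" by (simp add: mult.assoc)
  also have "HH.eqv \<dots> (?B U W' * ?B U' W * (?B U W * ?B U' W'))"
    by (rule HH.eqv_mult[OF HH.eqv_mult[OF HH.eqv_refl HH.bichar_sym] ZZ]) (rule c)
  also have "\<dots> = ?B U W' * (?B U' W * ?B U W) * ?B U' W'" by (simp add: mult.assoc)
  also have "HH.eqv \<dots> (?B U W' * (?B U W * ?B U' W) * ?B U' W')"
  proof (rule HH.eqv_mult[OF HH.eqv_mult[OF HH.eqv_refl] HH.eqv_refl])
    have "HH.eqv (U * ?B U' W) (?B U' W * U)" "HH.eqv (W * ?B U' W) (?B U' W * W)"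
      by (rule HH.eqv_sym, rule HH.bichar_commute, (rule c)+)+
    then show "HH.eqv (?B U' W * ?B U W) (?B U W * ?B U' W)"
      by (intro HH.eqv_sym[OF HH.bichar_commute[of U "?B U' W" U W W]])
  qed
  also have "\<dots> = (?B U W' * ?B U W) * (?B U' W * ?B U' W')" by (simp add: mult.assoc)
  also have "HH.eqv \<dots> (?B U (W' * W) * ?B U' (W * W'))"
    by (rule HH.eqv_mult[OF HH.bichar_mult_right HH.bichar_mult_right]) (rule pow c)+
  also have "\<dots> = ?B U (W * W') * ?B U' (W * W')" by (simp add: comm)
  also have "HH.eqv \<dots> (?B (U * U') (W * W'))"
  proof (rule HH.bichar_mult_left)
    show "HH.eqv ((W * W') ^ n) 1"
      using HH_eqv_tens[OF H_rels_eqv(2) H_rels_eqv(2)] by (simp add: defs tens_mult tens_power)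
    have "HH.eqv (tens (?x * ?y) ?y) (tens (?y * ?x) ?y)" "HH.eqv (tens ?y (?x * ?y)) (tens ?y (?y * ?x))"
      by (intro HH_eqv_tens H_rels_eqv H.eqv_refl)+
    then show "HH.eqv (U * (W * W')) (W * W' * U)" "HH.eqv (U' * (W * W')) (W * W' * U')"
      by (simp_all add: defs tens_mult)
  qed (rule c)
  also have "\<dots> = ?B (Delta n q fx) (Delta n q fy)" by (simp add: defs Delta_gen tens_mult)
  finally show ?thesis .
qed

text \<open>A preimage of an ideal is an ideal, so only the relations have to be checked. In the two
  relations that move z, the twist \<open>?J\<close> must pass the group-like elements, which it
  does because x and y commute.\<close>

lemma Delta_ideal:
  assumes "f \<in> H_ideal n q" shows "Delta n q f \<in> HH_ideal n q"
proof -
  have "two_sided_ideal {f. Delta n q f \<in> HH_ideal n q}"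
    by unfold_locales
      (simp_all add: Delta.hom_0 Delta.hom_add Delta.hom_mult HH.add HH.left HH.right)
  moreover have "H_rels n q \<subseteq> {f. Delta n q f \<in> HH_ideal n q}"
  proof -
    let ?x = "fx :: 'k free_alg" and ?y = "fy :: 'k free_alg" and ?z = "fz :: 'k free_alg"
    let ?J = "bichar n q (tens ?x 1) (tens 1 ?y)"
    have 1: "HH.eqv (Delta n q (fx ^ n)) (Delta n q 1)" "HH.eqv (Delta n q (fy ^ n)) (Delta n q 1)"
      using HH_eqv_tens[OF H_rels_eqv(1) H_rels_eqv(1)] HH_eqv_tens[OF H_rels_eqv(2) H_rels_eqv(2)]
      by (simp_all add: Delta.hom_power Delta.hom_1 Delta_gen tens_power)
    have 2: "HH.eqv (Delta n q (fx * fy)) (Delta n q (fy * fx))"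
      using HH_eqv_tens[OF H_rels_eqv(3) H_rels_eqv(3)]
      by (simp add: Delta.hom_mult Delta_gen tens_mult)
    have J: "HH.eqv (?J * tens ?y ?y) (tens ?y ?y * ?J)" "HH.eqv (?J * tens ?x ?x) (tens ?x ?x * ?J)"
      by (rule HH.bichar_commute; simp add: tens_mult HH_eqv_tens H_rels_eqv H.eqv_sym[OF H_rels_eqv(3)])+
    have "HH.eqv (Delta n q (fz * fx)) (Delta n q (fy * fz))"
    proof -
      have "Delta n q (fz * fx) = ?J * tens (?z * ?x) (?z * ?x)"
        by (simp add: Delta.hom_mult Delta_gen tens_mult mult.assoc)
      also have "HH.eqv \<dots> (?J * tens (?y * ?z) (?y * ?z))"
        by (rule HH.eqv_mult[OF HH.eqv_refl HH_eqv_tens]) (rule H_rels_eqv)+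
      also have "\<dots> = ?J * tens ?y ?y * tens ?z ?z" by (simp add: tens_mult mult.assoc)
      also have "HH.eqv \<dots> (tens ?y ?y * ?J * tens ?z ?z)"
        by (intro HH.eqv_mult J HH.eqv_refl)
      finally show ?thesis by (simp add: Delta.hom_mult Delta_gen mult.assoc)
    qed
    moreover have "HH.eqv (Delta n q (fz * fy)) (Delta n q (fx * fz))"
    proof -
      have "Delta n q (fz * fy) = ?J * tens (?z * ?y) (?z * ?y)"
        by (simp add: Delta.hom_mult Delta_gen tens_mult mult.assoc)
      also have "HH.eqv \<dots> (?J * tens (?x * ?z) (?x * ?z))"
        by (rule HH.eqv_mult[OF HH.eqv_refl HH_eqv_tens]) (rule H_rels_eqv)+
      also have "\<dots> = ?J * tens ?x ?x * tens ?z ?z" by (simp add: tens_mult mult.assoc)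
      also have "HH.eqv \<dots> (tens ?x ?x * ?J * tens ?z ?z)"
        by (intro HH.eqv_mult J HH.eqv_refl)
      finally show ?thesis by (simp add: Delta.hom_mult Delta_gen mult.assoc)
    qed
    ultimately show ?thesis
      using 1 2 Delta_z_sq
      by (simp add: H_rels_bichar HH.eqv_def Delta.hom_diff Delta.hom_power Delta.hom_bichar)
  qed
  ultimately show ?thesis
    using genideal_subset assms unfolding H_ideal_def by blast
qed

lemma H_cls_eq_iff: "H_cls n q f = H_cls n q g \<longleftrightarrow> H.eqv f g"
  unfolding H_cls_def by (rule H.coset_eq_iff)

lemma on_coset_H_cls:
  "(\<And>g. H.eqv g f \<Longrightarrow> \<phi> g = \<phi> f) \<Longrightarrow> on_coset \<phi> (H_cls n q f) = \<phi> f"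
  unfolding H_cls_def by (rule H.on_coset_eq)

lemma comult_H_cls: "comult n q (H_cls n q f) = HH_cls n q (Delta n q f)"
  unfolding comult_def
proof (rule on_coset_H_cls)
  fix g assume "H.eqv g f"
  then show "HH_cls n q (Delta n q g) = HH_cls n q (Delta n q f)"
    using Delta_ideal[of "g - f"]
    by (simp add: HH_cls_def HH.coset_eq_iff HH.eqv_def H.eqv_def Delta.hom_diff)
qed

text \<open>The inner sum vanishes unless i = 0. This makes the counit of the right-hand side of the
  relation for the square of z equal to 1.\<close>

lemma sum_inverse_q: "(\<Sum>i<n. \<Sum>j<n. inverse q ^ (i * j)) = of_nat n"
proof -
  have "(\<Sum>j<n. inverse q ^ (i * j)) = (if i = 0 then of_nat n else 0)" if "i < n" for i
    using primitive_root_orthogonality[OF q_prim, of 0 i] n_gt_1 that by (simp add: mult.commute)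
  then show ?thesis using n_gt_1 by simp
qed

lemma counit_ideal:
  assumes "f \<in> H_ideal n q" shows "free_ext (\<lambda>c. c) (\<lambda>_. 1) f = 0"
proof -
  let ?e = "free_ext (\<lambda>c::'k. c) (\<lambda>_. 1)"
  have m: "two_sided_ideal {f. ?e f = 0}"
    by unfold_locales (simp_all add: ground.free_ext_0 ground.free_ext_add ground.free_ext_mult)
  have e_minus: "?e (f - g) = ?e f - ?e g" for f g
    using ground.free_ext_add[of _ "f - g" g] by (simp add: algebra_simps)
  have e_power: "?e (f ^ k) = ?e f ^ k" for f k
    by (induction k) (use ground.free_ext_scal[of "\<lambda>_. 1" 1] in \<open>simp_all add: ground.free_ext_mult\<close>)
  have e_sum: "?e (sum f A) = (\<Sum>i\<in>A. ?e (f i))" for f and A :: "nat set"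
    by (induction A rule: infinite_finite_induct) (simp_all add: ground.free_ext_0 ground.free_ext_add)
  have e_bichar: "?e (bichar n q fx fy) = 1"
    using sum_inverse_q of_nat_n_nz
    by (simp add: bichar_def ground.free_ext_mult e_sum e_power ground.free_ext_scal ground.free_ext_gen)
  have "H_rels n q \<subseteq> {f. ?e f = 0}"
    using ground.free_ext_scal[of "\<lambda>_. 1" 1]
    by (simp add: H_rels_bichar e_minus e_power ground.free_ext_mult ground.free_ext_gen e_bichar)
  then show ?thesis
    using genideal_subset[OF m] assms unfolding H_ideal_def by blast
qed

lemma counit_H_cls: "counit (H_cls n q f) = free_ext (\<lambda>c. c) (\<lambda>_. 1) f"
  unfolding counit_def
proof (rule on_coset_H_cls)
  fix g assume "H.eqv g f"
  then have "free_ext (\<lambda>c. c) (\<lambda>_. 1) (g - f) = (0::'k)"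
    by (intro counit_ideal) (simp add: H.eqv_def)
  then show "free_ext (\<lambda>c. c) (\<lambda>_. 1) g = free_ext (\<lambda>c. c) (\<lambda>_. 1 :: 'k) f"
    using ground.free_ext_add[of "\<lambda>_. 1" "g - f" f] by simp
qed

lemma H_alg_carrier: "carrier (H_alg n q) = range (H_cls n q)"
  by (auto simp: H_alg_def FactRing_def A_RCOSETS_def' H_cls_def)

lemma H_ideal_ideal: "ideal (H_ideal n q) ring_of_type_algebra"
  using H.two_sided_ideal_axioms two_sided_ideal_iff_ideal by blast

lemma H_alg_mult: "H_cls n q f \<otimes>\<^bsub>H_alg n q\<^esub> H_cls n q g = H_cls n q (f * g)"
  using ideal.rcoset_mult_add[OF H_ideal_ideal, of f g]
  by (simp add: H_alg_def FactRing_def H_cls_def)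

lemma H_alg_add: "H_cls n q f \<oplus>\<^bsub>H_alg n q\<^esub> H_cls n q g = H_cls n q (f + g)"
  using abelian_subgroup.a_rcos_sum[OF
      abelian_subgroupI3[OF ideal.axioms(1)[OF H_ideal_ideal] ring.is_abelian_group[OF ring_ring_of_type_algebra]],
      of f g]
  by (simp add: H_alg_def FactRing_def H_cls_def)

lemma H_alg_one: "\<one>\<^bsub>H_alg n q\<^esub> = H_cls n q 1"
  by (simp add: H_alg_def FactRing_def H_cls_def)

end

subsection \<open>Kronecker products\<close>

lemma mult_mat_index:
  assumes "A \<in> carrier_mat a b" "B \<in> carrier_mat b c" "i < a" "j < c"
  shows "(A * B) $$ (i, j) = (\<Sum>k<b. A $$ (i, k) * B $$ (k, j))"
  using assms by (simp add: scalar_prod_def lessThan_atLeast0)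

text \<open>Splitting \<open>k\<close> into quotient and remainder is the index convention of
  \<open>kron_mat\<close>.\<close>

lemma sum_div_mod:
  fixes m n :: nat
  shows "(\<Sum>k<m * n. f (k div n) (k mod n)) = (\<Sum>a<m. \<Sum>b<n. f a b)"
proof (cases "n = 0")
  case False
  have lt: "a * n + b < m * n" if "a < m" "b < n" for a b
  proof -
    have "a * n + b < (a + 1) * n" using that by simp
    also have "\<dots> \<le> m * n" using that by (intro mult_le_mono1) simp
    finally show ?thesis .
  qed
  show ?thesis
    unfolding sum.cartesian_product
    by (rule sum.reindex_bij_witness[of _ "\<lambda>(a, b). a * n + b" "\<lambda>k. (k div n, k mod n)"])
      (use False lt in \<open>auto simp: less_mult_imp_div_less\<close>)
qed simp

lemma div_mod_less:
  assumes "i < a * (b :: nat)" shows "i div b < a" "i mod b < b"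
  using assms by (simp add: less_mult_imp_div_less) (use assms in \<open>cases "b = 0"; simp\<close>)

lemma kron_mat_carrier [intro]:
  "A \<in> carrier_mat a b \<Longrightarrow> B \<in> carrier_mat c d \<Longrightarrow> kron_mat A B \<in> carrier_mat (a * c) (b * d)"
  by (simp add: kron_mat_def)

lemma kron_mat_index:
  assumes "A \<in> carrier_mat a b" "B \<in> carrier_mat c d" "i < a * c" "j < b * d"
  shows "kron_mat A B $$ (i, j) = A $$ (i div c, j div d) * B $$ (i mod c, j mod d)"
  using assms by (simp add: kron_mat_def)

lemma kron_mat_mult:
  assumes A: "A \<in> carrier_mat a b" and C: "C \<in> carrier_mat b c"
    and B: "B \<in> carrier_mat d e" and D: "D \<in> carrier_mat e f"
  shows "kron_mat A B * kron_mat C D = kron_mat (A * C) (B * D)"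
proof (rule eq_matI)
  have AB: "kron_mat A B \<in> carrier_mat (a * d) (b * e)" and CD: "kron_mat C D \<in> carrier_mat (b * e) (c * f)"
    and AC: "A * C \<in> carrier_mat a c" and BD: "B * D \<in> carrier_mat d f"
    using assms by auto
  have R: "kron_mat (A * C) (B * D) \<in> carrier_mat (a * d) (c * f)" using AC BD by auto
  show "dim_row (kron_mat A B * kron_mat C D) = dim_row (kron_mat (A * C) (B * D))"
    "dim_col (kron_mat A B * kron_mat C D) = dim_col (kron_mat (A * C) (B * D))"
    using AB CD R by auto
  fix i j assume "i < dim_row (kron_mat (A * C) (B * D))" "j < dim_col (kron_mat (A * C) (B * D))"
  then have ij: "i < a * d" "j < c * f" using R by auto
  note dm = div_mod_less[OF ij(1)] div_mod_less[OF ij(2)]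
  have "(kron_mat A B * kron_mat C D) $$ (i, j) =
    (\<Sum>k<b * e. A $$ (i div d, k div e) * B $$ (i mod d, k mod e) * (C $$ (k div e, j div f) * D $$ (k mod e, j mod f)))"
    by (subst mult_mat_index[OF AB CD ij], intro sum.cong refl)
      (simp add: kron_mat_index[OF A B ij(1)] kron_mat_index[OF C D _ ij(2)])
  also have "\<dots> = (\<Sum>k<b. \<Sum>l<e. A $$ (i div d, k) * B $$ (i mod d, l) * (C $$ (k, j div f) * D $$ (l, j mod f)))"
    by (rule sum_div_mod)
  also have "\<dots> = (\<Sum>k<b. A $$ (i div d, k) * C $$ (k, j div f)) * (\<Sum>l<e. B $$ (i mod d, l) * D $$ (l, j mod f))"
    by (simp add: sum_product mult_ac)
  also have "\<dots> = kron_mat (A * C) (B * D) $$ (i, j)"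
    by (simp add: kron_mat_index[OF AC BD ij] mult_mat_index[OF A C dm(1) dm(3)] mult_mat_index[OF B D dm(2) dm(4)]
        del: index_mult_mat)
  finally show "(kron_mat A B * kron_mat C D) $$ (i, j) = kron_mat (A * C) (B * D) $$ (i, j)" .
qed

lemma kron_mat_one: "kron_mat (1\<^sub>m a) (1\<^sub>m b) = 1\<^sub>m (a * b)"
proof (rule eq_matI)
  fix i j assume "i < dim_row (1\<^sub>m (a * b))" "j < dim_col (1\<^sub>m (a * b))"
  then have ij: "i < a * b" "j < a * b" by auto
  note dm = div_mod_less[OF ij(1)] div_mod_less[OF ij(2)]
  have "i div b = j div b \<Longrightarrow> i mod b = j mod b \<Longrightarrow> i = j" by (metis div_mult_mod_eq)
  then show "kron_mat (1\<^sub>m a) (1\<^sub>m b) $$ (i, j) = 1\<^sub>m (a * b) $$ (i, j)"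
    using dm ij by (auto simp: kron_mat_index[of "1\<^sub>m a" a a "1\<^sub>m b" b b])
qed (auto simp: kron_mat_def)

lemma kron_mat_zero:
  "B \<in> carrier_mat c d \<Longrightarrow> kron_mat (0\<^sub>m a b) B = 0\<^sub>m (a * c) (b * d)"
  "B \<in> carrier_mat c d \<Longrightarrow> kron_mat B (0\<^sub>m a b) = 0\<^sub>m (c * a) (d * b)"
  by (auto intro!: eq_matI simp: kron_mat_def div_mod_less)

lemma kron_mat_add_left:
  "A \<in> carrier_mat a b \<Longrightarrow> A' \<in> carrier_mat a b \<Longrightarrow> kron_mat (A + A') B = kron_mat A B + kron_mat A' B"
  by (auto intro!: eq_matI simp: kron_mat_def div_mod_less distrib_right)

lemma kron_mat_add_right:
  "B \<in> carrier_mat a b \<Longrightarrow> B' \<in> carrier_mat a b \<Longrightarrow> kron_mat A (B + B') = kron_mat A B + kron_mat A B'"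
  by (auto intro!: eq_matI simp: kron_mat_def div_mod_less distrib_left)

lemma kron_mat_smult:
  "kron_mat (c \<cdot>\<^sub>m A) (d \<cdot>\<^sub>m B) = (c * d) \<cdot>\<^sub>m kron_mat A B"
  by (auto intro!: eq_matI simp: kron_mat_def div_mod_less)

subsection \<open>Matrix representations\<close>

text \<open>The exponent monoid is left open so that the same facts serve the free algebra, whose
  representations are the modules, and its tensor square, which acts on tensor products.\<close>

locale matrep =
  fixes d :: nat and R :: "('m::monoid_add \<Rightarrow>\<^sub>0 'k::field) \<Rightarrow> 'k mat"
  assumes carrier [simp, intro]: "R f \<in> carrier_mat d d"
    and add: "R (f + g) = R f + R g"
    and mult: "R (f * g) = R f * R g"
    and scal: "R (scal c) = c \<cdot>\<^sub>m 1\<^sub>m d"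
begin

lemma dim [simp]: "dim_row (R f) = d" "dim_col (R f) = d"
  by (rule carrier_matD[OF carrier])+

lemma one: "R 1 = 1\<^sub>m d"
  using scal[of 1] by (auto intro!: eq_matI)

lemma zero: "R 0 = 0\<^sub>m d d"
  using scal[of 0] by (auto intro!: eq_matI)

lemma scal_mult: "R (scal c * f) = c \<cdot>\<^sub>m R f"
  using mult_smult_assoc_mat[OF one_carrier_mat carrier, of c f] left_mult_one_mat[OF carrier, of f]
  by (simp add: mult scal)

lemma diff: "R (f - g) = R f - R g"
proof -
  have "R f = R (f - g) + R g" by (simp flip: add)
  then show ?thesis by (auto intro!: eq_matI)
qed

lemma sum: "R (sum f A) = mat d d (\<lambda>ij. \<Sum>a\<in>A. R (f a) $$ ij)"
  by (induction A rule: infinite_finite_induct) (auto intro!: eq_matI simp: zero add)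

lemma sum_index: "i < d \<Longrightarrow> j < d \<Longrightarrow> R (sum f A) $$ (i, j) = (\<Sum>a\<in>A. R (f a) $$ (i, j))"
  by (simp add: sum)

lemma power: "R (f ^ k) = R f ^\<^sub>m k"
  by (induction k) (simp_all add: one mult power_Suc2 del: power_Suc)

lemma kernel: "two_sided_ideal {f. R f = 0\<^sub>m d d}"
proof
  show "r * a \<in> {f. R f = 0\<^sub>m d d}" if "a \<in> {f. R f = 0\<^sub>m d d}" for a r
    using that right_mult_zero_mat[OF carrier, of r d] by (simp add: mult)
  show "a * r \<in> {f. R f = 0\<^sub>m d d}" if "a \<in> {f. R f = 0\<^sub>m d d}" for a r
    using that left_mult_zero_mat[OF carrier, of d r] by (simp add: mult)
qed (auto simp: zero add)

end

text \<open>The elements whose actions are intertwined by \<open>P\<close> form a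
  subalgebra.\<close>

lemma intertwiner_generators:
  assumes R: "matrep d R" and S: "matrep e S" and P: "P \<in> carrier_mat e d"
    and gen: "\<And>l. P * R (word_elt (Word [l])) = S (word_elt (Word [l])) * P"
  shows "P * R f = S f * P"
proof (induction f rule: free_alg_induct)
  interpret R: matrep d R by fact
  interpret S: matrep e S by fact
  {
    case (scal c)
    then show ?case using P by (auto simp: R.scal S.scal)
  next
    case (gen l)
    then show ?case by (rule assms(4))
  next
    case (add f g)
    then show ?case
      using mult_add_distrib_mat[OF P R.carrier R.carrier, of f g] add_mult_distrib_mat[OF S.carrier S.carrier P, of f g]
      by (simp add: R.add S.add)
  next
    case (mult f g)
    then show ?case
      using assoc_mult_mat[OF P R.carrier[of f] R.carrier[of g]] assoc_mult_mat[OF S.carrier[of f] S.carrier[of g] P]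
        assoc_mult_mat[OF S.carrier[of f] P R.carrier[of g]]
      by (simp add: R.mult S.mult)
  }
qed

subsection \<open>Complements\<close>

text \<open>
  Blocks with no rows or no columns turn \<open>four_block_mat\<close> into horizontal and vertical concatenation.
\<close>

lemma biproduct_complete:
  fixes B1 :: "'k::field mat"
  assumes B: "B1 \<in> carrier_mat (d + e) d" "B2 \<in> carrier_mat (d + e) e"
    and C: "C1 \<in> carrier_mat d (d + e)" "C2 \<in> carrier_mat e (d + e)"
    and CB: "C1 * B1 = 1\<^sub>m d" "C2 * B2 = 1\<^sub>m e" "C1 * B2 = 0\<^sub>m d e" "C2 * B1 = 0\<^sub>m e d"
  defines "P \<equiv> four_block_mat B1 B2 (0\<^sub>m 0 d) (0\<^sub>m 0 e)"
    and "Q \<equiv> four_block_mat C1 (0\<^sub>m d 0) C2 (0\<^sub>m e 0)"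
  shows "P \<in> carrier_mat (d + e) (d + e)" "Q \<in> carrier_mat (d + e) (d + e)"
    "P * Q = 1\<^sub>m (d + e)" "Q * P = 1\<^sub>m (d + e)" "B1 * C1 + B2 * C2 = 1\<^sub>m (d + e)"
proof -
  have P: "P \<in> carrier_mat (d + e + 0) (d + e)" and Q: "Q \<in> carrier_mat (d + e) (d + e + 0)"
    unfolding P_def Q_def using B C by auto
  then show PQ_carrier: "P \<in> carrier_mat (d + e) (d + e)" "Q \<in> carrier_mat (d + e) (d + e)" by auto
  have "Q * P = four_block_mat (C1 * B1 + 0\<^sub>m d 0 * 0\<^sub>m 0 d) (C1 * B2 + 0\<^sub>m d 0 * 0\<^sub>m 0 e)
      (C2 * B1 + 0\<^sub>m e 0 * 0\<^sub>m 0 d) (C2 * B2 + 0\<^sub>m e 0 * 0\<^sub>m 0 e)"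
    unfolding P_def Q_def using B C by (intro mult_four_block_mat) auto
  also have "\<dots> = four_block_mat (1\<^sub>m d) (0\<^sub>m d e) (0\<^sub>m e d) (1\<^sub>m e)"
    by (simp add: CB)
  finally show QP: "Q * P = 1\<^sub>m (d + e)" by simp
  show PQ: "P * Q = 1\<^sub>m (d + e)"
    by (rule mat_mult_left_right_inverse[OF PQ_carrier(2,1) QP])
  have PQ': "P * Q = four_block_mat (B1 * C1 + B2 * C2) (B1 * 0\<^sub>m d 0 + B2 * 0\<^sub>m e 0)
      (0\<^sub>m 0 d * C1 + 0\<^sub>m 0 e * C2) (0\<^sub>m 0 d * 0\<^sub>m d 0 + 0\<^sub>m 0 e * 0\<^sub>m e 0)"
    unfolding P_def Q_def using B C by (intro mult_four_block_mat) auto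
  show "B1 * C1 + B2 * C2 = 1\<^sub>m (d + e)"
  proof (rule eq_matI)
    fix i j assume "i < dim_row (1\<^sub>m (d + e))" "j < dim_col (1\<^sub>m (d + e))"
    then have ij: "i < d + e" "j < d + e" by auto
    have "(P * Q) $$ (i, j) = (B1 * C1 + B2 * C2) $$ (i, j)"
      unfolding PQ' using ij B C by (subst index_mat_four_block) auto
    then show "(B1 * C1 + B2 * C2) $$ (i, j) = 1\<^sub>m (d + e) $$ (i, j)"
      unfolding PQ by simp
  qed (use B C in auto)
qed

text \<open>The kernel of the functional C is a complement of the line spanned by B. K is a basis of
  that kernel, obtained by solving for one coordinate \<open>i0\<close> at which C is nonzero; L
  reads off the other coordinates after subtracting the component along B.\<close>

lemma complement_one:
  fixes B :: "'k::field mat"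
  assumes B: "B \<in> carrier_mat d 1" and C: "C \<in> carrier_mat 1 d" and CB: "C * B = 1\<^sub>m 1"
  obtains K L where "d > 0" "K \<in> carrier_mat d (d - 1)" "L \<in> carrier_mat (d - 1) d" "L * K = 1\<^sub>m (d - 1)"
    "C * K = 0\<^sub>m 1 (d - 1)" "L * B = 0\<^sub>m (d - 1) 1"
proof -
  define u where "u i = B $$ (i, 0)" for i
  define v where "v i = C $$ (0, i)" for i
  have uv: "(\<Sum>k<d. v k * u k) = 1"
    using mult_mat_index[OF C B, of 0 0] by (simp add: CB u_def v_def)
  then obtain i0 where i0: "i0 < d" "v i0 \<noteq> 0"
    by (metis (no_types, lifting) lessThan_iff mult_zero_left sum.neutral zero_neq_one)
  \<comment> \<open>Enumerates the indices other than \<open>i0\<close>.\<close>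
  define s where "s j = (if j < i0 then j else j + 1)" for j :: nat
  have s: "s j < d" "s j \<noteq> i0" "s j = s k \<longleftrightarrow> j = k" if "j < d - 1" for j k
    using that i0 by (auto simp: s_def split: if_splits)
  define K where "K = mat d (d - 1) (\<lambda>(r, j). (if r = s j then 1 else 0) - (if r = i0 then v (s j) / v i0 else 0))"
  define L where "L = mat (d - 1) d (\<lambda>(j, c). (if c = s j then 1 else 0) - u (s j) * v c)"
  have K: "K \<in> carrier_mat d (d - 1)" and L: "L \<in> carrier_mat (d - 1) d"
    by (auto simp: K_def L_def)
  have vK: "(\<Sum>r<d. v r * K $$ (r, j)) = 0" if "j < d - 1" for j
  proof -
    have "(\<Sum>r<d. v r * K $$ (r, j)) = (\<Sum>r<d. if r = s j then v r else 0) - (\<Sum>r<d. if r = i0 then v (s j) else 0)"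
      using that i0 unfolding sum_subtractf[symmetric]
      by (intro sum.cong refl) (auto simp: K_def algebra_simps)
    then show ?thesis using s[OF that] i0 by simp
  qed
  have Lu: "(\<Sum>c<d. L $$ (j, c) * u c) = 0" if "j < d - 1" for j
  proof -
    have "(\<Sum>c<d. L $$ (j, c) * u c) = (\<Sum>c<d. if c = s j then u c else 0) - u (s j) * (\<Sum>c<d. v c * u c)"
      using that unfolding sum_distrib_left sum_subtractf[symmetric]
      by (intro sum.cong refl) (simp add: L_def algebra_simps)
    then show ?thesis using s[OF that] uv by simp
  qed
  have LK: "(\<Sum>c<d. L $$ (j, c) * K $$ (c, k)) = (if j = k then 1 else 0)" if "j < d - 1" "k < d - 1" for j k
  proof -
    have "(\<Sum>c<d. L $$ (j, c) * K $$ (c, k)) = (\<Sum>c<d. if c = s j then K $$ (c, k) else 0) - u (s j) * (\<Sum>c<d. v c * K $$ (c, k))"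
      using that unfolding sum_distrib_left sum_subtractf[symmetric]
      by (intro sum.cong refl) (simp add: L_def algebra_simps)
    also have "\<dots> = K $$ (s j, k)" using s[OF that(1)] vK[OF that(2)] by simp
    finally show ?thesis using s[OF that(1)] that by (simp add: K_def)
  qed
  show thesis
  proof (rule that)
    show "L * K = 1\<^sub>m (d - 1)"
      using K L by (intro eq_matI) (auto simp: mult_mat_index[OF L K] LK simp del: index_mult_mat(1))
    show "C * K = 0\<^sub>m 1 (d - 1)"
      using K C by (intro eq_matI) (auto simp: mult_mat_index[OF C K] vK simp flip: v_def simp del: index_mult_mat(1))
    show "L * B = 0\<^sub>m (d - 1) 1"
      using L B by (intro eq_matI) (auto simp: mult_mat_index[OF L B] Lu simp flip: u_def simp del: index_mult_mat(1))
  qed (use i0 K L in auto)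
qed

lemma four_block_mat_empty:
  assumes "A \<in> carrier_mat a b"
  shows "four_block_mat A (0\<^sub>m a 0) (0\<^sub>m 0 b) (0\<^sub>m 0 0) = A"
  using assms by (intro eq_matI) auto

text \<open>Explicit bases give a direct summand a complement that is again described by matrices.
  The induction sets the last column of B and the last row of C apart, and applies
  \<open>complement_one\<close> to them inside the complement of the others.\<close>

lemma complement:
  fixes B :: "'k::field mat"
  assumes "B \<in> carrier_mat d r" "C \<in> carrier_mat r d" "C * B = 1\<^sub>m r"
  shows "r \<le> d \<and> (\<exists>K L. K \<in> carrier_mat d (d - r) \<and> L \<in> carrier_mat (d - r) d \<and> L * K = 1\<^sub>m (d - r) \<and>
    C * K = 0\<^sub>m r (d - r) \<and> L * B = 0\<^sub>m (d - r) r)"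
  using assms
proof (induction r arbitrary: B C)
  case 0
  have "C * 1\<^sub>m d = 0\<^sub>m 0 d" "1\<^sub>m d * B = 0\<^sub>m d 0"
    using 0 by (auto intro!: eq_matI)
  then show ?case by (intro conjI exI[of _ "1\<^sub>m d"]) auto
next
  case (Suc r)
  note B = Suc.prems(1) and C = Suc.prems(2) and CB = Suc.prems(3)
  \<comment> \<open>\<open>J\<close> and \<open>w\<close> include the first r coordinates and the
    last one; \<open>J'\<close> and \<open>w'\<close> are the matching projections.\<close>
  define J :: "'k mat" where "J = mat (Suc r) r (\<lambda>(i, j). if i = j then 1 else 0)"
  define J' :: "'k mat" where "J' = mat r (Suc r) (\<lambda>(i, j). if i = j then 1 else 0)"
  define w :: "'k mat" where "w = mat (Suc r) 1 (\<lambda>(i, j). if i = r then 1 else 0)"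
  define w' :: "'k mat" where "w' = mat 1 (Suc r) (\<lambda>(i, j). if j = r then 1 else 0)"
  have J: "J \<in> carrier_mat (r + 1) r" "J' \<in> carrier_mat r (r + 1)" "w \<in> carrier_mat (r + 1) 1" "w' \<in> carrier_mat 1 (r + 1)"
    by (auto simp: J_def J'_def w_def w'_def)
  have JJ: "J' * J = 1\<^sub>m r" "w' * w = 1\<^sub>m 1" "J' * w = 0\<^sub>m r 1" "w' * J = 0\<^sub>m 1 r"
    using J by (auto intro!: eq_matI simp: mult_mat_index[OF J(2) J(1)] mult_mat_index[OF J(4) J(3)]
        mult_mat_index[OF J(2) J(3)] mult_mat_index[OF J(4) J(1)] simp del: index_mult_mat(1))
      (auto simp: J_def J'_def w_def w'_def if_distrib[where f = "\<lambda>x. x * _"] sum.delta cong: if_cong)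
  have id: "J * J' + w * w' = 1\<^sub>m (Suc r)"
    using biproduct_complete(5)[OF J(1,3,2,4)] JJ by simp
  have B': "B \<in> carrier_mat d (r + 1)" and C': "C \<in> carrier_mat (r + 1) d" using B C by auto
  have CBX: "C * (B * F) = F" if "F \<in> carrier_mat (r + 1) c" for F c
    using assoc_mult_mat[OF C' B' that] CB that by simp
  have J'C: "(J' * C) * (B * J) = 1\<^sub>m r" "(w' * C) * (B * w) = 1\<^sub>m 1" "(J' * C) * (B * w) = 0\<^sub>m r 1"
      "(w' * C) * (B * J) = 0\<^sub>m 1 r"
    using assoc_mult_mat[OF J(2) C' mult_carrier_mat[OF B' J(1)]] assoc_mult_mat[OF J(4) C' mult_carrier_mat[OF B' J(3)]]
      assoc_mult_mat[OF J(2) C' mult_carrier_mat[OF B' J(3)]] assoc_mult_mat[OF J(4) C' mult_carrier_mat[OF B' J(1)]]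
    by (simp_all add: CBX[OF J(1)] CBX[OF J(3)] JJ)
  define B0 where "B0 = B * J"
  define C0 where "C0 = J' * C"
  define b where "b = B * w"
  define c where "c = w' * C"
  have cB: "B0 \<in> carrier_mat d r" "C0 \<in> carrier_mat r d" "b \<in> carrier_mat d 1" "c \<in> carrier_mat 1 d"
    using B' C' J by (auto simp: B0_def C0_def b_def c_def)
  have CB0: "C0 * B0 = 1\<^sub>m r" "c * b = 1\<^sub>m 1" "C0 * b = 0\<^sub>m r 1" "c * B0 = 0\<^sub>m 1 r"
    unfolding B0_def C0_def b_def c_def by (rule J'C)+
  from Suc.IH[OF cB(1,2) CB0(1)] obtain K L where r: "r \<le> d" and
    KL: "K \<in> carrier_mat d (d - r)" "L \<in> carrier_mat (d - r) d" "L * K = 1\<^sub>m (d - r)"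
    "C0 * K = 0\<^sub>m r (d - r)" "L * B0 = 0\<^sub>m (d - r) r" by blast
  have d: "d = r + (d - r)" using r by simp
  have KL1: "B0 * C0 + K * L = 1\<^sub>m d"
    using biproduct_complete(5)[of B0 r "d - r" K C0 L] cB KL CB0 r by simp
  \<comment> \<open>Inside the complement the last row and column still pair to 1, because K L is 1
    - B0 C0 and \<open>C0 * b\<close> vanishes.\<close>
  have "c * K * (L * b) = 1\<^sub>m 1"
  proof -
    have "c * K * (L * b) = c * (K * L * b)"
      using cB KL by (simp add: assoc_mult_mat[of _ 1 d _ "d - r" _ 1] assoc_mult_mat[of _ d "d - r" _ d _ 1])
    also have "K * L * b = (B0 * C0 + K * L) * b"
    proof -
      have "B0 * C0 * b = 0\<^sub>m d 1" using cB CB0(3) by (simp add: assoc_mult_mat[of _ d r _ d _ 1])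
      then show ?thesis
        using cB KL by (subst add_mult_distrib_mat[of _ d d]) auto
    qed
    also have "c * \<dots> = 1\<^sub>m 1" using cB CB0 by (simp add: KL1)
    finally show ?thesis .
  qed
  note cKLb = mult_carrier_mat[OF KL(2) cB(3)] mult_carrier_mat[OF cB(4) KL(1)] this
  obtain K1 L1 where r1: "d - r > 0" and K1: "K1 \<in> carrier_mat (d - r) (d - r - 1)"
    "L1 \<in> carrier_mat (d - r - 1) (d - r)" "L1 * K1 = 1\<^sub>m (d - r - 1)"
    "c * K * K1 = 0\<^sub>m 1 (d - r - 1)" "L1 * (L * b) = 0\<^sub>m (d - r - 1) 1"
    by (rule complement_one[OF cKLb])
  define K2 where "K2 = K * K1"
  define L2 where "L2 = L1 * L"
  have cK: "K2 \<in> carrier_mat d (d - Suc r)" "L2 \<in> carrier_mat (d - Suc r) d"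
    using KL K1 by (auto simp: K2_def L2_def)
  have "L2 * K2 = L1 * (L * K * K1)"
    unfolding K2_def L2_def using KL(1,2) K1(1,2)
    by (simp add: assoc_mult_mat[of _ "d - r - 1" "d - r" _ d _ "d - r - 1"] assoc_mult_mat[of _ "d - r" d _ "d - r" _ "d - r - 1"])
  then have LK: "L2 * K2 = 1\<^sub>m (d - Suc r)"
    unfolding KL(3) left_mult_one_mat[OF K1(1)] using K1(3) by simp
  have C0K: "C0 * K2 = 0\<^sub>m r (d - Suc r)" "c * K2 = 0\<^sub>m 1 (d - Suc r)"
    unfolding K2_def assoc_mult_mat[OF cB(2) KL(1) K1(1), symmetric] assoc_mult_mat[OF cB(4) KL(1) K1(1), symmetric] KL(4) K1(4)
    using K1(1) by simp_all
  have L2B: "L2 * B0 = 0\<^sub>m (d - Suc r) r" "L2 * b = 0\<^sub>m (d - Suc r) 1"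
    unfolding L2_def assoc_mult_mat[OF K1(2) KL(2) cB(1)] assoc_mult_mat[OF K1(2) KL(2) cB(3)] KL(5) K1(5)
    using K1(2) by simp_all
  have "C = (J * J' + w * w') * C" using id C by simp
  also have "\<dots> = J * C0 + w * c"
    unfolding C0_def c_def using J C'
    by (simp add: add_mult_distrib_mat[of _ "r + 1" "r + 1"] assoc_mult_mat[of _ "r + 1" r _ "r + 1" _ d] assoc_mult_mat[of _ "r + 1" 1 _ "r + 1" _ d])
  finally have "C * K2 = (J * C0 + w * c) * K2" by simp
  also have "\<dots> = J * (C0 * K2) + w * (c * K2)"
    using J cB cK by (simp add: add_mult_distrib_mat[of _ "r + 1" d] assoc_mult_mat[of _ "r + 1" r _ d] assoc_mult_mat[of _ "r + 1" 1 _ d])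
  also have "\<dots> = 0\<^sub>m (Suc r) (d - Suc r)" using J by (simp add: C0K)
  finally have CK: "C * K2 = 0\<^sub>m (Suc r) (d - Suc r)" .
  have "B = B * (J * J' + w * w')" using id B by simp
  also have "\<dots> = B0 * J' + b * w'"
    unfolding B0_def b_def using J B'
    using mult_add_distrib_mat[OF B' mult_carrier_mat[OF J(1,2)] mult_carrier_mat[OF J(3,4)]] by simp
  finally have "L2 * B = L2 * (B0 * J' + b * w')" by simp
  also have "\<dots> = L2 * B0 * J' + L2 * b * w'"
    using J cB cK by (simp add: mult_add_distrib_mat[of _ "d - Suc r" d _ "r + 1"] assoc_mult_mat[of _ "d - Suc r" d _ r] assoc_mult_mat[of _ "d - Suc r" d _ 1])
  also have "\<dots> = 0\<^sub>m (d - Suc r) (Suc r)" using J by (simp add: L2B)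
  finally have LB: "L2 * B = 0\<^sub>m (d - Suc r) (Suc r)" .
  show ?case using r1 cK LK CK LB by (intro conjI exI[of _ K2] exI[of _ L2]) auto
qed

subsection \<open>Modules as matrix representations of the free algebra\<close>

text \<open>The action pulled back to the free algebra, where induction over generators is
  available.\<close>

definition act :: "nat \<Rightarrow> 'k::field \<Rightarrow> 'k hmod \<Rightarrow> 'k free_alg \<Rightarrow> 'k mat" where
  "act n q M f = snd M (H_cls n q f)"

context hopf_data
begin

abbreviation hmod :: "'k hmod \<Rightarrow> bool" where "hmod \<equiv> is_hmod n q"
abbreviation iso :: "'k hmod \<Rightarrow> 'k hmod \<Rightarrow> bool" where "iso \<equiv> hmod_iso n q"
abbreviation Act :: "'k hmod \<Rightarrow> 'k free_alg \<Rightarrow> 'k mat" where "Act \<equiv> act n q"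
abbreviation tensor :: "'k hmod \<Rightarrow> 'k hmod \<Rightarrow> 'k hmod" where "tensor \<equiv> hmod_tensor n q"
abbreviation gen :: "letter \<Rightarrow> 'k free_alg" where "gen l \<equiv> word_elt (Word [l])"

lemma act_cong: "H.eqv f g \<Longrightarrow> Act M f = Act M g"
  unfolding act_def using H_cls_eq_iff by metis

lemma hmod_iff_matrep: "hmod M \<longleftrightarrow> matrep (fst M) (Act M)"
proof -
  obtain d \<rho> where M: "M = (d, \<rho>)" by (cases M)
  show ?thesis
  proof
    assume "hmod M"
    then have hom: "\<rho> \<in> Ring.ring_hom (H_alg n q) (ring_mat TYPE('k) d ())"
      and sc: "\<And>c h. h \<in> carrier (H_alg n q) \<Longrightarrow> \<rho> (H_cls n q (scal c) \<otimes>\<^bsub>H_alg n q\<^esub> h) = c \<cdot>\<^sub>m \<rho> h"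
      by (auto simp: M is_hmod_def)
    have c: "H_cls n q f \<in> carrier (H_alg n q)" for f by (auto simp: H_alg_carrier)
    show "matrep (fst M) (Act M)"
    proof
      show "Act M f \<in> carrier_mat (fst M) (fst M)" for f
        using ring_hom_closed[OF hom c] by (simp add: M act_def ring_mat_simps)
      show "Act M (f + g) = Act M f + Act M g" for f g
        using ring_hom_add[OF hom c c, of f g] by (simp add: M act_def ring_mat_simps H_alg_add)
      show "Act M (f * g) = Act M f * Act M g" for f g
        using ring_hom_mult[OF hom c c, of f g] by (simp add: M act_def ring_mat_simps H_alg_mult)
      show "Act M (scal x) = x \<cdot>\<^sub>m 1\<^sub>m (fst M)" for x
        using ring_hom_one[OF hom] sc[OF c, of x 1]
        by (simp add: M act_def ring_mat_simps H_alg_mult H_alg_one)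
    qed
  next
    assume "matrep (fst M) (Act M)"
    then interpret matrep d "Act M" by (simp add: M)
    have a: "\<rho> (H_cls n q f) = Act M f" for f by (simp add: M act_def)
    have "\<rho> \<in> Ring.ring_hom (H_alg n q) (ring_mat TYPE('k) d ())"
      by (intro ring_hom_memI)
        (auto simp: H_alg_carrier ring_mat_simps H_alg_mult H_alg_add H_alg_one a mult add one)
    then show "hmod M"
      by (auto simp: is_hmod_def M H_alg_carrier H_alg_mult a scal_mult[unfolded M])
  qed
qed

text \<open>The factor theorem for quotients: a representation of the free algebra that kills the
  relations is constant on cosets, so that \<open>on_coset\<close> is meaningful.\<close>

lemma rep_hmod:
  assumes R: "matrep d R" and rels: "\<And>r. r \<in> H_rels n q \<Longrightarrow> R r = 0\<^sub>m d d"
  shows "Act (d, on_coset R) = R" "hmod (d, on_coset R)"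
proof -
  interpret matrep d R by fact
  have "H_ideal n q \<subseteq> {f. R f = 0\<^sub>m d d}"
    unfolding H_ideal_def by (rule genideal_subset[OF kernel]) (use rels in auto)
  then have "R g = R f" if "H.eqv g f" for f g
  proof -
    have "R (g - f) = 0\<^sub>m d d" using that \<open>_ \<subseteq> _\<close> by (auto simp: H.eqv_def)
    then have "R (g - f) + R f = R f" by simp
    then show ?thesis by (simp flip: add)
  qed
  then show 1: "Act (d, on_coset R) = R"
    by (auto simp: act_def fun_eq_iff intro: on_coset_H_cls)
  show "hmod (d, on_coset R)" unfolding hmod_iff_matrep 1 using R by simp
qed

text \<open>Explicit inverses of known size replace \<open>invertible_mat\<close>, and the
  quantifier runs over the free algebra instead of the cosets.\<close>

lemma iso_iff:
  "iso M N \<longleftrightarrow> fst M = fst N \<and> (\<exists>P Q. P \<in> carrier_mat (fst M) (fst M) \<and> Q \<in> carrier_mat (fst M) (fst M) \<and>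
     P * Q = 1\<^sub>m (fst M) \<and> Q * P = 1\<^sub>m (fst M) \<and> (\<forall>f. P * Act M f = Act N f * P))"
proof -
  obtain d \<rho> where M: "M = (d, \<rho>)" by (cases M)
  obtain e \<sigma> where N: "N = (e, \<sigma>)" by (cases N)
  have inv: "invertible_mat P \<longleftrightarrow> (\<exists>Q. Q \<in> carrier_mat d d \<and> P * Q = 1\<^sub>m d \<and> Q * P = 1\<^sub>m d)"
    if P: "P \<in> carrier_mat d d" for P :: "'k mat"
  proof
    assume "invertible_mat P"
    then obtain Q where Q: "P * Q = 1\<^sub>m (dim_row P)" "Q * P = 1\<^sub>m (dim_row Q)"
      by (auto simp: invertible_mat_def inverts_mat_def)
    then have "dim_col Q = d" "dim_row Q = d"
      using P by (metis carrier_matD index_mult_mat(3) index_one_mat(3))+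
    then show "\<exists>Q. Q \<in> carrier_mat d d \<and> P * Q = 1\<^sub>m d \<and> Q * P = 1\<^sub>m d"
      using P Q by (intro exI[of _ Q]) auto
  next
    assume "\<exists>Q. Q \<in> carrier_mat d d \<and> P * Q = 1\<^sub>m d \<and> Q * P = 1\<^sub>m d"
    then show "invertible_mat P"
      using P by (auto simp: invertible_mat_def inverts_mat_def)
  qed
  show ?thesis
    using inv by (auto simp: M N hmod_iso_def H_alg_carrier act_def)
qed

lemma isoI:
  assumes "fst M = fst N" "P \<in> carrier_mat (fst M) (fst M)" "Q \<in> carrier_mat (fst M) (fst M)"
    "Q * P = 1\<^sub>m (fst M)" "\<And>f. P * Act M f = Act N f * P"
  shows "iso M N"
  unfolding iso_iff using assms mat_mult_left_right_inverse[OF assms(3,2,4)] by blast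

lemma iso_refl: "hmod M \<Longrightarrow> iso M M"
proof -
  assume "hmod M"
  then interpret matrep "fst M" "Act M" by (simp add: hmod_iff_matrep)
  show ?thesis by (rule isoI[of _ _ "1\<^sub>m (fst M)" "1\<^sub>m (fst M)"]) auto
qed

lemma iso_sym:
  assumes "hmod M" "hmod N" "iso M N" shows "iso N M"
proof -
  interpret M: matrep "fst M" "Act M" using assms by (simp add: hmod_iff_matrep)
  interpret N: matrep "fst N" "Act N" using assms by (simp add: hmod_iff_matrep)
  define d where "d = fst M"
  from assms(3) obtain P Q where d: "fst N = d" and PQ: "P \<in> carrier_mat d d" "Q \<in> carrier_mat d d"
    "P * Q = 1\<^sub>m d" "Q * P = 1\<^sub>m d" "\<And>f. P * Act M f = Act N f * P"
    by (auto simp: iso_iff d_def)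
  have c: "Act M f \<in> carrier_mat d d" "Act N f \<in> carrier_mat d d" for f
    using M.carrier[of f] N.carrier[of f] by (simp_all add: d_def d[unfolded d_def])
  have "Q * Act N f = Act M f * Q" for f
  proof -
    have "Q * Act N f = Q * (Act N f * (P * Q))" using right_mult_one_mat[OF c(2), of f] by (simp add: PQ(3))
    also have "\<dots> = Q * (Act N f * P) * Q"
      using PQ c[of f] by (simp add: assoc_mult_mat[of _ d d _ d _ d])
    also have "\<dots> = Q * (P * Act M f) * Q" by (simp add: PQ(5))
    also have "\<dots> = Q * P * Act M f * Q"
      using PQ(1,2) c[of f] by (simp add: assoc_mult_mat[of _ d d _ d _ d])
    finally show ?thesis unfolding PQ(4) left_mult_one_mat[OF c(1)] .
  qed
  then show ?thesis
    by (intro isoI[of N M Q P]) (use PQ d d_def in auto)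
qed

lemma iso_trans:
  assumes "hmod L" "hmod M" "hmod N" "iso L M" "iso M N" shows "iso L N"
proof -
  interpret L: matrep "fst L" "Act L" using assms by (simp add: hmod_iff_matrep)
  interpret M: matrep "fst M" "Act M" using assms by (simp add: hmod_iff_matrep)
  interpret N: matrep "fst N" "Act N" using assms by (simp add: hmod_iff_matrep)
  define d where "d = fst L"
  from assms(4) obtain P Q where d: "fst M = d" and PQ: "P \<in> carrier_mat d d" "Q \<in> carrier_mat d d"
    "P * Q = 1\<^sub>m d" "Q * P = 1\<^sub>m d" "\<And>f. P * Act L f = Act M f * P"
    by (auto simp: iso_iff d_def)
  from assms(5) obtain P' Q' where d': "fst N = d" and PQ': "P' \<in> carrier_mat d d" "Q' \<in> carrier_mat d d"
    "P' * Q' = 1\<^sub>m d" "Q' * P' = 1\<^sub>m d" "\<And>f. P' * Act M f = Act N f * P'"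
    by (auto simp: iso_iff d)
  have c: "Act L f \<in> carrier_mat d d" "Act M f \<in> carrier_mat d d" "Act N f \<in> carrier_mat d d" for f
    using L.carrier[of f] M.carrier[of f] N.carrier[of f] by (simp_all only: d_def[symmetric] d d')
  note a = assoc_mult_mat[of _ d d _ d _ d]
  show ?thesis
  proof (rule isoI[of L N "P' * P" "Q * Q'"])
    have "Q * Q' * (P' * P) = Q * ((Q' * P') * P)" using PQ(1,2) PQ'(1,2) by (simp add: a)
    also have "\<dots> = 1\<^sub>m d" using PQ(1,2,4) by (simp add: PQ'(4))
    finally show "Q * Q' * (P' * P) = 1\<^sub>m (fst L)" by (simp add: d_def)
    fix f
    have "P' * P * Act L f = P' * (Act M f * P)" using PQ(1,2) PQ'(1,2) c[of f] by (simp add: a PQ(5))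
    also have "\<dots> = (P' * Act M f) * P" using PQ(1,2) PQ'(1,2) c[of f] by (simp add: a)
    also have "\<dots> = Act N f * (P' * P)" unfolding PQ'(5) using PQ(1,2) PQ'(1,2) c[of f] by (simp add: a)
    finally show "P' * P * Act L f = Act N f * (P' * P)" .
  qed (use PQ PQ' d d' in \<open>auto simp: d_def\<close>)
qed


subsection \<open>Direct sums\<close>

lemma fst_hmod_sum [simp]: "fst (hmod_sum M N) = fst M + fst N"
  by (simp add: hmod_sum_def split: prod.splits)

lemma act_sum: "Act (hmod_sum M N) f =
    four_block_mat (Act M f) (0\<^sub>m (fst M) (fst N)) (0\<^sub>m (fst N) (fst M)) (Act N f)"
  by (simp add: act_def hmod_sum_def split: prod.splits)

lemma hmod_sum:
  assumes "hmod M" "hmod N" shows "hmod (hmod_sum M N)"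
proof -
  interpret M: matrep "fst M" "Act M" using assms by (simp add: hmod_iff_matrep)
  interpret N: matrep "fst N" "Act N" using assms by (simp add: hmod_iff_matrep)
  show ?thesis unfolding hmod_iff_matrep
  proof
    show "Act (hmod_sum M N) f \<in> carrier_mat (fst (hmod_sum M N)) (fst (hmod_sum M N))" for f
      by (simp add: act_sum)
    show "Act (hmod_sum M N) (f + g) = Act (hmod_sum M N) f + Act (hmod_sum M N) g" for f g
      unfolding act_sum by (subst add_four_block_mat) (auto simp: M.add N.add)
    show "Act (hmod_sum M N) (f * g) = Act (hmod_sum M N) f * Act (hmod_sum M N) g" for f g
      unfolding act_sum by (subst mult_four_block_mat) (auto simp: M.mult N.mult)
    show "Act (hmod_sum M N) (scal c) = c \<cdot>\<^sub>m 1\<^sub>m (fst (hmod_sum M N))" for c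
      unfolding act_sum by (auto intro!: eq_matI simp: M.scal N.scal)
  qed
qed

text \<open>The columns of \<open>B1\<close> and \<open>B2\<close> together form an invertible
  matrix, which intertwines as soon as both inclusions do.\<close>

lemma iso_sumI:
  assumes mods: "hmod M" "hmod N" "hmod D" and d: "fst D = fst M + fst N"
    and B: "B1 \<in> carrier_mat (fst D) (fst M)" "B2 \<in> carrier_mat (fst D) (fst N)"
    and C: "C1 \<in> carrier_mat (fst M) (fst D)" "C2 \<in> carrier_mat (fst N) (fst D)"
    and CB: "C1 * B1 = 1\<^sub>m (fst M)" "C2 * B2 = 1\<^sub>m (fst N)" "C1 * B2 = 0\<^sub>m (fst M) (fst N)" "C2 * B1 = 0\<^sub>m (fst N) (fst M)"
    and inter: "\<And>f. Act D f * B1 = B1 * Act M f" "\<And>f. Act D f * B2 = B2 * Act N f"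
  shows "iso (hmod_sum M N) D"
proof -
  interpret M: matrep "fst M" "Act M" using mods by (simp add: hmod_iff_matrep)
  interpret N: matrep "fst N" "Act N" using mods by (simp add: hmod_iff_matrep)
  interpret D: matrep "fst D" "Act D" using mods by (simp add: hmod_iff_matrep)
  let ?P = "four_block_mat B1 B2 (0\<^sub>m 0 (fst M)) (0\<^sub>m 0 (fst N))"
  let ?Q = "four_block_mat C1 (0\<^sub>m (fst M) 0) C2 (0\<^sub>m (fst N) 0)"
  note PQ = biproduct_complete[OF B[unfolded d] C[unfolded d] CB]
  show ?thesis
  proof (rule isoI[of _ _ ?P ?Q])
    fix f
    have "?P * Act (hmod_sum M N) f = four_block_mat (B1 * Act M f) (B2 * Act N f) (0\<^sub>m 0 (fst M)) (0\<^sub>m 0 (fst N))"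
      unfolding act_sum using B by (subst mult_four_block_mat[of _ "fst D" "fst M" _ "fst N" _ 0]) auto
    also have "\<dots> = four_block_mat (Act D f) (0\<^sub>m (fst D) 0) (0\<^sub>m 0 (fst D)) (0\<^sub>m 0 0) * ?P"
      using B by (subst mult_four_block_mat[of _ "fst D" "fst D" _ 0 _ 0]) (auto simp: inter)
    finally show "?P * Act (hmod_sum M N) f = Act D f * ?P"
      by (simp add: four_block_mat_empty[OF D.carrier])
  qed (use PQ d in auto)
qed

text \<open>Inclusions and projections, unlike the block form itself, survive tensoring with a third
  module.\<close>

lemma sum_biproduct:
  assumes mods: "hmod M" "hmod N"
  obtains B1 B2 C1 C2 where
    "B1 \<in> carrier_mat (fst M + fst N) (fst M)" "B2 \<in> carrier_mat (fst M + fst N) (fst N)"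
    "C1 \<in> carrier_mat (fst M) (fst M + fst N)" "C2 \<in> carrier_mat (fst N) (fst M + fst N)"
    "C1 * B1 = 1\<^sub>m (fst M)" "C2 * B2 = 1\<^sub>m (fst N)" "C1 * B2 = 0\<^sub>m (fst M) (fst N)" "C2 * B1 = 0\<^sub>m (fst N) (fst M)"
    "\<forall>f. Act (hmod_sum M N) f * B1 = B1 * Act M f" "\<forall>f. Act (hmod_sum M N) f * B2 = B2 * Act N f"
proof -
  interpret M: matrep "fst M" "Act M" using mods by (simp add: hmod_iff_matrep)
  interpret N: matrep "fst N" "Act N" using mods by (simp add: hmod_iff_matrep)
  let ?d = "fst M" and ?e = "fst N"
  let ?B1 = "four_block_mat (1\<^sub>m ?d :: 'k mat) (0\<^sub>m ?d 0) (0\<^sub>m ?e ?d) (0\<^sub>m ?e 0)"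
  let ?B2 = "four_block_mat (0\<^sub>m ?d ?e :: 'k mat) (0\<^sub>m ?d 0) (1\<^sub>m ?e) (0\<^sub>m ?e 0)"
  let ?C1 = "four_block_mat (1\<^sub>m ?d :: 'k mat) (0\<^sub>m ?d ?e) (0\<^sub>m 0 ?d) (0\<^sub>m 0 ?e)"
  let ?C2 = "four_block_mat (0\<^sub>m ?e ?d :: 'k mat) (1\<^sub>m ?e) (0\<^sub>m 0 ?d) (0\<^sub>m 0 ?e)"
  have e: "four_block_mat A (0\<^sub>m a 0) (0\<^sub>m 0 b) (0\<^sub>m 0 0) = A" if "A \<in> carrier_mat a b" for A :: "'k mat" and a b
    using that by (rule four_block_mat_empty)
  show thesis
  proof (rule that)
    have rc: "four_block_mat U Y (0\<^sub>m 0 ?d) (0\<^sub>m 0 ?e) * four_block_mat Z (0\<^sub>m ?d 0) W (0\<^sub>m ?e 0) = U * Z + Y * W"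
      if "U \<in> carrier_mat a ?d" "Y \<in> carrier_mat a ?e" "Z \<in> carrier_mat ?d b" "W \<in> carrier_mat ?e b"
      for U Y Z W :: "'k mat" and a b
      using that by (subst mult_four_block_mat[of U a ?d Y ?e _ 0 _ Z b _ 0 W]) (auto simp: e)
    show "?C1 * ?B1 = 1\<^sub>m ?d"
      by (subst rc[of _ ?d _ _ ?d]) (auto intro!: eq_matI)
    show "?C2 * ?B2 = 1\<^sub>m ?e"
      by (subst rc[of _ ?e _ _ ?e]) (auto intro!: eq_matI)
    show "?C1 * ?B2 = 0\<^sub>m ?d ?e"
      by (subst rc[of _ ?d _ _ ?e]) (auto intro!: eq_matI)
    show "?C2 * ?B1 = 0\<^sub>m ?e ?d"
      by (subst rc[of _ ?e _ _ ?d]) (auto intro!: eq_matI)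
    have "Act (hmod_sum M N) f * ?B1 = ?B1 * Act M f \<and> Act (hmod_sum M N) f * ?B2 = ?B2 * Act N f" for f
    proof
    have 1: "Act M f = four_block_mat (Act M f) (0\<^sub>m ?d 0) (0\<^sub>m 0 ?d) (0\<^sub>m 0 0)"
      and 2: "Act N f = four_block_mat (Act N f) (0\<^sub>m ?e 0) (0\<^sub>m 0 ?e) (0\<^sub>m 0 0)"
      by (simp_all add: e)
    have "Act (hmod_sum M N) f * ?B1 = four_block_mat (Act M f) (0\<^sub>m ?d 0) (0\<^sub>m ?e ?d) (0\<^sub>m ?e 0)"
      unfolding act_sum by (subst mult_four_block_mat[of _ ?d ?d _ ?e _ ?e]) auto
    also have "\<dots> = ?B1 * four_block_mat (Act M f) (0\<^sub>m ?d 0) (0\<^sub>m 0 ?d) (0\<^sub>m 0 0)"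
      by (subst mult_four_block_mat[of _ ?d ?d _ 0 _ ?e]) auto
    finally show "Act (hmod_sum M N) f * ?B1 = ?B1 * Act M f" by (simp flip: 1)
    have "Act (hmod_sum M N) f * ?B2 = four_block_mat (0\<^sub>m ?d ?e) (0\<^sub>m ?d 0) (Act N f) (0\<^sub>m ?e 0)"
      unfolding act_sum by (subst mult_four_block_mat[of _ ?d ?d _ ?e _ ?e]) auto
    also have "\<dots> = ?B2 * four_block_mat (Act N f) (0\<^sub>m ?e 0) (0\<^sub>m 0 ?e) (0\<^sub>m 0 0)"
      by (subst mult_four_block_mat[of _ ?d ?e _ 0 _ ?e]) auto
    finally show "Act (hmod_sum M N) f * ?B2 = ?B2 * Act N f" by (simp flip: 2)
    qed
    then show "\<forall>f. Act (hmod_sum M N) f * ?B1 = ?B1 * Act M f" "\<forall>f. Act (hmod_sum M N) f * ?B2 = ?B2 * Act N f"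
      by blast+
  qed auto
qed

text \<open>\<open>B\<close> embeds S, and the kernel of the equivariant retraction \<open>C\<close>
  is stable under the action. This kernel is the complementary module; in the bases from
  \<open>complement\<close> its action is \<open>L * Act M f * K\<close>.\<close>

lemma split_submodule:
  assumes mods: "hmod M" "hmod S"
    and B: "B \<in> carrier_mat (fst M) (fst S)" and C: "C \<in> carrier_mat (fst S) (fst M)" and CB: "C * B = 1\<^sub>m (fst S)"
    and inter: "\<And>f. Act M f * B = B * Act S f" "\<And>f. C * Act M f = Act S f * C"
  obtains N where "hmod N" "fst M = fst S + fst N" "iso (hmod_sum S N) M"
proof -
  interpret M: matrep "fst M" "Act M" using mods by (simp add: hmod_iff_matrep)
  interpret S: matrep "fst S" "Act S" using mods by (simp add: hmod_iff_matrep)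
  define d where "d = fst M"
  define r where "r = fst S"
  define e where "e = d - r"
  from complement[OF B C CB] obtain K L where r: "r \<le> d"
    and K: "K \<in> carrier_mat d e" and L: "L \<in> carrier_mat e d" and LK: "L * K = 1\<^sub>m e"
    and CK: "C * K = 0\<^sub>m r e" and LB: "L * B = 0\<^sub>m e r"
    unfolding d_def r_def e_def by blast
  have de: "d = r + e" using r by (simp add: e_def)
  note B' = B[folded d_def r_def] and C' = C[folded d_def r_def]
  have Mc: "Act M f \<in> carrier_mat d d" and Sc: "Act S f \<in> carrier_mat r r" for f
    by (simp_all add: d_def r_def)
  have id: "B * C + K * L = 1\<^sub>m d"
    using biproduct_complete(5)[of B r e K C L] B' C' K L LK CK LB CB by (simp add: de r_def)
  define N where "N = (e, \<lambda>h. L * snd M h * K)"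
  have fN: "fst N = e" and aN: "Act N f = L * Act M f * K" for f
    by (simp_all add: N_def act_def)
  \<comment> \<open>Stability of the kernel: the component along \<open>B\<close> is
    \<open>C * Act M f * K\<close>, which equals \<open>Act S f * (C * K)\<close> and hence
    vanishes.\<close>
  have comm: "Act M f * K = K * (L * Act M f * K)" for f
  proof -
    have "Act M f * K = (B * C + K * L) * (Act M f * K)"
      using left_mult_one_mat[OF mult_carrier_mat[OF Mc K], of f] by (simp only: id)
    also have "\<dots> = B * C * (Act M f * K) + K * L * (Act M f * K)"
      by (rule add_mult_distrib_mat[of _ d d _ _ e]) (use B' C' K L mult_carrier_mat[OF Mc K] in auto)
    also have "B * C * (Act M f * K) = B * ((C * Act M f) * K)"
      using assoc_mult_mat[OF B' C' mult_carrier_mat[OF Mc K], of f] assoc_mult_mat[OF C' Mc K, of f] by simp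
    also have "\<dots> = B * (Act S f * (C * K))" unfolding inter(2) using C' K Sc[of f] by simp
    also have "\<dots> = 0\<^sub>m d e" unfolding CK right_mult_zero_mat[OF Sc] right_mult_zero_mat[OF B'] ..
    also have "K * L * (Act M f * K) = K * (L * Act M f * K)"
      using assoc_mult_mat[OF K L mult_carrier_mat[OF Mc K], of f] assoc_mult_mat[OF L Mc K, of f] by simp
    finally show ?thesis
      by (subst (asm) left_add_zero_mat[of _ d e]) (use K L Mc[of f] in auto)
  qed
  have "matrep e (Act N)"
  proof
    show "Act N f \<in> carrier_mat e e" for f using K L Mc[of f] by (simp add: aN)
    show "Act N (f + g) = Act N f + Act N g" for f g
    proof -
      have "L * (Act M f + Act M g) * K = (L * Act M f + L * Act M g) * K"
        by (subst mult_add_distrib_mat[OF L Mc Mc]) simp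
      also have "\<dots> = L * Act M f * K + L * Act M g * K"
        by (rule add_mult_distrib_mat[of _ e d _ _ e]) (use L K Mc in auto)
      finally show ?thesis by (simp add: aN M.add)
    qed
    show "Act N (f * g) = Act N f * Act N g" for f g
    proof -
      have "Act N f * Act N g = L * (Act M f * (K * (L * Act M g * K)))"
      proof -
        have G: "L * Act M g * K \<in> carrier_mat e e" using K L Mc[of g] by auto
        show ?thesis
          unfolding aN assoc_mult_mat[OF mult_carrier_mat[OF L Mc] K G]
            assoc_mult_mat[OF L Mc mult_carrier_mat[OF K G]] ..
      qed
      also have "\<dots> = L * (Act M f * (Act M g * K))" by (simp only: comm)
      also have "\<dots> = L * (Act M f * Act M g) * K"
        unfolding assoc_mult_mat[OF Mc Mc K, symmetric] assoc_mult_mat[OF L mult_carrier_mat[OF Mc Mc] K, symmetric] ..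
      finally show ?thesis unfolding aN M.mult ..
    qed
    show "Act N (scal c) = c \<cdot>\<^sub>m 1\<^sub>m e" for c
    proof -
      have "L * (c \<cdot>\<^sub>m 1\<^sub>m d) * K = c \<cdot>\<^sub>m (L * K)"
        unfolding mult_smult_distrib[OF L one_carrier_mat] right_mult_one_mat[OF L] mult_smult_assoc_mat[OF L K] ..
      then show ?thesis by (simp add: aN M.scal LK flip: d_def)
    qed
  qed
  then have N: "hmod N" by (simp add: hmod_iff_matrep fN)
  show thesis
  proof (rule that)
    show "iso (hmod_sum S N) M"
      using B' C' K L CB LK CK LB
      by (intro iso_sumI[OF mods(2) N mods(1), of B K C L])
        (auto simp: fN aN inter comm simp flip: d_def r_def simp: de)
  qed (use N de in \<open>auto simp: fN d_def r_def\<close>)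
qed

subsection \<open>Tensor products\<close>

lemma fst_tensor [simp]: "fst (tensor M N) = fst M * fst N"
  by (simp add: hmod_tensor_def)

lemma tens_act_eq: "tens_act n q M N t = mat (fst M * fst N) (fst M * fst N) (\<lambda>ij.
    \<Sum>w\<in>Poly_Mapping.keys t. Poly_Mapping.lookup t w *
      kron_mat (Act M (word_elt (fst w))) (Act N (word_elt (snd w))) $$ ij)"
  by (simp add: tens_act_def act_def split_def)

lemma tens_act_carrier: "tens_act n q M N t \<in> carrier_mat (fst M * fst N) (fst M * fst N)"
  by (simp add: tens_act_eq)

lemma tens_act_add: "tens_act n q M N (s + t) = tens_act n q M N s + tens_act n q M N t"
proof (rule eq_matI)
  fix i j assume "i < dim_row (tens_act n q M N s + tens_act n q M N t)"
    "j < dim_col (tens_act n q M N s + tens_act n q M N t)"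
  then show "tens_act n q M N (s + t) $$ (i, j) = (tens_act n q M N s + tens_act n q M N t) $$ (i, j)"
    using sum_keys_add[of "\<lambda>w c. c * kron_mat (Act M (word_elt (fst w))) (Act N (word_elt (snd w))) $$ (i, j)" s t]
    by (simp add: tens_act_eq distrib_right)
qed (simp_all add: tens_act_eq)

lemma tens_act_0: "tens_act n q M N 0 = 0\<^sub>m (fst M * fst N) (fst M * fst N)"
  by (auto intro!: eq_matI simp: tens_act_eq)

lemma tens_act_single:
  assumes "hmod M" "hmod N"
  shows "tens_act n q M N (Poly_Mapping.single w c) =
    c \<cdot>\<^sub>m kron_mat (Act M (word_elt (fst w))) (Act N (word_elt (snd w)))"
proof -
  interpret M: matrep "fst M" "Act M" using assms by (simp add: hmod_iff_matrep)
  interpret N: matrep "fst N" "Act N" using assms by (simp add: hmod_iff_matrep)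
  show ?thesis
    by (auto intro!: eq_matI simp: tens_act_eq kron_mat_def)
qed

text \<open>\<open>P\<close> and \<open>Q\<close> may be rectangular, so this serves isomorphisms as
  well as inclusions of summands.\<close>

lemma tens_intertwine:
  assumes mods: "hmod M" "hmod N" "hmod M'" "hmod N'"
    and P: "P \<in> carrier_mat (fst M') (fst M)" and Q: "Q \<in> carrier_mat (fst N') (fst N)"
    and inter: "\<And>f. P * Act M f = Act M' f * P" "\<And>f. Q * Act N f = Act N' f * Q"
  shows "kron_mat P Q * tens_act n q M N t = tens_act n q M' N' t * kron_mat P Q"
proof -
  interpret M: matrep "fst M" "Act M" using mods by (simp add: hmod_iff_matrep)
  interpret N: matrep "fst N" "Act N" using mods by (simp add: hmod_iff_matrep)
  interpret M': matrep "fst M'" "Act M'" using mods by (simp add: hmod_iff_matrep)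
  interpret N': matrep "fst N'" "Act N'" using mods by (simp add: hmod_iff_matrep)
  have K: "kron_mat P Q \<in> carrier_mat (fst M' * fst N') (fst M * fst N)" using P Q by auto
  show ?thesis
  proof (induction t rule: poly_mapping_induct_sum)
    case zero
    then show ?case
      using right_mult_zero_mat[OF K] left_mult_zero_mat[OF K] by (simp add: tens_act_0)
  next
    case (single w c)
    have "kron_mat P Q * kron_mat (Act M (word_elt (fst w))) (Act N (word_elt (snd w))) =
      kron_mat (Act M' (word_elt (fst w))) (Act N' (word_elt (snd w))) * kron_mat P Q"
      by (simp add: kron_mat_mult[OF P M.carrier Q N.carrier] kron_mat_mult[OF M'.carrier P N'.carrier Q] inter)
    then show ?case
      by (simp add: tens_act_single mods mult_smult_distrib[OF K kron_mat_carrier[OF M.carrier N.carrier]]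
          mult_smult_assoc_mat[OF kron_mat_carrier[OF M'.carrier N'.carrier] K])
  next
    case (add s t)
    then show ?case
      by (simp add: tens_act_add mult_add_distrib_mat[OF K tens_act_carrier tens_act_carrier]
          add_mult_distrib_mat[OF tens_act_carrier tens_act_carrier K])
  qed
qed

lemma tens_act_tens:
  assumes "hmod M" "hmod N"
  shows "tens_act n q M N (tens f g) = kron_mat (Act M f) (Act N g)"
proof -
  interpret M: matrep "fst M" "Act M" using assms by (simp add: hmod_iff_matrep)
  interpret N: matrep "fst N" "Act N" using assms by (simp add: hmod_iff_matrep)
  have 1: "tens_act n q M N (tens (Poly_Mapping.single u a) g) = kron_mat (Act M (Poly_Mapping.single u a)) (Act N g)" for u a
  proof (induction g rule: poly_mapping_induct_sum)
    case zero
    then show ?case using kron_mat_zero(2)[OF M.carrier] by (simp add: tens_act_0 N.zero)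
  next
    case (single v b)
    then show ?case
      using M.scal_mult[of a "word_elt u"] N.scal_mult[of b "word_elt v"]
      by (simp add: tens_single tens_act_single assms kron_mat_smult flip: single_eq_scal_mult)
  next
    case (add g g')
    then show ?case
      by (simp add: tens_add_right tens_act_add N.add kron_mat_add_right[OF N.carrier N.carrier])
  qed
  show ?thesis
  proof (induction f rule: poly_mapping_induct_sum)
    case zero
    then show ?case using kron_mat_zero(1)[OF N.carrier] by (simp add: tens_act_0 M.zero)
  next
    case (single v b)
    then show ?case by (rule 1)
  next
    case (add f f')
    then show ?case
      by (simp add: tens_add_left tens_act_add M.add kron_mat_add_left[OF M.carrier M.carrier])
  qed
qed

text \<open>Multiplicativity is checked on monomials, where it is the mixed-product rule
  \<open>kron_mat_mult\<close>.\<close>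

lemma matrep_tens_act:
  assumes "hmod M" "hmod N"
  shows "matrep (fst M * fst N) (tens_act n q M N)"
proof -
  interpret M: matrep "fst M" "Act M" using assms by (simp add: hmod_iff_matrep)
  interpret N: matrep "fst N" "Act N" using assms by (simp add: hmod_iff_matrep)
  let ?D = "fst M * fst N" and ?T = "tens_act n q M N"
  have mult1: "?T (Poly_Mapping.single w c * t) = ?T (Poly_Mapping.single w c) * ?T t" for w c t
  proof (induction t rule: poly_mapping_induct_sum)
    case zero
    then show ?case using right_mult_zero_mat[OF tens_act_carrier] by (simp add: tens_act_0)
  next
    case (single w' c')
    have "word_elt (a + b) = word_elt a * (word_elt b :: 'k free_alg)" for a b
      by (simp add: word_elt_def mult_single)
    moreover have "Poly_Mapping.single w c * Poly_Mapping.single w' c' = (Poly_Mapping.single (fst w + fst w', snd w + snd w') (c * c'))"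
      by (simp add: mult_single plus_prod_def)
    moreover have "a \<cdot>\<^sub>m (b \<cdot>\<^sub>m A) = (a * b) \<cdot>\<^sub>m A" for a b and A :: "'k mat"
      by (auto intro!: eq_matI)
    ultimately show ?case
      using kron_mat_carrier[OF M.carrier N.carrier]
      by (simp add: tens_act_single assms M.mult N.mult kron_mat_mult[OF M.carrier M.carrier N.carrier N.carrier, symmetric]
          mult_smult_distrib[of _ ?D ?D _ ?D] mult_smult_assoc_mat[of _ ?D ?D _ ?D] mult.commute[of c' c])
  next
    case (add s t)
    then show ?case
      by (simp add: distrib_left tens_act_add mult_add_distrib_mat[OF tens_act_carrier tens_act_carrier tens_act_carrier])
  qed
  show ?thesis
  proof
    show "?T (f * g) = ?T f * ?T g" for f g
    proof (induction f rule: poly_mapping_induct_sum)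
      case zero
      then show ?case using left_mult_zero_mat[OF tens_act_carrier] by (simp add: tens_act_0)
    next
      case (single w c)
      then show ?case by (rule mult1)
    next
      case (add s t)
      then show ?case
        by (simp add: distrib_right tens_act_add add_mult_distrib_mat[OF tens_act_carrier tens_act_carrier tens_act_carrier])
    qed
    show "?T (scal c) = c \<cdot>\<^sub>m 1\<^sub>m ?D" for c
    proof -
      have "?T (tens (scal c) 1) = kron_mat (c \<cdot>\<^sub>m 1\<^sub>m (fst M)) (1 \<cdot>\<^sub>m 1\<^sub>m (fst N))"
        using N.scal[of 1] by (simp add: tens_act_tens assms M.scal)
      then show ?thesis by (simp add: tens_scal kron_mat_smult kron_mat_one)
    qed
  qed (rule tens_act_carrier tens_act_add)+
qed

text \<open>\<open>hmod_tensor\<close> evaluates \<open>tens_act\<close> on cosets, which is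
  meaningful because \<open>tens_act\<close> kills \<open>HH_ideal\<close>: the generators r
  \<otimes> 1 and 1 \<otimes> r act by Kronecker products with a zero factor.\<close>

lemma act_tensor:
  assumes "hmod M" "hmod N"
  shows "Act (tensor M N) f = tens_act n q M N (Delta n q f)"
proof -
  interpret M: matrep "fst M" "Act M" using assms by (simp add: hmod_iff_matrep)
  interpret N: matrep "fst N" "Act N" using assms by (simp add: hmod_iff_matrep)
  interpret T: matrep "fst M * fst N" "tens_act n q M N" by (rule matrep_tens_act[OF assms])
  let ?D = "fst M * fst N"
  have zero: "Act M' r = 0\<^sub>m (fst M') (fst M')" if "r \<in> H_ideal n q" "hmod M'" for r M'
    using act_cong[of r 0 M'] that matrep.zero by (auto simp: H.eqv_def hmod_iff_matrep)
  have "HH_ideal n q \<subseteq> {t. tens_act n q M N t = 0\<^sub>m ?D ?D}"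
    unfolding HH_ideal_def
    by (rule genideal_subset[OF T.kernel])
      (auto simp: tens_act_tens assms zero kron_mat_zero(1)[OF N.carrier] kron_mat_zero(2)[OF M.carrier])
  then have "tens_act n q M N s = tens_act n q M N t" if "HH.eqv s t" for s t
  proof -
    have "tens_act n q M N (s - t) = 0\<^sub>m ?D ?D" using that \<open>_ \<subseteq> _\<close> by (auto simp: HH.eqv_def)
    then have "tens_act n q M N (s - t) + tens_act n q M N t = tens_act n q M N t"
      using tens_act_carrier by simp
    then show ?thesis by (simp flip: tens_act_add)
  qed
  then show ?thesis
    unfolding act_def hmod_tensor_def HH_cls_def comult_H_cls snd_conv
    by (rule HH.on_coset_eq)
qed

lemma hmod_tensor:
  assumes "hmod M" "hmod N" shows "hmod (tensor M N)"
proof -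
  interpret T: matrep "fst M * fst N" "tens_act n q M N" by (rule matrep_tens_act[OF assms])
  show ?thesis
    unfolding hmod_iff_matrep
    by unfold_locales
      (simp_all add: act_tensor assms Delta.hom_add Delta.hom_mult Delta.hom_scal T.add T.mult T.scal)
qed

lemma iso_tensor:
  assumes mods: "hmod M" "hmod N" "hmod M'" "hmod N'" and "iso M M'" "iso N N'"
  shows "iso (tensor M N) (tensor M' N')"
proof -
  obtain P Q where d: "fst M' = fst M" and P: "P \<in> carrier_mat (fst M) (fst M)" "Q \<in> carrier_mat (fst M) (fst M)"
    "Q * P = 1\<^sub>m (fst M)" "\<And>f. P * Act M f = Act M' f * P"
    using \<open>iso M M'\<close> by (auto simp: iso_iff)
  obtain P' Q' where d': "fst N' = fst N" and P': "P' \<in> carrier_mat (fst N) (fst N)" "Q' \<in> carrier_mat (fst N) (fst N)"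
    "Q' * P' = 1\<^sub>m (fst N)" "\<And>f. P' * Act N f = Act N' f * P'"
    using \<open>iso N N'\<close> by (auto simp: iso_iff)
  show ?thesis
  proof (rule isoI[of _ _ "kron_mat P P'" "kron_mat Q Q'"])
    show "kron_mat Q Q' * kron_mat P P' = 1\<^sub>m (fst (tensor M N))"
      using kron_mat_mult[OF P(2,1) P'(2,1)] P P' by (simp add: kron_mat_one)
    show "kron_mat P P' * Act (tensor M N) f = Act (tensor M' N') f * kron_mat P P'" for f
      by (simp add: act_tensor mods) (rule tens_intertwine, use mods P P' d d' in auto)
  qed (use P P' d d' in auto)
qed

lemma tensor_sum_left:
  assumes mods: "hmod M" "hmod M'" "hmod N"
  shows "iso (hmod_sum (tensor M N) (tensor M' N)) (tensor (hmod_sum M M') N)"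
proof -
  obtain B1 B2 C1 C2 where
    B: "B1 \<in> carrier_mat (fst M + fst M') (fst M)" "B2 \<in> carrier_mat (fst M + fst M') (fst M')"
    and C: "C1 \<in> carrier_mat (fst M) (fst M + fst M')" "C2 \<in> carrier_mat (fst M') (fst M + fst M')"
    and CB: "C1 * B1 = 1\<^sub>m (fst M)" "C2 * B2 = 1\<^sub>m (fst M')" "C1 * B2 = 0\<^sub>m (fst M) (fst M')" "C2 * B1 = 0\<^sub>m (fst M') (fst M)"
    and inter: "\<forall>f. Act (hmod_sum M M') f * B1 = B1 * Act M f" "\<forall>f. Act (hmod_sum M M') f * B2 = B2 * Act M' f"
    by (rule sum_biproduct[OF mods(1,2)])
  interpret N: matrep "fst N" "Act N" using mods by (simp add: hmod_iff_matrep)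
  let ?I = "1\<^sub>m (fst N) :: 'k mat"
  have I: "?I \<in> carrier_mat (fst N) (fst N)" by simp
  note S = hmod_sum[OF mods(1,2)]
  note act = act_tensor[OF mods(1,3)] act_tensor[OF mods(2,3)] act_tensor[OF S mods(3)]
  show ?thesis
  proof (rule iso_sumI[of _ _ _ "kron_mat B1 ?I" "kron_mat B2 ?I" "kron_mat C1 ?I" "kron_mat C2 ?I"])
    show "Act (tensor (hmod_sum M M') N) f * kron_mat B1 ?I = kron_mat B1 ?I * Act (tensor M N) f" for f
      unfolding act by (rule tens_intertwine[symmetric, OF mods(1,3) S mods(3)]) (use B I inter in auto)
    show "Act (tensor (hmod_sum M M') N) f * kron_mat B2 ?I = kron_mat B2 ?I * Act (tensor M' N) f" for f
      unfolding act by (rule tens_intertwine[symmetric, OF mods(2,3) S mods(3)]) (use B I inter in auto)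
    show "kron_mat C1 ?I * kron_mat B1 ?I = 1\<^sub>m (fst (tensor M N))"
      "kron_mat C2 ?I * kron_mat B2 ?I = 1\<^sub>m (fst (tensor M' N))"
      "kron_mat C1 ?I * kron_mat B2 ?I = 0\<^sub>m (fst (tensor M N)) (fst (tensor M' N))"
      "kron_mat C2 ?I * kron_mat B1 ?I = 0\<^sub>m (fst (tensor M' N)) (fst (tensor M N))"
      by (simp_all add: kron_mat_mult[OF C(1) B(1) I I] kron_mat_mult[OF C(1) B(2) I I]
          kron_mat_mult[OF C(2) B(1) I I] kron_mat_mult[OF C(2) B(2) I I] CB kron_mat_one kron_mat_zero[OF I])
  qed (simp_all add: hmod_tensor mods S distrib_right kron_mat_carrier[OF _ I, of _ "fst M + fst M'", unfolded distrib_right]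
      kron_mat_carrier[OF _ I, of _ _ "fst M + fst M'", unfolded distrib_right] B C)
qed

lemma tensor_sum_right:
  assumes mods: "hmod M" "hmod M'" "hmod N"
  shows "iso (hmod_sum (tensor N M) (tensor N M')) (tensor N (hmod_sum M M'))"
proof -
  obtain B1 B2 C1 C2 where
    B: "B1 \<in> carrier_mat (fst M + fst M') (fst M)" "B2 \<in> carrier_mat (fst M + fst M') (fst M')"
    and C: "C1 \<in> carrier_mat (fst M) (fst M + fst M')" "C2 \<in> carrier_mat (fst M') (fst M + fst M')"
    and CB: "C1 * B1 = 1\<^sub>m (fst M)" "C2 * B2 = 1\<^sub>m (fst M')" "C1 * B2 = 0\<^sub>m (fst M) (fst M')" "C2 * B1 = 0\<^sub>m (fst M') (fst M)"
    and inter: "\<forall>f. Act (hmod_sum M M') f * B1 = B1 * Act M f" "\<forall>f. Act (hmod_sum M M') f * B2 = B2 * Act M' f"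
    by (rule sum_biproduct[OF mods(1,2)])
  interpret N: matrep "fst N" "Act N" using mods by (simp add: hmod_iff_matrep)
  let ?I = "1\<^sub>m (fst N) :: 'k mat"
  have I: "?I \<in> carrier_mat (fst N) (fst N)" by simp
  note S = hmod_sum[OF mods(1,2)]
  note act = act_tensor[OF mods(3,1)] act_tensor[OF mods(3,2)] act_tensor[OF mods(3) S]
  show ?thesis
  proof (rule iso_sumI[of _ _ _ "kron_mat ?I B1" "kron_mat ?I B2" "kron_mat ?I C1" "kron_mat ?I C2"])
    show "Act (tensor N (hmod_sum M M')) f * kron_mat ?I B1 = kron_mat ?I B1 * Act (tensor N M) f" for f
      unfolding act by (rule tens_intertwine[symmetric, OF mods(3,1) mods(3) S]) (use B I inter in auto)
    show "Act (tensor N (hmod_sum M M')) f * kron_mat ?I B2 = kron_mat ?I B2 * Act (tensor N M') f" for f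
      unfolding act by (rule tens_intertwine[symmetric, OF mods(3,2) mods(3) S]) (use B I inter in auto)
    show "kron_mat ?I C1 * kron_mat ?I B1 = 1\<^sub>m (fst (tensor N M))"
      "kron_mat ?I C2 * kron_mat ?I B2 = 1\<^sub>m (fst (tensor N M'))"
      "kron_mat ?I C1 * kron_mat ?I B2 = 0\<^sub>m (fst (tensor N M)) (fst (tensor N M'))"
      "kron_mat ?I C2 * kron_mat ?I B1 = 0\<^sub>m (fst (tensor N M')) (fst (tensor N M))"
      by (simp_all add: kron_mat_mult[OF I I C(1) B(1)] kron_mat_mult[OF I I C(1) B(2)]
          kron_mat_mult[OF I I C(2) B(1)] kron_mat_mult[OF I I C(2) B(2)] CB kron_mat_one kron_mat_zero[OF I])
  qed (simp_all add: hmod_tensor mods S distrib_left kron_mat_carrier[OF I, of _ "fst M + fst M'", unfolded distrib_left]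
      kron_mat_carrier[OF I, of _ _ "fst M + fst M'", unfolded distrib_left] B C)
qed

end

subsection \<open>Diagonal matrices and scalar sums\<close>

definition dg :: "nat \<Rightarrow> (nat \<Rightarrow> 'k::field) \<Rightarrow> 'k mat" where
  "dg d f = mat d d (\<lambda>(i, j). if i = j then f i else 0)"

lemma dg_carrier [simp, intro]: "dg d f \<in> carrier_mat d d"
  by (simp add: dg_def)

lemma dg_index [simp]: "i < d \<Longrightarrow> j < d \<Longrightarrow> dg d f $$ (i, j) = (if i = j then f i else 0)"
  "dim_row (dg d f) = d" "dim_col (dg d f) = d"
  by (simp_all add: dg_def)

lemma dg_mult_index:
  assumes "A \<in> carrier_mat d e" "i < d" "j < e"
  shows "(dg d f * A) $$ (i, j) = f i * A $$ (i, j)"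
  using assms by (subst mult_mat_index[of _ d d _ e]) (simp_all add: if_distrib[where f = "\<lambda>x. x * _"] sum.delta cong: if_cong)

lemma mult_dg_index:
  assumes "A \<in> carrier_mat e d" "i < e" "j < d"
  shows "(A * dg d f) $$ (i, j) = A $$ (i, j) * f j"
  using assms by (subst mult_mat_index[of _ e d _ d]) (simp_all add: if_distrib[where f = "\<lambda>x. _ * x"] sum.delta cong: if_cong)

lemma dg_mult: "dg d f * dg d g = dg d (\<lambda>i. f i * g i)"
  by (rule eq_matI) (auto simp: dg_mult_index[of _ d d] simp del: index_mult_mat(1))

lemma dg_power: "dg d f ^\<^sub>m k = dg d (\<lambda>i. f i ^ k)"
proof (induction k)
  case (Suc k)
  then show ?case by (simp add: dg_mult mult.commute)
qed (auto intro!: eq_matI)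

lemma dg_smult: "c \<cdot>\<^sub>m dg d f = dg d (\<lambda>i. c * f i)"
  by (rule eq_matI) auto

lemma dg_one: "1\<^sub>m d = dg d (\<lambda>_. 1)"
  by (rule eq_matI) auto

lemma kron_dg: "kron_mat (dg a f) (dg b g) = dg (a * b) (\<lambda>k. f (k div b) * g (k mod b))"
proof (rule eq_matI)
  fix i j assume "i < dim_row (dg (a * b) (\<lambda>k. f (k div b) * g (k mod b)))" "j < dim_col (dg (a * b) (\<lambda>k. f (k div b) * g (k mod b)))"
  then have ij: "i < a * b" "j < a * b" by auto
  have "i div b = j div b \<Longrightarrow> i mod b = j mod b \<Longrightarrow> i = j" by (metis div_mult_mod_eq)
  then show "kron_mat (dg a f) (dg b g) $$ (i, j) = dg (a * b) (\<lambda>k. f (k div b) * g (k mod b)) $$ (i, j)"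
    using ij div_mod_less[OF ij(1)] div_mod_less[OF ij(2)]
    by (auto simp: kron_mat_index[of "dg a f" a a "dg b g" b b])
qed (auto simp: kron_mat_def)

context matrep
begin

lemma sum_dg:
  assumes "\<And>i. i \<in> A \<Longrightarrow> R (f i) = dg d (g i)"
  shows "R (Groups_Big.sum f A) = dg d (\<lambda>r. \<Sum>i\<in>A. g i r)"
  using assms by (intro eq_matI) (auto simp: sum)

end

text \<open>A separate constant keeps scalars apart from the noncommutative products, so that
  \<open>smul_simps\<close> can collect them in front.\<close>

definition smul :: "'k::field \<Rightarrow> ('m::monoid_add \<Rightarrow>\<^sub>0 'k) \<Rightarrow> ('m \<Rightarrow>\<^sub>0 'k)" where
  "smul c f = scal c * f"

lemma smul_simps:
  "smul c f * g = smul c (f * g)" "f * smul c g = smul c (f * g)" "smul a (smul b f) = smul (a * b) f"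
  "smul c (f + g) = smul c f + smul c g" "smul 1 f = f" "smul 0 f = 0" "smul c 0 = 0"
  by (simp_all add: smul_def mult.assoc scal_left_commute[of f] scal_mult distrib_left)

lemma smul_sum: "smul c (sum f A) = (\<Sum>i\<in>A. smul c (f i))"
  by (simp add: smul_def sum_distrib_left)

lemma smul_sum_left: "(\<Sum>i\<in>A. smul (c i) f) = smul (sum c A) f"
  by (simp add: smul_def scal_sum sum_distrib_right)

lemma smul_add_left: "smul (a + b) f = smul a f + smul b f"
  by (simp add: smul_def scal_add distrib_right)

lemma bichar_smul: "bichar n q U W = smul (1 / of_nat n) (\<Sum>i<n. \<Sum>j<n. smul (inverse q ^ (i * j)) (U ^ i * W ^ j))"
  by (simp add: bichar_def smul_def mult.assoc)

lemma (in matrep) smul: "R (smul c f) = c \<cdot>\<^sub>m R f"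
  by (simp add: smul_def scal_mult)

section \<open>Eigenvectors and spectral idempotents of elements of finite order\<close>

context algebra_ideal
begin

lemma eqv_smul: "f \<doteq> g \<Longrightarrow> smul c f \<doteq> smul c g"
  unfolding smul_def by (rule eqv_left)

text \<open>By orthogonality the sum over j vanishes unless i is the residue of b, which leaves a
  single term.\<close>

lemma bichar_scalar: "(\<Sum>i<n. \<Sum>j<n. inverse q ^ (i * j) * (q ^ (a * i) * q ^ (b * j))) = of_nat n * q ^ (a * b)"
proof -
  have "(\<Sum>j<n. inverse q ^ (i * j) * (q ^ (a * i) * q ^ (b * j))) = (if i = b mod n then of_nat n * q ^ (a * b) else 0)" if "i < n" for i
  proof -
    have "(\<Sum>j<n. inverse q ^ (i * j) * (q ^ (a * i) * q ^ (b * j))) = q ^ (a * i) * (\<Sum>j<n. q ^ (j * b) * inverse q ^ (j * i))"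
      by (simp add: sum_distrib_left mult_ac)
    also have "\<dots> = q ^ (a * i) * (if b mod n = i then of_nat n else 0)"
      using primitive_root_orthogonality[OF prim n_pos, of b i] that by simp
    also have "q ^ (a * (b mod n)) = q ^ (a * b)"
      by (subst primitive_root_power_eq_iff[OF prim n_pos]) (simp add: mod_mult_right_eq)
    then have "q ^ (a * i) * (if b mod n = i then of_nat n else 0) = (if i = b mod n then of_nat n * q ^ (a * b) else 0)"
      by auto
    finally show ?thesis .
  qed
  then show ?thesis using n_pos by simp
qed

lemma eqv_power_eigen:
  assumes "U * f \<doteq> smul c f" shows "U ^ k * f \<doteq> smul (c ^ k) f"
proof (induction k)
  case (Suc k)
  have "U ^ Suc k * f = U * (U ^ k * f)" by (simp add: mult.assoc)
  also have "\<dots> \<doteq> U * smul (c ^ k) f" by (rule eqv_left[OF Suc])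
  also have "\<dots> = smul (c ^ k) (U * f)" by (simp add: smul_simps)
  also have "\<dots> \<doteq> smul (c ^ k) (smul c f)" by (rule eqv_smul[OF assms])
  finally show ?case by (simp add: smul_simps mult.commute)
qed (simp add: smul_simps)

lemma bichar_eigen:
  assumes "U * f \<doteq> smul (q ^ a) f" "W * f \<doteq> smul (q ^ b) f"
  shows "bichar n q U W * f \<doteq> smul (q ^ (a * b)) f"
proof -
  have UW: "U ^ i * W ^ j * f \<doteq> smul (q ^ (a * i) * q ^ (b * j)) f" for i j
  proof -
    have "U ^ i * W ^ j * f = U ^ i * (W ^ j * f)" by (simp add: mult.assoc)
    also have "\<dots> \<doteq> U ^ i * smul ((q ^ b) ^ j) f" by (intro eqv_left eqv_power_eigen assms)
    also have "\<dots> = smul ((q ^ b) ^ j) (U ^ i * f)" by (simp add: smul_simps)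
    also have "\<dots> \<doteq> smul ((q ^ b) ^ j) (smul ((q ^ a) ^ i) f)" by (intro eqv_smul eqv_power_eigen assms)
    finally show ?thesis by (simp add: smul_simps power_mult mult.commute)
  qed
  have "bichar n q U W * f = smul (1 / of_nat n) (\<Sum>i<n. \<Sum>j<n. smul (inverse q ^ (i * j)) (U ^ i * W ^ j * f))"
    by (simp add: bichar_smul smul_simps sum_distrib_right)
  also have "\<dots> \<doteq> smul (1 / of_nat n) (\<Sum>i<n. \<Sum>j<n. smul (inverse q ^ (i * j)) (smul (q ^ (a * i) * q ^ (b * j)) f))"
    by (intro eqv_smul eqv_sum UW)
  also have "\<dots> = smul (q ^ (a * b)) f"
    using n_nz by (simp add: smul_simps smul_sum_left bichar_scalar)
  finally show ?thesis .
qed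

text \<open>For U of order dividing n this is the spectral idempotent of U for the eigenvalue
  \<open>q ^ a\<close>, written as a finite Fourier transform of the powers of U.\<close>

definition pe :: "('m \<Rightarrow>\<^sub>0 'k) \<Rightarrow> nat \<Rightarrow> ('m \<Rightarrow>\<^sub>0 'k)" where
  "pe U a = smul (1 / of_nat n) (\<Sum>i<n. smul (inverse q ^ (a * i)) (U ^ i))"

lemma sum_pe: "(\<Sum>a<n. pe U a) = 1"
proof -
  have "(\<Sum>a<n. pe U a) = smul (1 / of_nat n) (\<Sum>i<n. smul (\<Sum>a<n. inverse q ^ (a * i)) (U ^ i))"
    unfolding pe_def smul_sum[symmetric] smul_sum_left[symmetric] by (subst sum.swap) simp
  also have "\<dots> = smul (1 / of_nat n) (\<Sum>i<n. if i = 0 then smul (of_nat n) 1 else 0)"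
    by (intro arg_cong[where f = "smul _"] sum.cong refl)
      (use primitive_root_orthogonality[OF prim n_pos, of 0] in \<open>auto simp: smul_simps\<close>)
  finally show ?thesis using n_pos n_nz by (simp add: smul_simps)
qed

lemma pe_commute:
  assumes "U * f \<doteq> f * W" shows "pe U a * f \<doteq> f * pe W a"
proof -
  have "pe U a * f = smul (1 / of_nat n) (\<Sum>i<n. smul (inverse q ^ (a * i)) (U ^ i * f))"
    by (simp add: pe_def smul_simps sum_distrib_right)
  also have "\<dots> \<doteq> smul (1 / of_nat n) (\<Sum>i<n. smul (inverse q ^ (a * i)) (f * W ^ i))"
    by (intro eqv_smul eqv_sum eqv_comm_power assms)
  also have "\<dots> = f * pe W a"
    by (simp add: pe_def smul_simps sum_distrib_left)
  finally show ?thesis .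
qed

text \<open>Multiplication by U shifts the summation index cyclically, at the cost of the factor
  \<open>q ^ a\<close> in the coefficients.\<close>

lemma pe_eigen:
  assumes "U ^ n \<doteq> 1"
  shows "U * pe U a \<doteq> smul (q ^ a) (pe U a)" "pe U a * U \<doteq> smul (q ^ a) (pe U a)"
proof -
  let ?g = "\<lambda>i. smul (inverse q ^ (a * i)) (U ^ i)"
  have step: "U * ?g i = smul (q ^ a) (smul (inverse q ^ (a * (i + 1))) (U ^ (i + 1)))" for i
    using q_nz by (simp add: smul_simps power_add field_simps)
  have mod: "smul (inverse q ^ (a * (i + 1))) (U ^ (i + 1)) \<doteq> ?g ((1 + i) mod n)" for i
  proof -
    have "inverse q ^ (a * (i + 1)) = inverse q ^ (a * ((1 + i) mod n))"
      unfolding power_inverse using primitive_root_power_eq_iff[OF prim n_pos, of "a * (i + 1)" "a * ((1 + i) mod n)"]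
      by (simp add: mod_mult_right_eq)
    moreover have "U ^ (i + 1) \<doteq> U ^ ((i + 1) mod n)" by (rule eqv_power_mod[OF assms])
    ultimately show ?thesis by (simp add: eqv_smul add.commute)
  qed
  have "U * pe U a = smul (1 / of_nat n) (\<Sum>i<n. U * ?g i)"
    by (simp add: pe_def smul_simps sum_distrib_left)
  also have "\<dots> \<doteq> smul (1 / of_nat n) (\<Sum>i<n. smul (q ^ a) (?g ((1 + i) mod n)))"
    unfolding step by (intro eqv_smul eqv_sum mod)
  also have "\<dots> = smul (q ^ a) (pe U a)"
    unfolding smul_sum[symmetric] sum_shift_mod[OF n_pos, of ?g] by (simp add: pe_def smul_simps mult.commute)
  finally show 1: "U * pe U a \<doteq> smul (q ^ a) (pe U a)" .
  have "pe U a * U \<doteq> U * pe U a" by (rule pe_commute) simp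
  then show "pe U a * U \<doteq> smul (q ^ a) (pe U a)" using 1 by (rule eqv_trans)
qed

lemma pe_mult_eigen:
  assumes "U * f \<doteq> smul (q ^ a) f" shows "pe U a * f \<doteq> f"
proof -
  have "pe U a * f = smul (1 / of_nat n) (\<Sum>i<n. smul (inverse q ^ (a * i)) (U ^ i * f))"
    by (simp add: pe_def smul_simps sum_distrib_right)
  also have "\<dots> \<doteq> smul (1 / of_nat n) (\<Sum>i<n. smul (inverse q ^ (a * i)) (smul ((q ^ a) ^ i) f))"
    by (intro eqv_smul eqv_sum eqv_power_eigen assms)
  also have "\<dots> = f"
  proof -
    have "inverse q ^ (a * i) * (q ^ a) ^ i = 1" for i
      using q_nz by (simp add: power_inverse flip: power_mult)
    then have "(\<Sum>i<n. smul (inverse q ^ (a * i)) (smul ((q ^ a) ^ i) f)) = smul (of_nat n) f"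
      unfolding smul_simps(3) smul_sum_left by simp
    then show ?thesis using n_nz by (simp add: smul_simps)
  qed
  finally show ?thesis .
qed

end

subsection \<open>Modules from generator matrices\<close>

text \<open>Matrices of a given size are not a type-class ring, so \<open>free_ext\<close> does not
  apply to them; words are multiplied out and then combined entrywise.\<close>

definition word_mat :: "nat \<Rightarrow> (letter \<Rightarrow> 'k::field mat) \<Rightarrow> letter list \<Rightarrow> 'k mat" where
  "word_mat d G ls = foldr (\<lambda>l A. G l * A) ls (1\<^sub>m d)"

definition gen_rep :: "nat \<Rightarrow> (letter \<Rightarrow> 'k::field mat) \<Rightarrow> 'k free_alg \<Rightarrow> 'k mat" where
  "gen_rep d G f = mat d d (\<lambda>ij. \<Sum>w\<in>Poly_Mapping.keys f. Poly_Mapping.lookup f w * word_mat d G (letters w) $$ ij)"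

lemma gen_rep:
  fixes G :: "letter \<Rightarrow> 'k::field mat"
  assumes G: "\<And>l. G l \<in> carrier_mat d d"
  shows "matrep d (gen_rep d G)" "gen_rep d G (word_elt (Word [l])) = G l"
proof -
  have W: "word_mat d G ls \<in> carrier_mat d d" for ls
    by (induction ls) (auto simp: word_mat_def intro!: mult_carrier_mat[OF G])
  have W_append: "word_mat d G (u @ v) = word_mat d G u * word_mat d G v" for u v
  proof (induction u)
    case Nil
    then show ?case using W[of v] by (simp add: word_mat_def)
  next
    case (Cons l u)
    have "word_mat d G ((l # u) @ v) = G l * word_mat d G (u @ v)" by (simp add: word_mat_def)
    also have "\<dots> = G l * word_mat d G u * word_mat d G v"
      unfolding Cons assoc_mult_mat[OF G W W] ..
    finally show ?case by (simp add: word_mat_def)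
  qed
  have c: "gen_rep d G f \<in> carrier_mat d d" for f by (simp add: gen_rep_def)
  have rep_single: "gen_rep d G (Poly_Mapping.single w c) = c \<cdot>\<^sub>m word_mat d G (letters w)" for w c
    using W[of "letters w"] by (auto intro!: eq_matI simp: gen_rep_def)
  have rep_zero: "gen_rep d G 0 = 0\<^sub>m d d" by (auto intro!: eq_matI simp: gen_rep_def)
  have rep_add: "gen_rep d G (f + g) = gen_rep d G f + gen_rep d G g" for f g
  proof (rule eq_matI)
    fix i j assume "i < dim_row (gen_rep d G f + gen_rep d G g)" "j < dim_col (gen_rep d G f + gen_rep d G g)"
    then show "gen_rep d G (f + g) $$ (i, j) = (gen_rep d G f + gen_rep d G g) $$ (i, j)"
      using sum_keys_add[of "\<lambda>w c. c * word_mat d G (letters w) $$ (i, j)" f g]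
      by (simp add: gen_rep_def distrib_right)
  qed (simp_all add: gen_rep_def)
  have mult1: "gen_rep d G (Poly_Mapping.single w a * g) = gen_rep d G (Poly_Mapping.single w a) * gen_rep d G g" for w a g
  proof (induction g rule: poly_mapping_induct_sum)
    case zero
    then show ?case using right_mult_zero_mat[OF c] by (simp add: rep_zero)
  next
    case (single v b)
    have "a \<cdot>\<^sub>m A * (b \<cdot>\<^sub>m B) = (a * b) \<cdot>\<^sub>m (A * B)" if "A \<in> carrier_mat d d" "B \<in> carrier_mat d d" for A B :: "'k mat"
      using that by (subst mult_smult_assoc_mat[of _ d d _ d], simp, simp, subst mult_smult_distrib[of _ d d _ d])
        (auto intro!: eq_matI)
    then show ?case using W by (simp add: mult_single rep_single plus_word_def W_append)
  next
    case (add g h)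
    then show ?case
      by (simp add: distrib_left rep_add mult_add_distrib_mat[OF c c c])
  qed
  show rep: "matrep d (gen_rep d G)"
  proof
    show "gen_rep d G (f * g) = gen_rep d G f * gen_rep d G g" for f g
    proof (induction f rule: poly_mapping_induct_sum)
      case zero
      then show ?case using left_mult_zero_mat[OF c] by (simp add: rep_zero)
    next
      case (single v b)
      then show ?case by (rule mult1)
    next
      case (add f h)
      then show ?case
        by (simp add: distrib_right rep_add add_mult_distrib_mat[OF c c c])
    qed
    show "gen_rep d G (scal a) = a \<cdot>\<^sub>m 1\<^sub>m d" for a
      by (simp add: scal_def rep_single zero_word_def word_mat_def)
  qed (rule c rep_add)+
  show "gen_rep d G (word_elt (Word [l])) = G l"
    using G[of l] by (auto simp: word_elt_def rep_single word_mat_def intro!: eq_matI)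
qed

context algebra_ideal
begin

lemma bichar_dg:
  assumes "matrep d R" "R U = dg d (\<lambda>r. q ^ a r)" "R W = dg d (\<lambda>r. q ^ b r)"
  shows "R (bichar n q U W) = dg d (\<lambda>r. q ^ (a r * b r))"
proof -
  interpret R: matrep d R by fact
  have "R (smul c (U ^ i * W ^ j)) = dg d (\<lambda>r. c * (q ^ (a r * i) * q ^ (b r * j)))" for c i j
    by (simp add: R.smul R.mult R.power assms dg_power dg_mult dg_smult power_mult)
  then have "R (bichar n q U W) = (1 / of_nat n) \<cdot>\<^sub>m dg d (\<lambda>r. \<Sum>i<n. \<Sum>j<n. inverse q ^ (i * j) * (q ^ (a r * i) * q ^ (b r * j)))"
    by (simp add: bichar_smul R.smul R.sum_dg)
  then show ?thesis using n_nz by (simp add: bichar_scalar dg_smult)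
qed

end

context hopf_data
begin

lemma p_nz: "p \<noteq> 0"
  using p_sq H.q_nz by auto

lemma p_power_sq: "p ^ a * p ^ a = q ^ a"
  by (simp add: p_sq[symmetric] power2_eq_square power_mult_distrib)

text \<open>
  Only for even \<open>n\<close> does \<open>p\<^bsup>aa\<^esup>\<close> depend on \<open>a\<close> modulo \<open>n\<close> alone.
\<close>

lemma p_power_mod: "p ^ ((a mod n) * (a mod n)) = p ^ (a * a)"
proof -
  obtain m where m: "n = 2 * m" using even_n by (rule evenE)
  define r k where "r = a mod n" and "k = a div n"
  have a: "a = n * k + r" by (simp add: r_def k_def)
  have pn: "p ^ (2 * n) = 1"
    using H.q_n p_sq by (simp add: power_mult)
  have "a * a = 2 * n * (k * r + m * k * k) + r * r"
    by (simp add: a m algebra_simps)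
  then have "p ^ (a * a) = (p ^ (2 * n)) ^ (k * r + m * k * k) * p ^ (r * r)"
    by (simp only: power_add[of p "2 * n * _"] power_mult[of p "2 * n"])
  then show ?thesis by (simp add: pn r_def)
qed

subsection \<open>The simple modules\<close>

text \<open>Once x and y are diagonal with powers of q as entries, \<open>bichar\<close> is diagonal
  by \<open>bichar_dg\<close>, and the relation for the square of z becomes an equation of diagonal
  matrices.\<close>

lemma diag_hmod:
  assumes R: "matrep d R" and x: "R fx = dg d (\<lambda>r. q ^ a r)" and y: "R fy = dg d (\<lambda>r. q ^ b r)"
    and zx: "R fz * R fx = R fy * R fz" and zy: "R fz * R fy = R fx * R fz"
    and zz: "R fz * R fz = dg d (\<lambda>r. q ^ (a r * b r))"
  shows "hmod (d, on_coset R)" "Act (d, on_coset R) = R"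
proof -
  interpret R: matrep d R by fact
  have pow: "(q ^ k) ^ n = 1" for k
    using H.q_n by (metis mult.commute power_mult power_one)
  have "R r = 0\<^sub>m d d" if "r \<in> H_rels n q" for r
    using that minus_r_inv_mat[OF R.carrier]
    by (auto simp: H_rels_bichar R.diff R.power R.mult R.one x y dg_power pow zx[unfolded x y] zy[unfolded x y] dg_mult
        mult.commute dg_one[symmetric] H.bichar_dg[OF R x y] power2_eq_square zz)
  then show "hmod (d, on_coset R)" "Act (d, on_coset R) = R"
    using rep_hmod[OF R] by auto
qed

definition sgn1 :: "bool \<Rightarrow> 'k" where "sgn1 s = (if s then 1 else - 1)"

primrec gens1 :: "nat \<Rightarrow> bool \<Rightarrow> letter \<Rightarrow> 'k mat" where
  "gens1 i s Lx = dg 1 (\<lambda>_. q ^ i)"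
| "gens1 i s Ly = dg 1 (\<lambda>_. q ^ i)"
| "gens1 i s Lz = dg 1 (\<lambda>_. sgn1 s * p ^ (i * i))"

definition simple1 :: "nat \<Rightarrow> bool \<Rightarrow> 'k hmod" where
  "simple1 i s = (1, on_coset (gen_rep 1 (gens1 i s)))"

text \<open>
  For \<open>a = b\<close> modulo \<open>n\<close> the module \<open>simple2 a b\<close> is not simple (see \<open>simple2_split\<close>). Allowing this
  case makes the formulas for tensor products uniform.
\<close>

primrec gens2 :: "nat \<Rightarrow> nat \<Rightarrow> letter \<Rightarrow> 'k mat" where
  "gens2 a b Lx = dg 2 (\<lambda>r. q ^ (if r = 0 then a else b))"
| "gens2 a b Ly = dg 2 (\<lambda>r. q ^ (if r = 0 then b else a))"
| "gens2 a b Lz = mat 2 2 (\<lambda>(i, j). if i = 0 \<and> j = 1 then q ^ (a * b) else if i = 1 \<and> j = 0 then 1 else 0)"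

definition simple2 :: "nat \<Rightarrow> nat \<Rightarrow> 'k hmod" where
  "simple2 a b = (2, on_coset (gen_rep 2 (gens2 a b)))"

lemma fst_simple [simp]: "fst (simple1 i s) = 1" "fst (simple2 a b) = 2"
  by (simp_all add: simple1_def simple2_def)

lemma gens_carrier: "gens1 i s l \<in> carrier_mat 1 1" "gens2 a b l \<in> carrier_mat 2 2"
  by (cases l; simp)+

lemma simple1: "hmod (simple1 i s)" "Act (simple1 i s) (gen l) = gens1 i s l"
proof -
  note g = gen_rep[of "gens1 i s" 1, OF gens_carrier(1)]
  have zz: "gens1 i s Lz * gens1 i s Lz = dg 1 (\<lambda>_. q ^ (i * i))"
    by (simp add: dg_mult sgn1_def p_power_sq)
  have "hmod (simple1 i s) \<and> Act (simple1 i s) = gen_rep 1 (gens1 i s)"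
    unfolding simple1_def
    by (intro conjI diag_hmod[OF g(1), of "\<lambda>_. i" "\<lambda>_. i"];
      (unfold g(2))?; (rule zz)?; simp add: dg_mult mult.commute)
  then show "hmod (simple1 i s)" "Act (simple1 i s) (gen l) = gens1 i s l"
    using g(2)[of l] by auto
qed

lemma sum_less_2: "(\<Sum>k<2. f k) = f 0 + f (1::nat)"
  by (simp add: numeral_2_eq_2)

lemma less_2: "i < (2::nat) \<longleftrightarrow> i = 0 \<or> i = 1" by auto

lemma simple2: "hmod (simple2 a b)" "Act (simple2 a b) (gen l) = gens2 a b l"
proof -
  note g = gen_rep[of "gens2 a b" 2, OF gens_carrier(2)]
  let ?Z = "gens2 a b Lz"
  have Z: "?Z \<in> carrier_mat 2 2" by (rule gens_carrier)
  have zx: "?Z * gens2 a b Lx = gens2 a b Ly * ?Z" "?Z * gens2 a b Ly = gens2 a b Lx * ?Z"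
    by (rule eq_matI; auto simp: mult_dg_index[of _ 2 2] dg_mult_index[of _ 2 2] less_2 simp del: index_mult_mat(1))+
  have zz: "?Z * ?Z = dg 2 (\<lambda>r. q ^ ((if r = 0 then a else b) * (if r = 0 then b else a)))"
  proof (rule eq_matI)
    fix i j assume "i < dim_row (dg 2 (\<lambda>r. q ^ ((if r = 0 then a else b) * (if r = 0 then b else a))))"
      "j < dim_col (dg 2 (\<lambda>r. q ^ ((if r = 0 then a else b) * (if r = 0 then b else a))))"
    then have ij: "i < 2" "j < 2" by auto
    show "(?Z * ?Z) $$ (i, j) = dg 2 (\<lambda>r. q ^ ((if r = 0 then a else b) * (if r = 0 then b else a))) $$ (i, j)"
      unfolding mult_mat_index[OF Z Z ij] sum_less_2 using ij by (auto simp: less_2 mult.commute)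
  qed auto
  have "hmod (simple2 a b) \<and> Act (simple2 a b) = gen_rep 2 (gens2 a b)"
    unfolding simple2_def
    by (intro conjI diag_hmod[OF g(1), of "\<lambda>r. if r = 0 then a else b" "\<lambda>r. if r = 0 then b else a"];
      (unfold g(2))?; (rule zx zz)?; simp)
  then show "hmod (simple2 a b)" "Act (simple2 a b) (gen l) = gens2 a b l"
    by (simp_all add: g(2))
qed

subsection \<open>Weight idempotents\<close>

text \<open>
  \<open>eid a b\<close> acts as the projection to the weight space \<open>x = q\<^sup>a\<close>, \<open>y = q\<^sup>b\<close>, and \<open>epm s a\<close> as the projection
  to the part of the weight space \<open>(a, a)\<close> where \<open>z\<close> has the eigenvalue \<open>\<plusminus>p\<^bsup>aa\<^esup>\<close> of sign \<open>s\<close>.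
\<close>

definition eid :: "nat \<Rightarrow> nat \<Rightarrow> 'k free_alg" where
  "eid a b = H.pe fx a * H.pe fy b"

lemma eid_comm: "H.eqv (H.pe fx a * H.pe fy b) (H.pe fy b * H.pe fx a)"
  by (intro H.pe_commute H.eqv_sym[OF H.pe_commute] H.eqv_sym[OF H_rels_eqv(3)])

lemma eid_eigen:
  "H.eqv (fx * eid a b) (smul (q ^ a) (eid a b))" "H.eqv (eid a b * fx) (smul (q ^ a) (eid a b))"
  "H.eqv (fy * eid a b) (smul (q ^ b) (eid a b))" "H.eqv (eid a b * fy) (smul (q ^ b) (eid a b))"
proof -
  note px = H.pe_eigen[OF H_rels_eqv(1), of a] and py = H.pe_eigen[OF H_rels_eqv(2), of b]
  show "H.eqv (fx * eid a b) (smul (q ^ a) (eid a b))"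
    using H.eqv_right[OF px(1)] by (simp add: eid_def smul_simps mult.assoc)
  show "H.eqv (eid a b * fy) (smul (q ^ b) (eid a b))"
    using H.eqv_left[OF py(2)] by (simp add: eid_def smul_simps mult.assoc)
  have c: "H.eqv (H.pe fy b * fx) (fx * H.pe fy b)" "H.eqv (fy * H.pe fx a) (H.pe fx a * fy)"
    by (intro H.pe_commute H.eqv_sym[OF H.pe_commute] H_rels_eqv(3) H.eqv_sym[OF H_rels_eqv(3)])+
  have "eid a b * fx = H.pe fx a * (H.pe fy b * fx)" by (simp add: eid_def mult.assoc)
  also have "H.eqv \<dots> (H.pe fx a * (fx * H.pe fy b))" by (rule H.eqv_left[OF c(1)])
  also have "\<dots> = (H.pe fx a * fx) * H.pe fy b" by (simp add: mult.assoc)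
  also have "H.eqv \<dots> (smul (q ^ a) (H.pe fx a) * H.pe fy b)" by (rule H.eqv_right[OF px(2)])
  finally show "H.eqv (eid a b * fx) (smul (q ^ a) (eid a b))" by (simp add: eid_def smul_simps)
  have "fy * eid a b = fy * H.pe fx a * H.pe fy b" by (simp add: eid_def mult.assoc)
  also have "H.eqv \<dots> (H.pe fx a * fy * H.pe fy b)" by (rule H.eqv_right[OF c(2)])
  also have "\<dots> = H.pe fx a * (fy * H.pe fy b)" by (simp add: mult.assoc)
  also have "H.eqv \<dots> (H.pe fx a * smul (q ^ b) (H.pe fy b))" by (rule H.eqv_left[OF py(1)])
  finally show "H.eqv (fy * eid a b) (smul (q ^ b) (eid a b))" by (simp add: eid_def smul_simps)
qed

lemma eid_mult_eigen:
  assumes "H.eqv (fx * f) (smul (q ^ a) f)" "H.eqv (fy * f) (smul (q ^ b) f)"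
  shows "H.eqv (eid a b * f) f"
proof -
  have "eid a b * f = H.pe fx a * (H.pe fy b * f)" by (simp add: eid_def mult.assoc)
  also have "H.eqv \<dots> (H.pe fx a * f)" by (intro H.eqv_left H.pe_mult_eigen assms)
  also have "H.eqv \<dots> f" by (intro H.pe_mult_eigen assms)
  finally show ?thesis .
qed

lemma eid_idem: "H.eqv (eid a b * eid a b) (eid a b)"
  by (intro eid_mult_eigen eid_eigen)

lemma z_eid: "H.eqv (fz * eid a b) (eid b a * fz)"
proof -
  have "fz * eid a b = fz * H.pe fx a * H.pe fy b" by (simp add: eid_def mult.assoc)
  also have "H.eqv \<dots> (H.pe fy a * fz * H.pe fy b)"
    by (intro H.eqv_right H.eqv_sym[OF H.pe_commute] H.eqv_sym[OF H_rels_eqv(4)])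
  also have "\<dots> = H.pe fy a * (fz * H.pe fy b)" by (simp add: mult.assoc)
  also have "H.eqv \<dots> (H.pe fy a * (H.pe fx b * fz))"
    by (intro H.eqv_left H.eqv_sym[OF H.pe_commute] H.eqv_sym[OF H_rels_eqv(5)])
  also have "\<dots> = H.pe fy a * H.pe fx b * fz" by (simp add: mult.assoc)
  also have "H.eqv \<dots> (H.pe fx b * H.pe fy a * fz)" by (intro H.eqv_right H.eqv_sym[OF eid_comm])
  finally show ?thesis by (simp add: eid_def)
qed

lemma zz_eid: "H.eqv (fz * (fz * eid a b)) (smul (q ^ (a * b)) (eid a b))"
proof -
  have "fz * (fz * eid a b) = fz ^ 2 * eid a b" by (simp add: power2_eq_square mult.assoc)
  also have "H.eqv \<dots> (bichar n q fx fy * eid a b)" by (rule H.eqv_right[OF H_rels_eqv(6)])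
  also have "H.eqv \<dots> (smul (q ^ (a * b)) (eid a b))" by (intro H.bichar_eigen eid_eigen)
  finally show ?thesis .
qed

lemma sum_eid: "(\<Sum>a<n. \<Sum>b<n. eid a b) = 1"
  by (simp add: eid_def H.sum_pe flip: sum_product)

definition epm :: "bool \<Rightarrow> nat \<Rightarrow> 'k free_alg" where
  "epm s a = smul (1 / 2) (eid a a + smul (sgn1 s * inverse p ^ (a * a)) (eid a a * fz))"

text \<open>Put c = \<open>sgn1 s * p ^ (a * a)\<close>. On the weight (a, a) the square of z is the
  square of c, and \<open>epm s a\<close> is half of 1 + z / c there, so multiplying it by z amounts
  to multiplying it by c.\<close>

lemma epm_z: "H.eqv (fz * epm s a) (smul (sgn1 s * p ^ (a * a)) (epm s a))"
    "H.eqv (epm s a * fz) (smul (sgn1 s * p ^ (a * a)) (epm s a))"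
proof -
  let ?e = "eid a a" and ?t = "sgn1 s * inverse p ^ (a * a)" and ?u = "sgn1 s * p ^ (a * a)"
  have ut: "?u * ?t = 1" using p_nz by (simp add: sgn1_def power_inverse)
  have tq: "?t * q ^ (a * a) = ?u" using p_nz p_power_sq[of "a * a"]
    by (simp add: sgn1_def power_inverse field_simps)
  have ez: "H.eqv (fz * ?e) (?e * fz)" by (rule z_eid)
  have ezz: "H.eqv (fz * (?e * fz)) (smul (q ^ (a * a)) ?e)" "H.eqv (?e * fz * fz) (smul (q ^ (a * a)) ?e)"
  proof -
    show 1: "H.eqv (fz * (?e * fz)) (smul (q ^ (a * a)) ?e)"
      using H.eqv_trans[OF H.eqv_left[OF H.eqv_sym[OF ez]] zz_eid] .
    have "H.eqv (?e * fz * fz) (fz * ?e * fz)" by (rule H.eqv_right[OF H.eqv_sym[OF ez]])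
    also have "\<dots> = fz * (?e * fz)" by (simp add: mult.assoc)
    finally show "H.eqv (?e * fz * fz) (smul (q ^ (a * a)) ?e)" using 1 by (rule H.eqv_trans)
  qed
  have rhs: "smul (1 / 2) (?e * fz + smul ?t (smul (q ^ (a * a)) ?e)) = smul ?u (epm s a)"
  proof -
    have "smul ?t (smul (q ^ (a * a)) ?e) = smul ?u ?e" unfolding smul_simps(3) tq ..
    moreover have "?e * fz = smul ?u (smul ?t (?e * fz))" unfolding smul_simps(3) ut smul_simps(5) ..
    ultimately have "?e * fz + smul ?t (smul (q ^ (a * a)) ?e) = smul ?u (?e + smul ?t (?e * fz))"
      unfolding smul_simps(4) by (simp only: add.commute)
    then show ?thesis by (simp only: epm_def smul_simps(3) mult.commute)
  qed
  have "fz * epm s a = smul (1 / 2) (fz * ?e + smul ?t (fz * (?e * fz)))"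
    by (simp add: epm_def smul_simps distrib_left)
  also have "H.eqv \<dots> (smul (1 / 2) (?e * fz + smul ?t (smul (q ^ (a * a)) ?e)))"
    by (intro H.eqv_smul H.eqv_add ez ezz)
  finally show "H.eqv (fz * epm s a) (smul ?u (epm s a))" unfolding rhs .
  have "epm s a * fz = smul (1 / 2) (?e * fz + smul ?t (?e * fz * fz))"
    by (simp add: epm_def smul_simps distrib_right)
  also have "H.eqv \<dots> (smul (1 / 2) (?e * fz + smul ?t (smul (q ^ (a * a)) ?e)))"
    by (intro H.eqv_smul H.eqv_add H.eqv_refl ezz)
  finally show "H.eqv (epm s a * fz) (smul ?u (epm s a))" unfolding rhs .
qed

lemma epm_xy: 
  "H.eqv (fx * epm s a) (smul (q ^ a) (epm s a))" "H.eqv (fy * epm s a) (smul (q ^ a) (epm s a))"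
  "H.eqv (epm s a * fx) (smul (q ^ a) (epm s a))" "H.eqv (epm s a * fy) (smul (q ^ a) (epm s a))"
proof -
  let ?e = "eid a a" and ?t = "sgn1 s * inverse p ^ (a * a)"
  have l: "H.eqv (g * epm s a) (smul (q ^ a) (epm s a))" if "H.eqv (g * ?e) (smul (q ^ a) ?e)" for g
  proof -
    have "g * epm s a = smul (1 / 2) (g * ?e + smul ?t (g * ?e * fz))"
      by (simp add: epm_def smul_simps distrib_left mult.assoc)
    also have "H.eqv \<dots> (smul (1 / 2) (smul (q ^ a) ?e + smul ?t (smul (q ^ a) ?e * fz)))"
      by (intro H.eqv_smul H.eqv_add H.eqv_right that)
    finally show ?thesis by (simp add: epm_def smul_simps mult_ac)
  qed
  show "H.eqv (fx * epm s a) (smul (q ^ a) (epm s a))" "H.eqv (fy * epm s a) (smul (q ^ a) (epm s a))"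
    by (intro l eid_eigen)+
  have r: "H.eqv (epm s a * g) (smul (q ^ a) (epm s a))"
    if "H.eqv (?e * g) (smul (q ^ a) ?e)" "H.eqv (?e * h) (smul (q ^ a) ?e)" "H.eqv (fz * g) (h * fz)" for g h
  proof -
    have "H.eqv (?e * (fz * g)) (?e * (h * fz))" by (rule H.eqv_left[OF that(3)])
    also have "\<dots> = ?e * h * fz" by (simp add: mult.assoc)
    also have "H.eqv \<dots> (smul (q ^ a) ?e * fz)" by (rule H.eqv_right[OF that(2)])
    finally have 1: "H.eqv (?e * (fz * g)) (smul (q ^ a) ?e * fz)" .
    have "epm s a * g = smul (1 / 2) (?e * g + smul ?t (?e * (fz * g)))"
      by (simp add: epm_def smul_simps distrib_right mult.assoc)
    also have "H.eqv \<dots> (smul (1 / 2) (smul (q ^ a) ?e + smul ?t (smul (q ^ a) ?e * fz)))"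
      by (intro H.eqv_smul H.eqv_add that 1)
    finally show ?thesis by (simp add: epm_def smul_simps mult_ac)
  qed
  show "H.eqv (epm s a * fx) (smul (q ^ a) (epm s a))"
    by (rule r[of _ fy]) (rule eid_eigen H_rels_eqv)+
  show "H.eqv (epm s a * fy) (smul (q ^ a) (epm s a))"
    by (rule r[of _ fx]) (rule eid_eigen H_rels_eqv)+
qed

text \<open>Expand the left factor only. On the right factor \<open>eid a a\<close> is the identity
  and z is the scalar \<open>?u\<close>; since \<open>?t * ?u = 1\<close>, the result is half of
  twice \<open>?f\<close>.\<close>

lemma epm_idem: "H.eqv (epm s a * epm s a) (epm s a)"
proof -
  let ?e = "eid a a" and ?t = "sgn1 s * inverse p ^ (a * a)" and ?u = "sgn1 s * p ^ (a * a)" and ?f = "epm s a"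
  have ef: "H.eqv (?e * ?f) ?f" by (intro eid_mult_eigen epm_xy)
  have "?f * ?f = smul (1 / 2) (?e * ?f + smul ?t (?e * (fz * ?f)))"
    by (subst (1) epm_def) (simp add: smul_simps distrib_right mult.assoc)
  also have "H.eqv \<dots> (smul (1 / 2) (?f + smul ?t (smul ?u ?f)))"
  proof (intro H.eqv_smul H.eqv_add ef)
    have "H.eqv (?e * (fz * ?f)) (?e * smul ?u ?f)" by (rule H.eqv_left[OF epm_z(1)])
    also have "\<dots> = smul ?u (?e * ?f)" by (simp add: smul_simps)
    also have "H.eqv \<dots> (smul ?u ?f)" by (rule H.eqv_smul[OF ef])
    finally show "H.eqv (?e * (fz * ?f)) (smul ?u ?f)" .
  qed
  also have "\<dots> = ?f"
  proof -
    have "?t * ?u = 1" using p_nz by (simp add: sgn1_def power_inverse)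
    then have "?f + smul ?t (smul ?u ?f) = smul (1 + 1) ?f"
      unfolding smul_add_left by (simp add: smul_simps)
    then show ?thesis using two_nz by (simp add: smul_simps)
  qed
  finally show ?thesis .
qed

lemma epm_sum: "epm True a + epm False a = eid a a"
proof -
  have "epm True a + epm False a = smul (1 / 2) (eid a a + eid a a + (smul (sgn1 True * inverse p ^ (a * a)) (eid a a * fz)
      + smul (sgn1 False * inverse p ^ (a * a)) (eid a a * fz)))"
    by (simp add: epm_def smul_simps)
  also have "smul (sgn1 True * inverse p ^ (a * a)) (eid a a * fz) + smul (sgn1 False * inverse p ^ (a * a)) (eid a a * fz) = 0"
    unfolding smul_add_left[symmetric] by (simp add: sgn1_def smul_simps)
  also have "eid a a + eid a a = smul (1 + 1) (eid a a)"
    unfolding smul_add_left by (simp add: smul_simps)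
  finally show ?thesis using two_nz by (simp add: smul_simps)
qed


subsection \<open>Splitting off a simple summand\<close>

text \<open>The \<open>f c\<close> multiply from the left like a basis of S, so their j-th columns
  span an image of S; dually, the i-th rows of the \<open>g c\<close> define an equivariant map to
  S. The entries of \<open>g c * f c'\<close> at (i, j) say that this map is a retraction of the
  first, which is therefore an embedding.\<close>

lemma split_by_elements:
  assumes mods: "hmod M" "hmod S" and ij: "i < fst M" "j < fst M"
    and f: "\<And>l c. c < fst S \<Longrightarrow> H.eqv (gen l * f c) (\<Sum>c'<fst S. smul (Act S (gen l) $$ (c', c)) (f c'))"
    and g: "\<And>l c. c < fst S \<Longrightarrow> H.eqv (g c * gen l) (\<Sum>c'<fst S. smul (Act S (gen l) $$ (c, c')) (g c'))"
    and gf: "\<And>c c'. c < fst S \<Longrightarrow> c' < fst S \<Longrightarrow> Act M (g c * f c') $$ (i, j) = (if c = c' then 1 else 0)"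
  obtains N where "hmod N" "fst M = fst S + fst N" "iso (hmod_sum S N) M"
proof -
  interpret M: matrep "fst M" "Act M" using mods by (simp add: hmod_iff_matrep)
  interpret S: matrep "fst S" "Act S" using mods by (simp add: hmod_iff_matrep)
  define d where "d = fst M"
  define r where "r = fst S"
  have Mc: "Act M h \<in> carrier_mat d d" and Sc: "Act S h \<in> carrier_mat r r" for h by (simp_all add: d_def r_def)
  define B where "B = mat d r (\<lambda>(k, c). Act M (f c) $$ (k, j))"
  define C where "C = mat r d (\<lambda>(c, k). Act M (g c) $$ (i, k))"
  have B: "B \<in> carrier_mat d r" and C: "C \<in> carrier_mat r d" by (auto simp: B_def C_def)
  have ij': "i < d" "j < d" using ij by (simp_all add: d_def)
  have CB: "C * B = 1\<^sub>m r"
  proof (rule eq_matI)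
    fix c c' assume "c < dim_row (1\<^sub>m r)" "c' < dim_col (1\<^sub>m r)"
    then have cc: "c < r" "c' < r" by auto
    have "(C * B) $$ (c, c') = (\<Sum>k<d. Act M (g c) $$ (i, k) * Act M (f c') $$ (k, j))"
      using cc by (subst mult_mat_index[OF C B]) (auto simp: B_def C_def)
    also have "\<dots> = Act M (g c * f c') $$ (i, j)"
      unfolding M.mult by (rule mult_mat_index[OF Mc Mc ij', symmetric])
    finally show "(C * B) $$ (c, c') = 1\<^sub>m r $$ (c, c')" using gf cc by (simp add: r_def)
  qed (use B C in auto)
  have B_gen: "B * Act S (gen l) = Act M (gen l) * B" for l
  proof (rule eq_matI)
    fix k c assume "k < dim_row (Act M (gen l) * B)" "c < dim_col (Act M (gen l) * B)"
    then have kc: "k < d" "c < r" using Mc[of "gen l"] B by auto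
    have "(Act M (gen l) * B) $$ (k, c) = (\<Sum>k'<d. Act M (gen l) $$ (k, k') * Act M (f c) $$ (k', j))"
      using kc by (subst mult_mat_index[OF Mc B]) (auto simp: B_def)
    also have "\<dots> = Act M (gen l * f c) $$ (k, j)"
      unfolding M.mult by (rule mult_mat_index[OF Mc Mc kc(1) ij'(2), symmetric])
    also have "\<dots> = Act M (\<Sum>c'<r. smul (Act S (gen l) $$ (c', c)) (f c')) $$ (k, j)"
      using act_cong[OF f[of c l]] kc by (simp add: r_def)
    also have "\<dots> = (\<Sum>c'<r. Act S (gen l) $$ (c', c) * Act M (f c') $$ (k, j))"
      using kc ij' by (simp add: M.sum_index M.smul flip: d_def)
    also have "\<dots> = (B * Act S (gen l)) $$ (k, c)"
      using kc by (subst mult_mat_index[OF B Sc]) (auto simp: B_def mult.commute)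
    finally show "(B * Act S (gen l)) $$ (k, c) = (Act M (gen l) * B) $$ (k, c)" ..
  qed (use B Mc[of "gen l"] Sc[of "gen l"] in auto)
  have C_gen: "C * Act M (gen l) = Act S (gen l) * C" for l
  proof (rule eq_matI)
    fix c k assume "c < dim_row (Act S (gen l) * C)" "k < dim_col (Act S (gen l) * C)"
    then have kc: "k < d" "c < r" using Sc[of "gen l"] C by auto
    have "(C * Act M (gen l)) $$ (c, k) = (\<Sum>k'<d. Act M (g c) $$ (i, k') * Act M (gen l) $$ (k', k))"
      using kc by (subst mult_mat_index[OF C Mc]) (auto simp: C_def)
    also have "\<dots> = Act M (g c * gen l) $$ (i, k)"
      unfolding M.mult by (rule mult_mat_index[OF Mc Mc ij'(1) kc(1), symmetric])
    also have "\<dots> = Act M (\<Sum>c'<r. smul (Act S (gen l) $$ (c, c')) (g c')) $$ (i, k)"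
      using act_cong[OF g[of c l]] kc by (simp add: r_def)
    also have "\<dots> = (\<Sum>c'<r. Act S (gen l) $$ (c, c') * Act M (g c') $$ (i, k))"
      using kc ij' by (simp add: M.sum_index M.smul flip: d_def)
    also have "\<dots> = (Act S (gen l) * C) $$ (c, k)"
      using kc by (subst mult_mat_index[OF Sc C]) (auto simp: C_def)
    finally show "(C * Act M (gen l)) $$ (c, k) = (Act S (gen l) * C) $$ (c, k)" .
  qed (use C Mc[of "gen l"] Sc[of "gen l"] in auto)
  note B' = B[unfolded d_def r_def] and C' = C[unfolded d_def r_def]
  show thesis
  proof (rule split_submodule[OF mods B' C'])
    show "C * B = 1\<^sub>m (fst S)" using CB by (simp add: r_def)
    show "Act M h * B = B * Act S h" for h
      by (rule intertwiner_generators[OF S.matrep_axioms M.matrep_axioms B' B_gen, symmetric])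
    show "C * Act M h = Act S h * C" for h
      by (rule intertwiner_generators[OF M.matrep_axioms S.matrep_axioms C' C_gen])
  qed (rule that)
qed

text \<open>The nonzero entry is the normalization: dividing one of the two copies of
  \<open>epm s a\<close> by it makes row and column pair to 1.\<close>

lemma split_simple1:
  assumes M: "hmod M" and ij: "i < fst M" "j < fst M" and nz: "Act M (epm s a) $$ (i, j) \<noteq> 0"
  obtains N where "hmod N" "fst M = 1 + fst N" "iso (hmod_sum (simple1 a s) N) M"
proof -
  interpret M: matrep "fst M" "Act M" using M by (simp add: hmod_iff_matrep)
  define \<kappa> where "\<kappa> = Act M (epm s a) $$ (i, j)"
  have l: "H.eqv (gen l * epm s a) (smul (gens1 a s l $$ (0, 0)) (epm s a))"
    "H.eqv (epm s a * gen l) (smul (gens1 a s l $$ (0, 0)) (epm s a))" for l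
    by (cases l; simp add: epm_xy epm_z)+
  have k: "Act M (smul (1 / \<kappa>) (epm s a) * epm s a) $$ (i, j) = 1"
    using act_cong[OF epm_idem, of M s a] ij nz
    by (simp add: smul_simps M.smul \<kappa>_def)
  have g: "H.eqv (smul (1 / \<kappa>) (epm s a) * gen l) (smul (gens1 a s l $$ (0, 0)) (smul (1 / \<kappa>) (epm s a)))" for l
    using H.eqv_smul[OF l(2)[of l], of "1 / \<kappa>"] by (simp add: smul_simps mult.commute)
  show thesis
    by (rule split_by_elements[OF M simple1(1)[of a s] ij, of "\<lambda>_. epm s a" "\<lambda>_. smul (1 / \<kappa>) (epm s a)"])
      (use l g k in \<open>auto simp: simple1(2) intro: that\<close>)
qed

text \<open>An x placed between the two factors acts as \<open>q ^ a\<close> on the left one and as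
  \<open>q ^ b\<close> on the right one.\<close>

lemma eid_orth:
  assumes "a mod n \<noteq> b mod n" shows "H.eqv (eid a b * eid b a) 0"
proof -
  let ?P = "eid a b * eid b a"
  have "smul (q ^ a) ?P = smul (q ^ a) (eid a b) * eid b a" by (simp add: smul_simps)
  also have "H.eqv \<dots> (eid a b * fx * eid b a)"
    by (rule H.eqv_right[OF H.eqv_sym[OF eid_eigen(2)]])
  also have "\<dots> = eid a b * (fx * eid b a)" by (simp add: mult.assoc)
  also have "H.eqv \<dots> (eid a b * smul (q ^ b) (eid b a))" by (rule H.eqv_left[OF eid_eigen(1)])
  also have "\<dots> = smul (q ^ b) ?P" by (simp add: smul_simps)
  finally have "H.eqv (smul (q ^ a) ?P - smul (q ^ b) ?P) 0" by (simp add: H.eqv_def)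
  moreover have "smul (q ^ a) ?P - smul (q ^ b) ?P = smul (q ^ a - q ^ b) ?P"
    using smul_add_left[of "q ^ a - q ^ b" "q ^ b" ?P] by simp
  ultimately have "H.eqv (smul (q ^ a - q ^ b) ?P) 0" by simp
  moreover have "q ^ a - q ^ b \<noteq> 0"
    using primitive_root_power_eq_iff[OF q_prim] assms n_gt_1 by simp
  ultimately show ?thesis
    using H.eqv_smul[of "smul (q ^ a - q ^ b) ?P" 0 "1 / (q ^ a - q ^ b)"] by (simp add: smul_simps)
qed

lemma split_simple2:
  assumes M: "hmod M" and ij: "i < fst M" "j < fst M" and nz: "Act M (eid a b) $$ (i, j) \<noteq> 0"
    and ab: "a mod n \<noteq> b mod n"
  obtains N where "hmod N" "fst M = 2 + fst N" "iso (hmod_sum (simple2 a b) N) M"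
proof -
  interpret M: matrep "fst M" "Act M" using M by (simp add: hmod_iff_matrep)
  define \<kappa> where "\<kappa> = Act M (eid a b) $$ (i, j)"
  define e where "e = eid a b"
  \<comment> \<open>The pair e, z e multiplies from the left like the basis of
    \<open>simple2 a b\<close>. The dual pair is e, e z up to scalars: e z e vanishes by
    \<open>eid_orth\<close>, and z z e is \<open>q ^ (a * b)\<close> times e.\<close>
  define f where "f c = (if c = 0 then e else fz * e)" for c :: nat
  define g where "g c = (if c = 0 then smul (1 / \<kappa>) e else smul (1 / (\<kappa> * q ^ (a * b))) (e * fz))" for c :: nat
  have qnz: "q ^ (a * b) \<noteq> 0" using H.q_nz by simp
  note ee = eid_eigen[of a b, folded e_def]
  have ze: "H.eqv (fz * e) (eid b a * fz)" "H.eqv (e * fz) (fz * eid b a)"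
    unfolding e_def by (rule z_eid, rule H.eqv_sym[OF z_eid])
  have zze: "H.eqv (fz * (fz * e)) (smul (q ^ (a * b)) e)" unfolding e_def by (rule zz_eid)
  have ezz: "H.eqv (e * fz * fz) (smul (q ^ (a * b)) e)"
  proof -
    have "H.eqv (e * fz * fz) (fz * eid b a * fz)" by (rule H.eqv_right[OF ze(2)])
    also have "\<dots> = fz * (eid b a * fz)" by (simp add: mult.assoc)
    also have "H.eqv \<dots> (fz * (fz * e))" by (rule H.eqv_left[OF H.eqv_sym[OF ze(1)]])
    finally show ?thesis using zze by (rule H.eqv_trans)
  qed
  have eze: "H.eqv (e * (fz * e)) 0"
  proof -
    have "H.eqv (e * (fz * e)) (e * (eid b a * fz))" by (rule H.eqv_left[OF ze(1)])
    also have "\<dots> = eid a b * eid b a * fz" by (simp add: e_def mult.assoc)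
    also have "H.eqv \<dots> (0 * fz)" by (rule H.eqv_right[OF eid_orth[OF ab]])
    finally show ?thesis by simp
  qed
  have idem: "H.eqv (e * e) e" unfolding e_def by (rule eid_idem)
  have xze: "H.eqv (fx * (fz * e)) (smul (q ^ b) (fz * e))" "H.eqv (fy * (fz * e)) (smul (q ^ a) (fz * e))"
  proof -
    have "H.eqv (fx * fz * e) (fz * fy * e)" "H.eqv (fy * fz * e) (fz * fx * e)"
      by (rule H.eqv_right, rule H.eqv_sym, rule H_rels_eqv)+
    moreover have "H.eqv (fz * (fy * e)) (fz * smul (q ^ b) e)" "H.eqv (fz * (fx * e)) (fz * smul (q ^ a) e)"
      by (intro H.eqv_left ee)+
    ultimately show "H.eqv (fx * (fz * e)) (smul (q ^ b) (fz * e))" "H.eqv (fy * (fz * e)) (smul (q ^ a) (fz * e))"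
      unfolding mult.assoc smul_simps by (blast intro: H.eqv_trans)+
  qed
  have ezx: "H.eqv (e * fz * fx) (smul (q ^ b) (e * fz))" "H.eqv (e * fz * fy) (smul (q ^ a) (e * fz))"
  proof -
    have "H.eqv (e * (fz * fx)) (e * (fy * fz))" "H.eqv (e * (fz * fy)) (e * (fx * fz))"
      by (rule H.eqv_left, rule H_rels_eqv)+
    moreover have "H.eqv (e * fy * fz) (smul (q ^ b) e * fz)" "H.eqv (e * fx * fz) (smul (q ^ a) e * fz)"
      by (intro H.eqv_right ee)+
    ultimately show "H.eqv (e * fz * fx) (smul (q ^ b) (e * fz))" "H.eqv (e * fz * fy) (smul (q ^ a) (e * fz))"
      unfolding mult.assoc smul_simps by (blast intro: H.eqv_trans)+
  qed
  show thesis
  proof (rule split_by_elements[OF M simple2(1)[of a b] ij, of f g])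
    fix l c assume "c < fst (simple2 a b)"
    then have c: "c = 0 \<or> c = 1" by auto
    show "H.eqv (gen l * f c) (\<Sum>c'<fst (simple2 a b). smul (Act (simple2 a b) (gen l) $$ (c', c)) (f c'))"
      using c ee(1,3) xze zze by (cases l) (auto simp: f_def simple2(2) sum_less_2 smul_simps)
    have sm: "H.eqv (smul k u) (smul k v)" if "H.eqv u v" for u v k by (rule H.eqv_smul[OF that])
    show "H.eqv (g c * gen l) (\<Sum>c'<fst (simple2 a b). smul (Act (simple2 a b) (gen l) $$ (c, c')) (g c'))"
    proof (cases l)
      case Lx
      then show ?thesis
        using c H.eqv_smul[OF ee(2), of "1 / \<kappa>"] H.eqv_smul[OF ezx(1), of "1 / (\<kappa> * q ^ (a * b))"]
        by (auto simp: g_def simple2(2) sum_less_2 smul_simps mult.commute)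
    next
      case Ly
      then show ?thesis
        using c H.eqv_smul[OF ee(4), of "1 / \<kappa>"] H.eqv_smul[OF ezx(2), of "1 / (\<kappa> * q ^ (a * b))"]
        by (auto simp: g_def simple2(2) sum_less_2 smul_simps mult.commute)
    next
      case Lz
      then show ?thesis
        using c H.eqv_smul[OF ezz, of "1 / (\<kappa> * q ^ (a * b))"] qnz
        by (auto simp: g_def simple2(2) sum_less_2 smul_simps)
    qed
  next
    fix c c' assume "c < fst (simple2 a b)" "c' < fst (simple2 a b)"
    then have c: "c = 0 \<or> c = 1" "c' = 0 \<or> c' = 1" by auto
    have k: "Act M e $$ (i, j) = \<kappa>" "\<kappa> \<noteq> 0" using nz by (simp_all add: \<kappa>_def e_def)
    have z: "Act M (e * (fz * e)) $$ (i, j) = 0"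
      using act_cong[OF eze, of M] ij by (simp add: M.zero)
    have "H.eqv (e * (fz * (fz * e))) (smul (q ^ (a * b)) e)"
    proof -
      have "H.eqv (e * (fz * (fz * e))) (e * smul (q ^ (a * b)) e)" by (rule H.eqv_left[OF zze])
      also have "\<dots> = smul (q ^ (a * b)) (e * e)" by (simp add: smul_simps)
      also have "H.eqv \<dots> (smul (q ^ (a * b)) e)" by (rule H.eqv_smul[OF idem])
      finally show ?thesis .
    qed
    then have zz: "Act M (e * (fz * (fz * e))) $$ (i, j) = q ^ (a * b) * \<kappa>"
      using act_cong[of _ _ M] ij k by (simp add: M.smul)
    have "Act M (e * e) $$ (i, j) = \<kappa>" using act_cong[OF idem, of M] k by simp
    then show "Act M (g c * f c') $$ (i, j) = (if c = c' then 1 else 0)"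
      using c z zz k qnz ij by (auto simp: f_def g_def smul_simps M.smul mult.assoc)
  qed (use that in auto)
qed

text \<open>The weight idempotents sum to 1, so one of them has a nonzero entry at (0, 0). For a
  weight (a, a) one of the two halves \<open>epm s a\<close> inherits this.\<close>

lemma exists_simple_summand:
  assumes M: "hmod M" and pos: "fst M > 0"
  obtains S N where "(\<exists>i s. i < n \<and> S = simple1 i s) \<or> (\<exists>a b. a < b \<and> b < n \<and> S = simple2 a b)"
    "hmod N" "fst M = fst S + fst N" "iso (hmod_sum S N) M"
proof -
  interpret M: matrep "fst M" "Act M" using M by (simp add: hmod_iff_matrep)
  have "(\<Sum>a<n. \<Sum>b<n. Act M (eid a b) $$ (0, 0)) = 1"
    using arg_cong[OF sum_eid, of "\<lambda>f. Act M f $$ (0, 0)"] pos by (simp add: M.sum_index M.one)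
  then obtain a b where ab: "a < n" "b < n" and nz: "Act M (eid a b) $$ (0, 0) \<noteq> 0"
    by (metis (no_types, lifting) lessThan_iff sum.neutral zero_neq_one)
  show thesis
  proof (cases "a = b")
    case True
    have "Act M (eid a b) $$ (0, 0) = Act M (epm True a) $$ (0, 0) + Act M (epm False a) $$ (0, 0)"
      using pos epm_sum[of a] by (simp add: True flip: M.add)
        (metis M.add M.dim index_add_mat(1))
    then obtain s where s: "Act M (epm s a) $$ (0, 0) \<noteq> 0" using nz by force
    obtain N where "hmod N" "fst M = 1 + fst N" "iso (hmod_sum (simple1 a s) N) M"
      by (rule split_simple1[OF M pos pos s])
    then show thesis
      using that[of "simple1 a s" N] ab(1) fst_simple(1) by metis
  next
    case False
    \<comment> \<open>Simple modules are indexed with the smaller weight first, so the idempotent of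
      the exchanged weight may be the one required. Multiplying it by z on both sides gives
      \<open>eid a b\<close> up to a unit, hence it does not act as zero either.\<close>
    have ex: "\<exists>i<fst M. \<exists>j<fst M. Act M (eid b a) $$ (i, j) \<noteq> 0"
    proof (rule ccontr)
      assume "\<not> ?thesis"
      then have "Act M (eid b a) = 0\<^sub>m (fst M) (fst M)" by (intro eq_matI) auto
      then have "Act M (fz * (eid b a * fz)) = 0\<^sub>m (fst M) (fst M)"
        using right_mult_zero_mat[OF M.carrier, of fz "fst M"] left_mult_zero_mat[OF M.carrier, of "fst M" fz]
        by (simp add: M.mult)
      moreover have "H.eqv (fz * (eid b a * fz)) (smul (q ^ (a * b)) (eid a b))"
        using H.eqv_trans[OF H.eqv_left[OF H.eqv_sym[OF z_eid]] zz_eid] .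
      then have "Act M (fz * (eid b a * fz)) $$ (0, 0) = q ^ (a * b) * Act M (eid a b) $$ (0, 0)"
        using act_cong[of _ _ M] pos by (simp add: M.smul)
      ultimately show False using nz H.q_nz pos by simp
    qed
    show thesis
    proof (cases "a < b")
      case True
      obtain N where "hmod N" "fst M = 2 + fst N" "iso (hmod_sum (simple2 a b) N) M"
        by (rule split_simple2[OF M pos pos nz]) (use ab True in auto)
      then show thesis
        using that[of "simple2 a b" N] ab(2) True fst_simple(2) by metis
    next
      case False
      with \<open>a \<noteq> b\<close> have "b < a" by simp
      obtain i j where "i < fst M" "j < fst M" "Act M (eid b a) $$ (i, j) \<noteq> 0" using ex by blast
      then obtain N where "hmod N" "fst M = 2 + fst N" "iso (hmod_sum (simple2 b a) N) M"
        by (rule split_simple2[OF M]) (use ab \<open>b < a\<close> in auto)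
      then show thesis
        using that[of "simple2 b a" N] ab(1) \<open>b < a\<close> fst_simple(2) by metis
    qed
  qed
qed


subsection \<open>Tensor products of simple modules\<close>

lemma iso_genI:
  assumes mods: "hmod M" "hmod N" and d: "fst M = d" "fst N = d"
    and P: "P \<in> carrier_mat d d" "Q \<in> carrier_mat d d" "Q * P = 1\<^sub>m d"
    and gens: "\<And>l. P * Act M (gen l) = Act N (gen l) * P"
  shows "iso M N"
proof -
  have "matrep d (Act M)" "matrep d (Act N)" using mods d by (simp_all add: hmod_iff_matrep)
  then show ?thesis
    using intertwiner_generators[of d "Act M" d "Act N" P] assms by (intro isoI[of M N P Q]) auto
qed

lemma iso_sum_genI:
  assumes mods: "hmod M" "hmod N" "hmod D" and d: "fst D = fst M + fst N"
    and B: "B1 \<in> carrier_mat (fst D) (fst M)" "B2 \<in> carrier_mat (fst D) (fst N)"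
    and C: "C1 \<in> carrier_mat (fst M) (fst D)" "C2 \<in> carrier_mat (fst N) (fst D)"
    and CB: "C1 * B1 = 1\<^sub>m (fst M)" "C2 * B2 = 1\<^sub>m (fst N)" "C1 * B2 = 0\<^sub>m (fst M) (fst N)" "C2 * B1 = 0\<^sub>m (fst N) (fst M)"
    and inter: "\<And>l. Act D (gen l) * B1 = B1 * Act M (gen l)" "\<And>l. Act D (gen l) * B2 = B2 * Act N (gen l)"
  shows "iso (hmod_sum M N) D"
proof -
  have m: "matrep (fst M) (Act M)" "matrep (fst N) (Act N)" "matrep (fst D) (Act D)"
    using mods by (simp_all add: hmod_iff_matrep)
  show ?thesis
    by (rule iso_sumI[OF mods d B C CB])
      (use intertwiner_generators[OF m(1) m(3) B(1)] intertwiner_generators[OF m(2) m(3) B(2)] inter in auto)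
qed

lemma act_tensor_xy:
  assumes "hmod M" "hmod N"
  shows "Act (tensor M N) fx = kron_mat (Act M fx) (Act N fx)" "Act (tensor M N) fy = kron_mat (Act M fy) (Act N fy)"
  by (simp_all add: act_tensor assms Delta_gen tens_act_tens)

text \<open>The twist in \<Delta>(z) acts diagonally, so it contributes a power of q that depends on
  the row index only.\<close>

lemma act_tensor_z:
  assumes mods: "hmod M" "hmod N"
    and x: "Act M fx = dg (fst M) (\<lambda>r. q ^ a r)" and y: "Act N fy = dg (fst N) (\<lambda>r. q ^ b r)"
    and kl: "k < fst M * fst N" "l < fst M * fst N"
  shows "Act (tensor M N) fz $$ (k, l) = q ^ (a (k div fst N) * b (k mod fst N)) *
    (Act M fz $$ (k div fst N, l div fst N) * Act N fz $$ (k mod fst N, l mod fst N))"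
proof -
  interpret M: matrep "fst M" "Act M" using mods by (simp add: hmod_iff_matrep)
  interpret N: matrep "fst N" "Act N" using mods by (simp add: hmod_iff_matrep)
  interpret T: matrep "fst M * fst N" "tens_act n q M N" by (rule matrep_tens_act[OF mods])
  have "tens_act n q M N (tens fx 1) = dg (fst M * fst N) (\<lambda>k. q ^ a (k div fst N))"
    "tens_act n q M N (tens 1 fy) = dg (fst M * fst N) (\<lambda>k. q ^ b (k mod fst N))"
    by (simp_all add: tens_act_tens mods x y M.one N.one dg_one kron_dg)
  from HH.bichar_dg[OF T.matrep_axioms this]
  have "Act (tensor M N) fz = dg (fst M * fst N) (\<lambda>k. q ^ (a (k div fst N) * b (k mod fst N))) * kron_mat (Act M fz) (Act N fz)"
    by (simp add: act_tensor mods Delta_gen T.mult tens_act_tens)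
  then show ?thesis
    using kl by (simp add: dg_mult_index[OF kron_mat_carrier[OF M.carrier N.carrier]]
        kron_mat_index[OF M.carrier N.carrier] del: index_mult_mat(1))
qed

lemma act1: "Act (simple1 i s) fx = dg 1 (\<lambda>r. q ^ i)" "Act (simple1 i s) fy = dg 1 (\<lambda>r. q ^ i)"
    "Act (simple1 i s) fz = dg 1 (\<lambda>_. sgn1 s * p ^ (i * i))"
  by (simp_all only: simple1(2) gens1.simps)

lemma act2: "Act (simple2 a b) fx = dg 2 (\<lambda>r. q ^ (if r = 0 then a else b))"
    "Act (simple2 a b) fy = dg 2 (\<lambda>r. q ^ (if r = 0 then b else a))"
    "Act (simple2 a b) fz = mat 2 2 (\<lambda>(i, j). if i = 0 \<and> j = 1 then q ^ (a * b) else if i = 1 \<and> j = 0 then 1 else 0)"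
  by (simp_all only: simple2(2) gens2.simps)

lemma tensor_simple1_simple1: "iso (simple1 (i + j) (s = t)) (tensor (simple1 i s) (simple1 j t))"
proof (rule iso_genI[of _ _ 1 "1\<^sub>m 1" "1\<^sub>m 1"])
  let ?M = "simple1 i s" and ?N = "simple1 j t"
  note mods = simple1(1)[of i s] simple1(1)[of j t]
  have "Act (simple1 (i + j) (s = t)) (gen l) = Act (tensor ?M ?N) (gen l)" for l
  proof (cases l)
    case Lz
    \<comment> \<open>Since q is the square of p, the twist supplies the mixed term in the square of
      i + j.\<close>
    have "q ^ (i * j) * p ^ (i * i) * p ^ (j * j) = p ^ ((i + j) * (i + j))"
      by (simp add: p_power_sq[symmetric] distrib_left distrib_right power_add mult_ac)
    then have z: "Act (tensor ?M ?N) fz $$ (0, 0) = sgn1 (s = t) * p ^ ((i + j) * (i + j))"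
      using act_tensor_z[OF mods, of "\<lambda>_. i" "\<lambda>_. j" 0 0]
      by (auto simp: act1 sgn1_def mult_ac)
    interpret T: matrep 1 "Act (tensor ?M ?N)" using hmod_tensor[OF mods] by (simp add: hmod_iff_matrep)
    show ?thesis unfolding Lz act1 by (rule eq_matI) (use z T.dim in auto)
  qed (simp_all add: act_tensor_xy mods act1 kron_dg power_add)
  then show "1\<^sub>m 1 * Act (simple1 (i + j) (s = t)) (gen l) = Act (tensor ?M ?N) (gen l) * 1\<^sub>m 1" for l
    using gens_carrier(1)[of "i + j" "s = t" l] by (simp add: simple1(2))
qed (simp_all add: simple1 hmod_tensor)

text \<open>Rescaling one basis vector normalizes the lower left entry of z; only the product of the
  two entries is an invariant.\<close>

lemma antidiagonal_iso_simple2: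
  assumes T: "hmod T" "fst T = 2" and x: "Act T fx = dg 2 (\<lambda>r. q ^ (if r = 0 then a else b))"
    and y: "Act T fy = dg 2 (\<lambda>r. q ^ (if r = 0 then b else a))"
    and z: "Act T fz $$ (0, 0) = 0" "Act T fz $$ (1, 1) = 0" "Act T fz $$ (1, 0) = u" "Act T fz $$ (0, 1) = v"
    and uv: "u * v = q ^ (a * b)"
  shows "iso T (simple2 a b)"
proof -
  interpret T: matrep 2 "Act T" using T by (simp add: hmod_iff_matrep)
  interpret N: matrep 2 "Act (simple2 a b)" using simple2(1)[of a b] by (simp add: hmod_iff_matrep)
  have u: "u \<noteq> 0" using uv H.q_nz by auto
  let ?P = "dg 2 (\<lambda>k. if k = 0 then u else 1)"
  show ?thesis
  proof (rule iso_genI[of _ _ 2 ?P "dg 2 (\<lambda>k. if k = 0 then 1 / u else 1)"])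
    show "?P * Act T (gen l) = Act (simple2 a b) (gen l) * ?P" for l
    proof (cases l)
      case Lz
      have "(?P * Act T fz) $$ (k, l) = (Act (simple2 a b) fz * ?P) $$ (k, l)" if "k < 2" "l < 2" for k l
        unfolding dg_mult_index[OF T.carrier that] mult_dg_index[OF N.carrier that]
        using that z uv by (auto simp: less_2 act2)
      then show ?thesis unfolding Lz
        by (intro eq_matI) (use T.carrier[of fz] N.carrier[of fz] in \<open>auto simp del: index_mult_mat(1)\<close>)
    qed (auto simp: x y act2 dg_mult mult.commute intro!: eq_matI)
  qed (use u T in \<open>auto simp: simple2 dg_mult intro!: eq_matI\<close>)
qed

lemma tensor_simple1_simple2: "iso (tensor (simple1 i s) (simple2 a b)) (simple2 (i + a) (i + b))"
proof -
  note mods = simple1(1)[of i s] simple2(1)[of a b]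
  define c where "c = sgn1 s * p ^ (i * i)"
  have c: "c * c = q ^ (i * i)" using p_power_sq[of "i * i"] by (auto simp: c_def sgn1_def)
  note z = act_tensor_z[OF mods, of "\<lambda>_. i" "\<lambda>r. if r = 0 then b else a"]
  show ?thesis
  proof (rule antidiagonal_iso_simple2)
    show "(q ^ (i * a) * c) * (q ^ (i * b) * (c * q ^ (a * b))) = q ^ ((i + a) * (i + b))"
      using c by (simp add: distrib_left distrib_right power_add mult_ac)
  qed (auto simp: hmod_tensor mods act_tensor_xy act1 act2 kron_dg power_add c_def z intro!: eq_matI)
qed

lemma tensor_simple2_simple1: "iso (tensor (simple2 a b) (simple1 i s)) (simple2 (a + i) (b + i))"
proof -
  note mods = simple2(1)[of a b] simple1(1)[of i s]
  define c where "c = sgn1 s * p ^ (i * i)"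
  have c: "c * c = q ^ (i * i)" using p_power_sq[of "i * i"] by (auto simp: c_def sgn1_def)
  note z = act_tensor_z[OF mods, of "\<lambda>r. if r = 0 then a else b" "\<lambda>_. i"]
  show ?thesis
  proof (rule antidiagonal_iso_simple2)
    show "(q ^ (b * i) * c) * (q ^ (a * i) * (q ^ (a * b) * c)) = q ^ ((a + i) * (b + i))"
      using c by (simp add: distrib_left distrib_right power_add mult_ac)
  qed (auto simp: hmod_tensor mods act_tensor_xy act1 act2 kron_dg power_add c_def z intro!: eq_matI)
qed

lemma less_4: "i < (4::nat) \<longleftrightarrow> i = 0 \<or> i = 1 \<or> i = 2 \<or> i = 3" by auto

lemma sum_less_4: "(\<Sum>k<4. f k) = f 0 + f 1 + f 2 + f (3::nat)"
  by (simp add: eval_nat_numeral)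

text \<open>In the basis of the Kronecker product, z exchanges the indices 0 and 3 and the indices 1
  and 2 up to scalars; each pair carries one of the two summands.\<close>

lemma tensor_simple2_simple2:
  "iso (hmod_sum (simple2 (a + c) (b + d)) (simple2 (a + d) (b + c))) (tensor (simple2 a b) (simple2 c d))"
proof -
  let ?M = "simple2 a b" and ?N = "simple2 c d"
  let ?S = "simple2 (a + c) (b + d)" and ?S' = "simple2 (a + d) (b + c)"
  note mods = simple2(1)[of a b] simple2(1)[of c d]
  interpret T: matrep 4 "Act (tensor ?M ?N)" using hmod_tensor[OF mods] by (simp add: hmod_iff_matrep)
  interpret S: matrep 2 "Act ?S" using simple2(1)[of "a + c" "b + d"] by (simp add: hmod_iff_matrep)
  interpret S': matrep 2 "Act ?S'" using simple2(1)[of "a + d" "b + c"] by (simp add: hmod_iff_matrep)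
  \<comment> \<open>\<open>u\<close> and \<open>v\<close> are the entries of z at (3, 0) and (2, 1),
    so that the second column of each of \<open>B1\<close> and \<open>B2\<close> is the image under
    z of the first.\<close>
  define u where "u = q ^ (b * c)"
  define v where "v = q ^ (b * d) * q ^ (c * d)"
  have uv: "u \<noteq> 0" "v \<noteq> 0" using H.q_nz by (simp_all add: u_def v_def)
  have uq: "q ^ (a * d) * (q ^ (a * b) * q ^ (c * d)) * u = q ^ ((a + c) * (b + d))"
    and vq: "q ^ (a * c) * q ^ (a * b) * v = q ^ ((a + d) * (b + c))"
    by (simp_all add: u_def v_def distrib_left distrib_right power_add mult_ac)
  define B1 where "B1 = mat 4 2 (\<lambda>(k, j). if k = 0 \<and> j = 0 then 1 else if k = 3 \<and> j = 1 then u else 0)"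
  define C1 where "C1 = mat 2 4 (\<lambda>(j, k). if k = 0 \<and> j = 0 then 1 else if k = 3 \<and> j = 1 then 1 / u else 0)"
  define B2 where "B2 = mat 4 2 (\<lambda>(k, j). if k = 1 \<and> j = 0 then 1 else if k = 2 \<and> j = 1 then v else 0)"
  define C2 where "C2 = mat 2 4 (\<lambda>(j, k). if k = 1 \<and> j = 0 then 1 else if k = 2 \<and> j = 1 then 1 / v else 0)"
  note defs = B1_def B2_def C1_def C2_def
  have B: "B1 \<in> carrier_mat 4 2" "B2 \<in> carrier_mat 4 2" and C: "C1 \<in> carrier_mat 2 4" "C2 \<in> carrier_mat 2 4"
    by (auto simp: defs)
  have CB: "C1 * B1 = 1\<^sub>m 2" "C2 * B2 = 1\<^sub>m 2" "C1 * B2 = 0\<^sub>m 2 2" "C2 * B1 = 0\<^sub>m 2 2"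
  proof -
    have e: "(C1 * B1) $$ (i, j) = 1\<^sub>m 2 $$ (i, j)" "(C2 * B2) $$ (i, j) = 1\<^sub>m 2 $$ (i, j)"
      "(C1 * B2) $$ (i, j) = 0" "(C2 * B1) $$ (i, j) = 0" if "i < 2" "j < 2" for i j
      using that uv unfolding mult_mat_index[OF C(1) B(1) that] mult_mat_index[OF C(2) B(2) that]
        mult_mat_index[OF C(1) B(2) that] mult_mat_index[OF C(2) B(1) that] sum_less_4
      by (auto simp: less_2 defs)
    show "C1 * B1 = 1\<^sub>m 2" "C2 * B2 = 1\<^sub>m 2" "C1 * B2 = 0\<^sub>m 2 2" "C2 * B1 = 0\<^sub>m 2 2"
      by (rule eq_matI; use B C e in \<open>auto simp del: index_mult_mat(1)\<close>)+
  qed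
  have z: "Act (tensor ?M ?N) fz $$ (k, l) = q ^ ((if k div 2 = 0 then a else b) * (if k mod 2 = 0 then d else c)) *
      (Act ?M fz $$ (k div 2, l div 2) * Act ?N fz $$ (k mod 2, l mod 2))"
    if "k < 4" "l < 4" for k l
    using act_tensor_z[OF mods, of "\<lambda>r. if r = 0 then a else b" "\<lambda>r. if r = 0 then d else c" k l] that
    by (simp add: act2)
  have x: "Act (tensor ?M ?N) fx = dg 4 (\<lambda>k. q ^ (if k div 2 = 0 then a else b) * q ^ (if k mod 2 = 0 then c else d))"
    and y: "Act (tensor ?M ?N) fy = dg 4 (\<lambda>k. q ^ (if k div 2 = 0 then b else a) * q ^ (if k mod 2 = 0 then d else c))"
    by (simp_all add: act_tensor_xy mods act2 kron_dg)
  have inter: "Act (tensor ?M ?N) (gen l) * B1 = B1 * Act ?S (gen l) \<and> Act (tensor ?M ?N) (gen l) * B2 = B2 * Act ?S' (gen l)" for l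
  proof (cases l)
    case Lx
    show ?thesis unfolding Lx x act2
      by (intro conjI eq_matI; use B in \<open>auto simp: dg_mult_index[OF B(1)] dg_mult_index[OF B(2)] mult_dg_index[OF B(1)]
          mult_dg_index[OF B(2)] less_4 less_2 simp del: index_mult_mat(1)\<close>) (auto simp: defs power_add)
  next
    case Ly
    show ?thesis unfolding Ly y act2
      by (intro conjI eq_matI; use B in \<open>auto simp: dg_mult_index[OF B(1)] dg_mult_index[OF B(2)] mult_dg_index[OF B(1)]
          mult_dg_index[OF B(2)] less_4 less_2 simp del: index_mult_mat(1)\<close>) (auto simp: defs power_add)
  next
    case Lz
    have e: "(Act (tensor ?M ?N) fz * B1) $$ (k, j) = (B1 * Act ?S fz) $$ (k, j)"
      "(Act (tensor ?M ?N) fz * B2) $$ (k, j) = (B2 * Act ?S' fz) $$ (k, j)" if "k < 4" "j < 2" for k j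
      using that unfolding mult_mat_index[OF T.carrier B(1) that] mult_mat_index[OF T.carrier B(2) that]
        mult_mat_index[OF B(1) S.carrier that] mult_mat_index[OF B(2) S'.carrier that] sum_less_4 sum_less_2
      by (auto simp: less_4 less_2 z act2 defs uq vq) (auto simp: u_def v_def mult_ac)
    show ?thesis unfolding Lz
      by (intro conjI eq_matI) (use B T.carrier[of fz] S.carrier[of fz] S'.carrier[of fz] e in \<open>auto simp del: index_mult_mat(1)\<close>)
  qed
  show ?thesis
    by (rule iso_sum_genI[of _ _ _ B1 B2 C1 C2]) (use B C CB inter in \<open>auto simp: simple2 hmod_tensor mods\<close>)
qed

text \<open>With c a square root of \<open>q ^ (a * a)\<close>, the matrix of z has the eigenvalues
  c and -c. \<open>B s\<close> is an eigenvector and \<open>C s\<close> the dual one, whose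
  normalization divides by 2.\<close>

lemma simple2_split:
  assumes ab: "a mod n = b mod n"
  shows "iso (hmod_sum (simple1 a True) (simple1 a False)) (simple2 a b)"
proof -
  let ?M = "simple2 a b"
  interpret M: matrep 2 "Act ?M" using simple2(1)[of a b] by (simp add: hmod_iff_matrep)
  have q: "q ^ b = q ^ a" "q ^ (a * b) = q ^ (a * a)"
    using primitive_root_power_eq_iff[OF q_prim] n_gt_1 ab by (metis gr_implies_not_zero mod_mult_right_eq neq0_conv)+
  define c where "c = p ^ (a * a)"
  have c: "q ^ (a * a) = c * c" "c \<noteq> 0" using p_power_sq[of "a * a"] p_nz by (simp_all add: c_def)
  define B where "B s = mat 2 1 (\<lambda>(i, j). if i = 0 then 1 else sgn1 s / c)" for s
  define C where "C s = mat 1 2 (\<lambda>(i, j). if j = 0 then 1 / 2 else sgn1 s * c / 2)" for s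
  have B: "B s \<in> carrier_mat 2 1" and C: "C s \<in> carrier_mat 1 2" for s by (auto simp: B_def C_def)
  have half: "1 / 2 + 1 / 2 = (1 :: 'k)" using two_nz by (simp add: field_simps)
  have CB: "(C s * B t) $$ (0, 0) = (if s = t then 1 else 0)" for s t
    using c half by (subst mult_mat_index[OF C B]) (auto simp: sum_less_2 B_def C_def sgn1_def)
  have inter: "Act ?M (gen l) * B s = B s * Act (simple1 a s) (gen l)" for l s
  proof (rule eq_matI)
    fix i j assume "i < dim_row (B s * Act (simple1 a s) (gen l))" "j < dim_col (B s * Act (simple1 a s) (gen l))"
    then have ij: "i < 2" "j < 1" using B[of s] gens_carrier(1)[of a s l] by (auto simp: simple1(2))
    have S: "Act (simple1 a s) (gen l) \<in> carrier_mat 1 1" using gens_carrier(1) by (simp add: simple1(2))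
    show "(Act ?M (gen l) * B s) $$ (i, j) = (B s * Act (simple1 a s) (gen l)) $$ (i, j)"
      unfolding mult_mat_index[OF M.carrier B ij] mult_mat_index[OF B S ij] sum_less_2
      using ij by (cases l) (auto simp: less_2 act1 act2 B_def q c sgn1_def c_def[symmetric])
  qed (use B[of s] M.carrier[of "gen l"] gens_carrier(1)[of a s l] in \<open>auto simp: simple1(2)\<close>)
  have m: "A = D" if "A \<in> carrier_mat 1 1" "D \<in> carrier_mat 1 1" "A $$ (0, 0) = D $$ (0, 0)" for A D :: "'k mat"
    using that by (intro eq_matI) auto
  show ?thesis
    by (rule iso_sum_genI[of _ _ _ "B True" "B False" "C True" "C False"])
      (use B C inter mult_carrier_mat[OF C B] in \<open>auto simp: simple1 simple2 CB simp del: index_mult_mat(1) intro!: m\<close>)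
qed

end

subsection \<open>Multiplicities of idempotents\<close>

text \<open>
  The rank of an idempotent matrix. The trace would not do, since the characteristic may be positive.
\<close>

definition rank1 :: "'k::field mat \<Rightarrow> nat" where
  "rank1 A = order 1 (char_poly A)"

text \<open>Characteristic polynomials of block sums multiply, and orders of roots add.\<close>

lemma rank1_four_block:
  fixes A :: "'k::field mat"
  assumes A: "A \<in> carrier_mat d d" and B: "B \<in> carrier_mat e e"
  shows "rank1 (four_block_mat A (0\<^sub>m d e) (0\<^sub>m e d) B) = rank1 A + rank1 B"
proof -
  have "char_poly_matrix (four_block_mat A (0\<^sub>m d e) (0\<^sub>m e d) B) =
    four_block_mat (char_poly_matrix A) (0\<^sub>m d e) (0\<^sub>m e d) (char_poly_matrix B)"
    using A B by (intro eq_matI) (auto simp: char_poly_matrix_def)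
  then have "char_poly (four_block_mat A (0\<^sub>m d e) (0\<^sub>m e d) B) = char_poly A * char_poly B"
    using A B by (simp add: char_poly_def det_four_block_mat_lower_left_zero[of _ d _ e])
  moreover have "char_poly A \<noteq> 0" "char_poly B \<noteq> 0"
    using degree_monic_char_poly[OF A] degree_monic_char_poly[OF B] by auto
  ultimately show ?thesis by (simp add: rank1_def order_mult)
qed

lemma order_1_linear: "order 1 [:- b, 1:] = (if b = (1::'k::field) then 1 else 0)"
  using order_power_n_n[of "1 :: 'k" 1] by (auto intro: order_0I)

lemma rank1_dg: "rank1 (dg d f) = (\<Sum>i<d. if f i = 1 then 1 else 0)"
proof -
  have "char_poly (dg d f) = (\<Prod>a \<leftarrow> diag_mat (dg d f). [:- a, 1:])"
    by (rule char_poly_upper_triangular) auto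
  also have "diag_mat (dg d f) = map f [0..<d]" by (auto simp: diag_mat_def)
  finally have c: "char_poly (dg d f) = (\<Prod>a \<leftarrow> map f [0..<d]. [:- a, 1:])" .
  have "order 1 (\<Prod>a \<leftarrow> xs. [:- a, 1:]) = (\<Sum>a\<leftarrow>xs. if a = 1 then 1 else 0)" for xs :: "'a list"
  proof (induction xs)
    case (Cons a xs)
    have "(\<Prod>a \<leftarrow> a # xs. [:- a, 1:]) \<noteq> (0 :: 'a poly)" unfolding prod_list_zero_iff by auto
    then show ?case using Cons by (simp add: order_mult order_1_linear del: mult_pCons_left)
  qed simp
  then show ?thesis
    by (simp add: rank1_def c o_def sum_list_sum_nth atLeast0LessThan del: map_map)
qed

lemma rank1_dg_01: "rank1 (dg d (\<lambda>r. if P r then 1 else 0)) = (\<Sum>i<d. if P i then 1 else 0)"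
  unfolding rank1_dg by (intro sum.cong) auto

lemma rank1_empty: "A \<in> carrier_mat 0 0 \<Longrightarrow> rank1 A = 0"
  by (simp add: rank1_def char_poly_def)

lemma (in algebra_ideal) pe_dg:
  assumes "matrep d R" "R U = dg d (\<lambda>r. q ^ a r)"
  shows "R (pe U c) = dg d (\<lambda>r. if a r mod n = c mod n then 1 else 0)"
proof -
  interpret R: matrep d R by fact
  have "R (smul (inverse q ^ (c * i)) (U ^ i)) = dg d (\<lambda>r. q ^ (i * a r) * inverse q ^ (i * c))" for i
    by (simp add: R.smul R.power assms dg_power dg_smult mult.commute flip: power_mult)
  then have "R (pe U c) = dg d (\<lambda>r. 1 / of_nat n * (\<Sum>i<n. q ^ (i * a r) * inverse q ^ (i * c)))"
    by (simp add: pe_def R.smul R.sum_dg dg_smult)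
  then show ?thesis
    using n_nz by (auto simp: primitive_root_orthogonality[OF prim n_pos] intro!: eq_matI)
qed

context hopf_data
begin

abbreviation rk :: "'k hmod \<Rightarrow> 'k free_alg \<Rightarrow> nat" where "rk M f \<equiv> rank1 (Act M f)"

lemma rk_sum:
  assumes "hmod M" "hmod N" shows "rk (hmod_sum M N) f = rk M f + rk N f"
proof -
  interpret M: matrep "fst M" "Act M" using assms by (simp add: hmod_iff_matrep)
  interpret N: matrep "fst N" "Act N" using assms by (simp add: hmod_iff_matrep)
  show ?thesis by (simp add: act_sum rank1_four_block[OF M.carrier N.carrier])
qed

lemma rk_iso:
  assumes "hmod M" "hmod N" "iso M N" shows "rk M f = rk N f"
proof -
  interpret M: matrep "fst M" "Act M" using assms by (simp add: hmod_iff_matrep)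
  interpret N: matrep "fst N" "Act N" using assms by (simp add: hmod_iff_matrep)
  define d where "d = fst M"
  from assms(3) obtain P Q where d: "fst N = d" and PQ: "P \<in> carrier_mat d d" "Q \<in> carrier_mat d d"
    "P * Q = 1\<^sub>m d" "Q * P = 1\<^sub>m d" "P * Act M f = Act N f * P"
    by (auto simp: iso_iff d_def)
  have c: "Act M f \<in> carrier_mat d d" "Act N f \<in> carrier_mat d d"
    using M.carrier[of f] N.carrier[of f] by (simp_all only: d_def[symmetric] d)
  have "P * Act M f * Q = Act N f * (P * Q)" unfolding PQ(5) by (rule assoc_mult_mat[OF c(2) PQ(1,2)])
  also have "\<dots> = Act N f" unfolding PQ(3) by (rule right_mult_one_mat[OF c(2)])
  finally have "similar_mat_wit (Act N f) (Act M f) P Q"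
    using PQ c by (auto simp: similar_mat_wit_def Let_def)
  then have "similar_mat (Act N f) (Act M f)" by (auto simp: similar_mat_def)
  then show ?thesis by (simp add: rank1_def char_poly_similar)
qed

lemma rk_zero: "hmod M \<Longrightarrow> fst M = 0 \<Longrightarrow> rk M f = 0"
  by (rule rank1_empty) (metis hmod_iff_matrep matrep.carrier)

lemma act_eid:
  assumes "matrep d R" "R fx = dg d (\<lambda>r. q ^ a r)" "R fy = dg d (\<lambda>r. q ^ b r)"
  shows "R (eid c e) = dg d (\<lambda>r. if a r mod n = c mod n \<and> b r mod n = e mod n then 1 else 0)"
  unfolding eid_def matrep.mult[OF assms(1)] H.pe_dg[OF assms(1,2)] H.pe_dg[OF assms(1,3)]
  by (auto simp: dg_mult intro!: eq_matI)

lemma rk_simple1: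
  "rk (simple1 i s) (eid a b) = (if i mod n = a mod n \<and> i mod n = b mod n then 1 else 0)"
  "rk (simple1 i s) (epm t a) = (if i mod n = a mod n \<and> s = t then 1 else 0)"
proof -
  interpret S: matrep 1 "Act (simple1 i s)" using simple1(1)[of i s] by (simp add: hmod_iff_matrep)
  note e = act_eid[OF S.matrep_axioms act1(1,2)]
  show "rk (simple1 i s) (eid a b) = (if i mod n = a mod n \<and> i mod n = b mod n then 1 else 0)"
    by (simp add: e rank1_dg)
  \<comment> \<open>Signs can be compared across representatives of one residue because of
    \<open>p_power_mod\<close>.\<close>
  have eq: "p ^ (i * i) = p ^ (a * a)" if "i mod n = a mod n"
    using p_power_mod[of i] p_power_mod[of a] that by simp
  have half: "1 / 2 + 1 / 2 = (1 :: 'k)" using two_nz by (simp add: field_simps)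
  have "Act (simple1 i s) (epm t a) = dg 1 (\<lambda>_. if i mod n = a mod n \<and> s = t then 1 else 0)"
    unfolding epm_def S.smul S.add S.mult e act1 dg_mult dg_smult
    using eq two_nz half p_nz by (intro eq_matI) (auto simp: sgn1_def power_inverse)
  then show "rk (simple1 i s) (epm t a) = (if i mod n = a mod n \<and> s = t then 1 else 0)"
    by (simp add: rank1_dg)
qed

lemma rk_simple2:
  assumes "a mod n \<noteq> b mod n"
  shows "rk (simple2 a b) (eid c d) = (if a mod n = c mod n \<and> b mod n = d mod n then 1 else 0) +
      (if b mod n = c mod n \<and> a mod n = d mod n then 1 else 0)"
    "rk (simple2 a b) (epm t c) = 0"
proof -
  interpret S: matrep 2 "Act (simple2 a b)" using simple2(1)[of a b] by (simp add: hmod_iff_matrep)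
  note e = act_eid[OF S.matrep_axioms act2(1,2)]
  show "rk (simple2 a b) (eid c d) = (if a mod n = c mod n \<and> b mod n = d mod n then 1 else 0) +
      (if b mod n = c mod n \<and> a mod n = d mod n then 1 else 0)"
    unfolding e rank1_dg_01 sum_less_2 by simp
  have "Act (simple2 a b) (eid c c) = 0\<^sub>m 2 2"
    using assms unfolding e by (intro eq_matI) auto
  then have "Act (simple2 a b) (epm t c) = dg 2 (\<lambda>_. 0)"
    unfolding epm_def S.smul S.add S.mult using left_mult_zero_mat[OF S.carrier, of 2 fz]
    by (intro eq_matI) auto
  then show "rk (simple2 a b) (epm t c) = 0"
    by (simp add: rank1_dg)
qed

end

subsection \<open>Characters\<close>

datatype simple_index = I1 nat bool | I2 nat nat

datatype point = PC nat nat | PT nat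

locale hopf_char = hopf_data n q p
  for n :: nat and q p :: "'k::field" +
  fixes z :: complex
  assumes z_prim: "primitive_root_of_unity n z"
begin

lemma z_n: "z ^ n = 1" and z_nz: "z \<noteq> 0"
  using z_prim n_gt_1 by (auto simp: primitive_root_of_unity_def zero_power)

lemma z_mod: "z ^ (u * (a mod n)) = z ^ (u * a)"
  using primitive_root_power_eq_iff[OF z_prim] n_gt_1 by (simp add: mod_mult_right_eq)

text \<open>
  \<open>PC u v\<close> and \<open>PT w\<close> stand for characters of \<open>(\<int>/n)\<^sup>2\<close> and \<open>\<int>/n\<close>, evaluated on the dimensions of the
  weight spaces and on the signed dimensions of the weight spaces \<open>(a, a)\<close>.
\<close>

primrec psi :: "'k hmod \<Rightarrow> point \<Rightarrow> complex" where
  "psi M (PC u v) = (\<Sum>a<n. \<Sum>b<n. of_nat (rk M (eid a b)) * z ^ (u * a + v * b))"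
| "psi M (PT w) = (\<Sum>a<n. (of_nat (rk M (epm True a)) - of_nat (rk M (epm False a))) * z ^ (w * a))"

lemma psi_sum:
  assumes "hmod M" "hmod N" shows "psi (hmod_sum M N) t = psi M t + psi N t"
  by (cases t) (simp_all add: rk_sum assms algebra_simps flip: sum.distrib)

lemma psi_iso: "hmod M \<Longrightarrow> hmod N \<Longrightarrow> iso M N \<Longrightarrow> psi M t = psi N t"
  by (cases t) (simp_all add: rk_iso[of M N])

lemma psi_zero: "hmod M \<Longrightarrow> fst M = 0 \<Longrightarrow> psi M t = 0"
  by (cases t) (simp_all add: rk_zero)

primrec chi1 :: "nat \<Rightarrow> bool \<Rightarrow> point \<Rightarrow> complex" where
  "chi1 i s (PC u v) = z ^ ((u + v) * i)"
| "chi1 i s (PT w) = (if s then 1 else - 1) * z ^ (w * i)"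

primrec chi2 :: "nat \<Rightarrow> nat \<Rightarrow> point \<Rightarrow> complex" where
  "chi2 a b (PC u v) = z ^ (u * a + v * b) + z ^ (u * b + v * a)"
| "chi2 a b (PT w) = 0"

lemma sum_delta_mod: "(\<Sum>a<n. (if i mod n = a mod n then f a else 0)) = (f (i mod n) :: complex)"
proof -
  have "(\<Sum>a<n. (if i mod n = a mod n then f a else 0)) = (\<Sum>a<n. (if a = i mod n then f a else 0))"
    by (intro sum.cong) auto
  then show ?thesis using n_gt_1 by simp
qed

lemma sum_delta_mod2:
  "(\<Sum>a<n. \<Sum>b<n. of_nat (if i mod n = a mod n \<and> j mod n = b mod n then 1 else 0) * f a b) = (f (i mod n) (j mod n) :: complex)"
proof -
  have 1: "of_nat (if P \<and> Q then 1 else 0) * x = (if P then (if Q then x else 0) else 0)" for P Q and x :: complex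
    by simp
  have 2: "(\<Sum>b<n. if P then g b else 0) = (if P then \<Sum>b<n. g b else 0)" for P and g :: "nat \<Rightarrow> complex"
    by simp
  show ?thesis unfolding 1 2 sum_delta_mod ..
qed

lemma psi_simple1: "psi (simple1 i s) t = chi1 i s t"
proof (cases t)
  case (PC u v)
  show ?thesis
    unfolding PC psi.simps rk_simple1 sum_delta_mod2 by (simp add: power_add z_mod distrib_right)
next
  case (PT w)
  have "psi (simple1 i s) t = (\<Sum>a<n. if i mod n = a mod n then (if s then 1 else - 1) * z ^ (w * a) else 0)"
    unfolding PT psi.simps by (rule sum.cong[OF refl]) (auto simp: rk_simple1)
  then show ?thesis unfolding sum_delta_mod by (simp add: PT z_mod del: psi.simps)
qed

text \<open>\<open>rk_simple2\<close> covers distinct residues. For equal residues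
  \<open>simple2_split\<close> applies: the two signs cancel at \<open>PT\<close>, and the two equal
  weights add up at \<open>PC\<close>.\<close>

lemma psi_simple2: "psi (simple2 a b) t = chi2 a b t"
proof (cases "a mod n = b mod n")
  case True
  have "z ^ (u * a) = z ^ (u * b)" for u using z_mod[of u a] z_mod[of u b] True by simp
  then show ?thesis
    using psi_iso[OF hmod_sum[OF simple1(1) simple1(1)] simple2(1) simple2_split[OF True], of t]
    by (cases t) (simp_all only: psi_sum simple1 psi_simple1, simp_all add: distrib_right power_add)
next
  case False
  show ?thesis
  proof (cases t)
    case (PC u v)
    show ?thesis
      unfolding PC psi.simps rk_simple2[OF False] of_nat_add distrib_right sum.distrib sum_delta_mod2
      by (simp add: power_add z_mod)
  next
    case (PT w)
    then show ?thesis by (simp add: rk_simple2[OF False])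
  qed
qed

definition Simp :: "simple_index set" where
  "Simp = {I1 i s | i s. i < n} \<union> {I2 a b | a b. a < b \<and> b < n}"

primrec smod :: "simple_index \<Rightarrow> 'k hmod" where
  "smod (I1 i s) = simple1 i s"
| "smod (I2 a b) = simple2 a b"

lemma hmod_smod: "hmod (smod x)"
  by (cases x) (simp_all add: simple1 simple2)

text \<open>The tensor decompositions turn into product formulas for powers of z. Since
  \<open>psi_simple1\<close> and \<open>psi_simple2\<close> hold for arbitrary indices, sums such as
  i + j need no reduction modulo n.\<close>

lemma psi_tensor_simple: "psi (tensor (smod x) (smod y)) t = psi (smod x) t * psi (smod y) t"
proof -
  have 11: "psi (tensor (simple1 i s) (simple1 j s')) t = chi1 i s t * chi1 j s' t" for i j s s'
    using psi_iso[OF simple1(1) hmod_tensor[OF simple1(1) simple1(1)] tensor_simple1_simple1, of i j s s' t]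
    by (cases t) (auto simp: psi_simple1 distrib_left power_add simp del: psi.simps)
  have 12: "psi (tensor (simple1 i s) (simple2 a b)) t = chi1 i s t * chi2 a b t" for i a b s
    using psi_iso[OF hmod_tensor[OF simple1(1) simple2(1)] simple2(1) tensor_simple1_simple2, of i s a b t]
    by (cases t) (auto simp: psi_simple2 distrib_left distrib_right power_add mult_ac simp del: psi.simps)
  have 21: "psi (tensor (simple2 a b) (simple1 i s)) t = chi2 a b t * chi1 i s t" for i a b s
    using psi_iso[OF hmod_tensor[OF simple2(1) simple1(1)] simple2(1) tensor_simple2_simple1, of a b i s t]
    by (cases t) (auto simp: psi_simple2 distrib_left distrib_right power_add mult_ac simp del: psi.simps)
  have 22: "psi (tensor (simple2 a b) (simple2 c d)) t = chi2 a b t * chi2 c d t" for a b c d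
    using psi_iso[OF hmod_sum[OF simple2(1) simple2(1)] hmod_tensor[OF simple2(1) simple2(1)] tensor_simple2_simple2, of a c b d t]
    by (cases t) (auto simp: psi_simple2 psi_sum simple2 algebra_simps power_add simp del: psi.simps)
  show ?thesis
    by (cases x; cases y) (simp_all add: 11 12 21 22 psi_simple1 psi_simple2 del: psi.simps chi1.simps chi2.simps)
qed

text \<open>Complete reducibility in the form of an induction on the dimension.\<close>

lemma hmod_induct [consumes 1, case_names zero sum]:
  assumes M: "hmod M" and zero: "\<And>M. hmod M \<Longrightarrow> fst M = 0 \<Longrightarrow> P M"
    and sum: "\<And>x N M. x \<in> Simp \<Longrightarrow> hmod N \<Longrightarrow> P N \<Longrightarrow> hmod M \<Longrightarrow> iso (hmod_sum (smod x) N) M \<Longrightarrow> P M"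
  shows "P M"
  using M
proof (induction "fst M" arbitrary: M rule: less_induct)
  case less
  show ?case
  proof (cases "fst M = 0")
    case True
    then show ?thesis using zero less by blast
  next
    case False
    then obtain S N where S: "(\<exists>i s. i < n \<and> S = simple1 i s) \<or> (\<exists>a b. a < b \<and> b < n \<and> S = simple2 a b)"
      and N: "hmod N" "fst M = fst S + fst N" "iso (hmod_sum S N) M"
      using exists_simple_summand[OF less(2)] by (metis neq0_conv)
    then have "\<exists>x\<in>Simp. S = smod x" unfolding Simp_def by (fastforce intro: smod.simps[symmetric])
    then obtain x where x: "x \<in> Simp" "S = smod x" by blast
    have "fst N < fst M" using N(2) S by auto
    then show ?thesis using sum[OF x(1) N(1) less(1)[OF _ N(1)] less(2)] N(3) x(2) by simp
  qed
qed

text \<open>Both sides are additive in each factor and invariant under isomorphism, so complete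
  reducibility leaves the case of simple factors.\<close>

lemma psi_tensor:
  assumes "hmod M" "hmod N" shows "psi (tensor M N) t = psi M t * psi N t"
  using assms(1)
proof (induction M rule: hmod_induct)
  case (zero M)
  then show ?case using assms(2) by (simp add: psi_zero hmod_tensor)
next
  case (sum x M' M)
  have 1: "psi (tensor (smod x) N) t = psi (smod x) t * psi N t"
    using assms(2)
  proof (induction N rule: hmod_induct)
    case (zero N)
    then show ?case by (simp add: psi_zero hmod_tensor hmod_smod)
  next
    case (sum y N' N)
    have "psi (tensor (smod x) N) t = psi (tensor (smod x) (hmod_sum (smod y) N')) t"
      using sum hmod_smod by (intro psi_iso[symmetric] iso_tensor hmod_tensor hmod_sum iso_refl)
    also have "\<dots> = psi (hmod_sum (tensor (smod x) (smod y)) (tensor (smod x) N')) t"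
      using sum hmod_smod by (intro psi_iso[symmetric] tensor_sum_right hmod_tensor hmod_sum)
    also have "\<dots> = psi (smod x) t * psi (hmod_sum (smod y) N') t"
      using sum hmod_smod by (simp add: psi_sum hmod_tensor psi_tensor_simple distrib_left del: psi.simps)
    also have "psi (hmod_sum (smod y) N') t = psi N t"
      using sum hmod_smod by (intro psi_iso hmod_sum)
    finally show ?case .
  qed
  have "psi (tensor M N) t = psi (tensor (hmod_sum (smod x) M') N) t"
    using sum hmod_smod assms(2) by (intro psi_iso[symmetric] iso_tensor hmod_tensor hmod_sum iso_refl)
  also have "\<dots> = psi (hmod_sum (tensor (smod x) N) (tensor M' N)) t"
    using sum hmod_smod assms(2) by (intro psi_iso[symmetric] tensor_sum_left hmod_tensor hmod_sum)
  also have "\<dots> = psi (hmod_sum (smod x) M') t * psi N t"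
    using sum hmod_smod assms(2) 1 by (simp add: psi_sum hmod_tensor distrib_right del: psi.simps)
  also have "psi (hmod_sum (smod x) M') t = psi M t"
    using sum hmod_smod by (intro psi_iso hmod_sum)
  finally show ?case .
qed

text \<open>The trivial module is isomorphic to \<open>simple1 0 True\<close>, whose character is
  constantly 1.\<close>

lemma hmod_triv: "hmod hmod_triv" "psi hmod_triv t = 1"
proof -
  have a: "Act hmod_triv f = mat 1 1 (\<lambda>_. free_ext (\<lambda>c. c) (\<lambda>_. 1) f)" for f
    by (simp add: act_def hmod_triv_def counit_H_cls)
  have "matrep 1 (Act hmod_triv)"
    by unfold_locales
      (auto simp: a ground.free_ext_add ground.free_ext_mult ground.free_ext_scal scalar_prod_def intro!: eq_matI)
  then show m: "hmod hmod_triv" by (simp add: hmod_iff_matrep hmod_triv_def)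
  have "Act hmod_triv (gen l) = gens1 0 True l" for l
    by (cases l) (auto simp: a ground.free_ext_gen sgn1_def intro!: eq_matI)
  then have "iso hmod_triv (simple1 0 True)"
    by (intro iso_genI[of _ _ 1 "1\<^sub>m 1" "1\<^sub>m 1"])
      (use m left_mult_one_mat[OF gens_carrier(1)] right_mult_one_mat[OF gens_carrier(1)] in \<open>auto simp: simple1 hmod_triv_def[THEN arg_cong, of fst]\<close>)
  from psi_iso[OF m simple1(1) this, of t] show "psi hmod_triv t = 1"
    by (cases t) (simp_all add: psi_simple1 del: psi.simps)
qed

end

subsection \<open>Quotients as rings of functions\<close>

text \<open>The common target of both quotients. Closure of A under the operations is not built in;
  it comes from A being the image of a map that respects them.\<close>

definition fun_ring :: "('i \<Rightarrow> 'c::comm_ring_1) set \<Rightarrow> ('i \<Rightarrow> 'c) ring" where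
  "fun_ring A = \<lparr>carrier = A, monoid.mult = (\<lambda>f g t. f t * g t), one = (\<lambda>_. 1),
     ring.zero = (\<lambda>_. 0), add = (\<lambda>f g t. f t + g t)\<rparr>"

lemma UN_UN_const:
  assumes "a \<in> A" "b \<in> B" "\<And>x y. x \<in> A \<Longrightarrow> y \<in> B \<Longrightarrow> f x y = C"
  shows "(\<Union>x\<in>A. \<Union>y\<in>B. f x y) = C"
proof -
  have "(\<Union>x\<in>A. \<Union>y\<in>B. f x y) = (\<Union>x\<in>A. \<Union>y\<in>B. C)"
    using assms(3) by (intro SUP_cong refl)
  also have "\<dots> = C" using assms(1,2) by auto
  finally show ?thesis .
qed

text \<open>The first isomorphism theorem, with just an additive group and a closed product on the
  side of R. In this form it applies to \<open>free_green\<close> without a proof of associativity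
  or distributivity there.\<close>

lemma quotient_iso_fun_ring:
  fixes R :: "('a, 'b) ring_scheme" and h :: "'a \<Rightarrow> 'i \<Rightarrow> 'c::comm_ring_1"
  assumes R: "abelian_group R" and mult_closed: "\<And>a b. a \<in> carrier R \<Longrightarrow> b \<in> carrier R \<Longrightarrow> a \<otimes>\<^bsub>R\<^esub> b \<in> carrier R"
    and one: "\<one>\<^bsub>R\<^esub> \<in> carrier R" "\<And>t. h \<one>\<^bsub>R\<^esub> t = 1"
    and h_add: "\<And>a b t. a \<in> carrier R \<Longrightarrow> b \<in> carrier R \<Longrightarrow> h (a \<oplus>\<^bsub>R\<^esub> b) t = h a t + h b t"
    and h_mult: "\<And>a b t. a \<in> carrier R \<Longrightarrow> b \<in> carrier R \<Longrightarrow> h (a \<otimes>\<^bsub>R\<^esub> b) t = h a t * h b t"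
    and K: "K = {a \<in> carrier R. \<forall>t. h a t = 0}"
  shows "R Quot K \<simeq> fun_ring (h ` carrier R)"
proof -
  interpret abelian_group R by fact
  have h_zero: "h \<zero>\<^bsub>R\<^esub> t = 0" for t using h_add[of "\<zero>\<^bsub>R\<^esub>" "\<zero>\<^bsub>R\<^esub>" t] by simp
  have h_minus: "h (\<ominus>\<^bsub>R\<^esub> a) t = - h a t" if "a \<in> carrier R" for a t
    using h_add[of a "\<ominus>\<^bsub>R\<^esub> a" t] that by (simp add: r_neg h_zero add_eq_0_iff2)
  have coset: "K +>\<^bsub>R\<^esub> a = {b \<in> carrier R. h b = h a}" if a: "a \<in> carrier R" for a
  proof (intro equalityI subsetI)
    fix b assume "b \<in> K +>\<^bsub>R\<^esub> a"
    then obtain k where "k \<in> K" "b = k \<oplus>\<^bsub>R\<^esub> a" by (auto simp: a_r_coset_def')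
    then show "b \<in> {b \<in> carrier R. h b = h a}" using a by (auto simp: K h_add fun_eq_iff)
  next
    fix b assume b: "b \<in> {b \<in> carrier R. h b = h a}"
    then have "b \<oplus>\<^bsub>R\<^esub> \<ominus>\<^bsub>R\<^esub> a \<in> K" using a by (auto simp: K h_add h_minus)
    moreover have "b = (b \<oplus>\<^bsub>R\<^esub> \<ominus>\<^bsub>R\<^esub> a) \<oplus>\<^bsub>R\<^esub> a" using a b by (simp add: a_assoc l_neg)
    ultimately show "b \<in> K +>\<^bsub>R\<^esub> a" by (auto simp: a_r_coset_def')
  qed
  define H where "H A = the_elem (h ` A)" for A
  have H: "H (K +>\<^bsub>R\<^esub> a) = h a" if "a \<in> carrier R" for a
  proof -
    have "h ` (K +>\<^bsub>R\<^esub> a) = {h a}" using that by (auto simp: coset)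
    then show ?thesis by (simp add: H_def)
  qed
  have carr: "carrier (R Quot K) = (\<lambda>a. K +>\<^bsub>R\<^esub> a) ` carrier R"
    by (auto simp: FactRing_def A_RCOSETS_def')
  have mult: "(K +>\<^bsub>R\<^esub> a) \<otimes>\<^bsub>R Quot K\<^esub> (K +>\<^bsub>R\<^esub> b) = K +>\<^bsub>R\<^esub> (a \<otimes>\<^bsub>R\<^esub> b)" if ab: "a \<in> carrier R" "b \<in> carrier R" for a b
  proof -
    \<comment> \<open>The product of two cosets is a union of cosets of products; these all
      coincide, since \<open>h\<close> is constant on cosets.\<close>
    have e: "K +>\<^bsub>R\<^esub> (a' \<otimes>\<^bsub>R\<^esub> b') = K +>\<^bsub>R\<^esub> (a \<otimes>\<^bsub>R\<^esub> b)" if "a' \<in> K +>\<^bsub>R\<^esub> a" "b' \<in> K +>\<^bsub>R\<^esub> b" for a' b'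
      using that ab by (auto simp: coset mult_closed h_mult fun_eq_iff)
    have "a \<in> K +>\<^bsub>R\<^esub> a" "b \<in> K +>\<^bsub>R\<^esub> b" using ab by (auto simp: coset)
    from UN_UN_const[OF this e] show ?thesis by (simp add: FactRing_def rcoset_mult_def)
  qed
  have add: "H (A \<oplus>\<^bsub>R Quot K\<^esub> B) = (\<lambda>t. H A t + H B t)" if AB: "A \<in> carrier (R Quot K)" "B \<in> carrier (R Quot K)" for A B
  proof -
    obtain a b where a: "a \<in> carrier R" "A = K +>\<^bsub>R\<^esub> a" and b: "b \<in> carrier R" "B = K +>\<^bsub>R\<^esub> b"
      using AB by (auto simp: carr)
    have "A \<oplus>\<^bsub>R Quot K\<^esub> B = {x \<oplus>\<^bsub>R\<^esub> y | x y. x \<in> A \<and> y \<in> B}"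
      by (auto simp: FactRing_def set_add_def')
    then have "h ` (A \<oplus>\<^bsub>R Quot K\<^esub> B) = {\<lambda>t. h a t + h b t}"
      using a b by (auto simp: coset fun_eq_iff h_add image_iff) (metis h_add)
    then have "H (A \<oplus>\<^bsub>R Quot K\<^esub> B) = (\<lambda>t. h a t + h b t)" by (simp only: H_def the_elem_eq)
    moreover have "H A = h a" "H B = h b" using a b H by simp_all
    ultimately show ?thesis by simp
  qed
  have "H \<in> ring_iso (R Quot K) (fun_ring (h ` carrier R))"
  proof (rule ring_iso_memI)
    show "H (A \<otimes>\<^bsub>R Quot K\<^esub> B) = H A \<otimes>\<^bsub>fun_ring (h ` carrier R)\<^esub> H B"
      if "A \<in> carrier (R Quot K)" "B \<in> carrier (R Quot K)" for A B
      using that by (auto simp: carr mult H mult_closed fun_ring_def h_mult fun_eq_iff)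
    show "H (A \<oplus>\<^bsub>R Quot K\<^esub> B) = H A \<oplus>\<^bsub>fun_ring (h ` carrier R)\<^esub> H B"
      if "A \<in> carrier (R Quot K)" "B \<in> carrier (R Quot K)" for A B
      using add[OF that] by (simp add: fun_ring_def)
    show "H \<one>\<^bsub>R Quot K\<^esub> = \<one>\<^bsub>fun_ring (h ` carrier R)\<^esub>"
      using one by (simp add: FactRing_def H fun_ring_def fun_eq_iff)
    show "bij_betw H (carrier (R Quot K)) (carrier (fun_ring (h ` carrier R)))"
    proof (rule bij_betw_imageI)
      show "inj_on H (carrier (R Quot K))"
      proof (rule inj_onI)
        fix A B assume AB: "A \<in> carrier (R Quot K)" "B \<in> carrier (R Quot K)" "H A = H B"
        then obtain a b where "a \<in> carrier R" "A = K +>\<^bsub>R\<^esub> a" "b \<in> carrier R" "B = K +>\<^bsub>R\<^esub> b"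
          by (auto simp: carr)
        then show "A = B" using AB(3) H coset by metis
      qed
      have "H ` carrier (R Quot K) = (\<lambda>a. H (K +>\<^bsub>R\<^esub> a)) ` carrier R" unfolding carr image_image ..
      also have "\<dots> = h ` carrier R" using H by (rule image_cong[OF refl])
      finally show "H ` carrier (R Quot K) = carrier (fun_ring (h ` carrier R))" by (simp add: fun_ring_def)
    qed
  qed (auto simp: carr H fun_ring_def)
  then show ?thesis by (auto simp: is_ring_iso_def)
qed

subsection \<open>Linear independence of the simple characters\<close>

context hopf_char
begin

primrec chi :: "simple_index \<Rightarrow> point \<Rightarrow> complex" where
  "chi (I1 i s) = chi1 i s"
| "chi (I2 a b) = chi2 a b"

lemma psi_smod: "psi (smod x) t = chi x t"
  by (cases x) (simp_all add: psi_simple1 psi_simple2 del: psi.simps chi1.simps chi2.simps)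

lemma sum_Simp:
  "(\<Sum>x\<in>Simp. g x) = (\<Sum>i<n. g (I1 i True) + g (I1 i False)) + (\<Sum>(a, b)\<in>{(a, b). a < b \<and> b < n}. g (I2 a b) :: 'c::comm_monoid_add)"
  and finite_Simp: "finite Simp"
proof -
  have S: "Simp = (\<lambda>i. I1 i True) ` {..<n} \<union> (\<lambda>i. I1 i False) ` {..<n} \<union> (\<lambda>(a, b). I2 a b) ` {(a, b). a < b \<and> b < n}"
    unfolding Simp_def by (auto simp: image_iff)
  have "{(a, b). a < b \<and> b < n} \<subseteq> {..<n} \<times> {..<n}" by auto
  then have f: "finite {(a, b). a < b \<and> b < n}" by (rule finite_subset) auto
  then show "finite Simp" unfolding S by auto
  show "(\<Sum>x\<in>Simp. g x) = (\<Sum>i<n. g (I1 i True) + g (I1 i False)) + (\<Sum>(a, b)\<in>{(a, b). a < b \<and> b < n}. g (I2 a b))"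
    unfolding S using f
    by (subst sum.union_disjoint, (auto)[3], subst sum.union_disjoint, (auto)[3], subst (1 2 3) sum.reindex)
      (auto simp: inj_on_def sum.distrib split_def)
qed

text \<open>Inversion of the discrete Fourier transform on the residues modulo n.\<close>

lemma fourier:
  assumes "\<And>w. (\<Sum>i<n. d i * z ^ (w * i)) = 0" and j: "j < n"
  shows "d j = 0"
proof -
  have "0 = (\<Sum>w<n. inverse z ^ (w * j) * (\<Sum>i<n. d i * z ^ (w * i)))" by (simp add: assms)
  also have "\<dots> = (\<Sum>w<n. \<Sum>i<n. d i * (z ^ (w * i) * inverse z ^ (w * j)))"
    by (simp add: sum_distrib_left mult_ac)
  also have "\<dots> = (\<Sum>i<n. d i * (\<Sum>w<n. z ^ (w * i) * inverse z ^ (w * j)))"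
    by (subst sum.swap) (simp add: sum_distrib_left)
  also have "\<dots> = (\<Sum>i<n. if i = j then d i * of_nat n else 0)"
    using primitive_root_orthogonality[OF z_prim] n_gt_1 j by (intro sum.cong) auto
  finally show ?thesis using j n_gt_1 by simp
qed

text \<open>At the points \<open>PT\<close> only the one-dimensional modules are seen, with signs,
  so the coefficients of \<open>I1 i True\<close> and \<open>I1 i False\<close> agree. At the points
  \<open>PC\<close> only their sum is seen, together with the coefficients of the
  \<open>I2 a b\<close>; these form an array that is recovered by a Fourier inversion in each
  variable.\<close>

lemma chi_independent:
  assumes "\<And>t. (\<Sum>x\<in>Simp. c x * chi x t) = 0" and x: "x \<in> Simp"
  shows "c x = 0"
proof -
  let ?L = "{(a, b). a < b \<and> b < n}"
  \<comment> \<open>The array is symmetric because \<open>I2 a b\<close> contributes the weights (a,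
    b) and (b, a) equally.\<close>
  let ?D = "\<lambda>a b. if a = b then c (I1 a True) + c (I1 a False) else if a < b then c (I2 a b) else c (I2 b a)"
  have eq: "c (I1 i True) - c (I1 i False) = 0" if "i < n" for i
  proof (rule fourier[OF _ that])
    fix w show "(\<Sum>i<n. (c (I1 i True) - c (I1 i False)) * z ^ (w * i)) = 0"
      using assms(1)[of "PT w"] unfolding sum_Simp by (simp add: split_def left_diff_distrib)
  qed
  have L: "finite ?L" by (rule finite_subset[of _ "{..<n} \<times> {..<n}"]) auto
  have zero: "(\<Sum>a<n. \<Sum>b<n. ?D a b * z ^ (u * a + v * b)) = 0" for u v
  proof -
    let ?f = "\<lambda>(a, b). ?D a b * z ^ (u * a + v * b)"
    have sq: "{..<n} \<times> {..<n} = (\<lambda>i. (i, i)) ` {..<n} \<union> ?L \<union> prod.swap ` ?L"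
      by (auto simp: image_iff)
    have "(\<Sum>a<n. \<Sum>b<n. ?D a b * z ^ (u * a + v * b)) = sum ?f ({..<n} \<times> {..<n})"
      by (simp add: sum.cartesian_product)
    also have "\<dots> = sum ?f ((\<lambda>i. (i, i)) ` {..<n}) + sum ?f ?L + sum ?f (prod.swap ` ?L)"
      unfolding sq using L by (subst sum.union_disjoint, (auto)[3], subst sum.union_disjoint, auto)
    also have "sum ?f ((\<lambda>i. (i, i)) ` {..<n}) = (\<Sum>i<n. (c (I1 i True) + c (I1 i False)) * z ^ (u * i + v * i))"
      by (subst sum.reindex) (auto simp: inj_on_def)
    also have "sum ?f ?L = (\<Sum>(a, b)\<in>?L. c (I2 a b) * z ^ (u * a + v * b))"
      by (intro sum.cong) auto
    also have "sum ?f (prod.swap ` ?L) = (\<Sum>(a, b)\<in>?L. c (I2 a b) * z ^ (u * b + v * a))"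
      by (subst sum.reindex) (auto simp: inj_on_def intro!: sum.cong)
    also have "(\<Sum>i<n. (c (I1 i True) + c (I1 i False)) * z ^ (u * i + v * i)) + (\<Sum>(a, b)\<in>?L. c (I2 a b) * z ^ (u * a + v * b))
        + (\<Sum>(a, b)\<in>?L. c (I2 a b) * z ^ (u * b + v * a)) = (\<Sum>x\<in>Simp. c x * chi x (PC u v))"
      unfolding sum_Simp by (simp add: split_def distrib_left distrib_right sum.distrib)
    finally show ?thesis using assms(1) by simp
  qed
  have D: "?D a b = 0" if "a < n" "b < n" for a b
  proof (rule fourier[of "?D a", OF _ \<open>b < n\<close>])
    fix v show "(\<Sum>b<n. ?D a b * z ^ (v * b)) = 0"
    proof (rule fourier[of "\<lambda>a. \<Sum>b<n. ?D a b * z ^ (v * b)", OF _ \<open>a < n\<close>])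
      fix u
      have "(\<Sum>a<n. (\<Sum>b<n. ?D a b * z ^ (v * b)) * z ^ (u * a)) = (\<Sum>a<n. \<Sum>b<n. ?D a b * z ^ (u * a + v * b))"
        by (simp only: sum_distrib_left sum_distrib_right power_add mult_ac)
      then show "(\<Sum>a<n. (\<Sum>b<n. ?D a b * z ^ (v * b)) * z ^ (u * a)) = 0" using zero by simp
    qed
  qed
  show ?thesis
  proof (cases x)
    case (I1 i s)
    then have i: "i < n" using x by (auto simp: Simp_def)
    have "c (I1 i True) + c (I1 i False) = 0" using D[OF i i] by simp
    with eq[OF i] have "2 * c (I1 i True) = 0" "2 * c (I1 i False) = 0" by (simp_all add: algebra_simps)
    then show ?thesis using I1 by (cases s) auto
  next
    case (I2 a b)
    then have ab: "a < b" "b < n" using x by (auto simp: Simp_def)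
    then show ?thesis using D[of a b] I2 by simp
  qed
qed

subsection \<open>The Green ring\<close>

abbreviation cls :: "'k hmod \<Rightarrow> 'k hmod set" where "cls \<equiv> hmod_class n q"
abbreviation G where "G \<equiv> free_green n q"

lemma cls_self: "hmod M \<Longrightarrow> M \<in> cls M"
  by (simp add: hmod_class_def iso_refl)

lemma cls_eqI:
  assumes "hmod M" "hmod N" "iso M N" shows "cls M = cls N"
  using assms iso_trans iso_sym unfolding hmod_class_def by blast

definition psi_cls :: "'k hmod set \<Rightarrow> point \<Rightarrow> complex" where
  "psi_cls A = psi (SOME M. M \<in> A)"

lemma psi_cls:
  assumes "hmod M" shows "psi_cls (cls M) t = psi M t"
proof -
  have "(SOME M'. M' \<in> cls M) \<in> cls M" using cls_self[OF assms] by (rule someI)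
  then have "hmod (SOME M'. M' \<in> cls M)" "iso M (SOME M'. M' \<in> cls M)"
    by (simp_all add: hmod_class_def)
  then show ?thesis
    unfolding psi_cls_def using psi_iso[OF assms] by metis
qed

lemma class_tensor:
  assumes "hmod M" "hmod N" shows "class_tensor n q (cls M) (cls N) = cls (tensor M N)"
proof -
  have e: "cls (tensor M' N') = cls (tensor M N)" if "M' \<in> cls M" "N' \<in> cls N" for M' N'
    using that assms by (intro cls_eqI[symmetric] hmod_tensor iso_tensor) (auto simp: hmod_class_def)
  show ?thesis
    unfolding class_tensor_def by (rule UN_UN_const[OF cls_self[OF assms(1)] cls_self[OF assms(2)] e])
qed

definition Psi :: "('k hmod set \<Rightarrow>\<^sub>0 int) \<Rightarrow> point \<Rightarrow> complex" where
  "Psi a t = (\<Sum>A\<in>Poly_Mapping.keys a. of_int (Poly_Mapping.lookup a A) * psi_cls A t)"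

lemma Psi_add: "Psi (a + b) t = Psi a t + Psi b t"
  unfolding Psi_def by (rule sum_keys_add[where F = "\<lambda>A c. of_int c * psi_cls A t"]) (simp_all add: distrib_right)

lemma Psi_0: "Psi 0 t = 0" by (simp add: Psi_def)

lemma Psi_uminus: "Psi (- a) t = - Psi a t"
  using Psi_add[of a "- a" t] by (simp add: Psi_0 add_eq_0_iff2)

lemma Psi_diff: "Psi (a - b) t = Psi a t - Psi b t"
  using Psi_add[of a "- b" t] by (simp add: Psi_uminus)

lemma Psi_single: "Psi (Poly_Mapping.single A c) t = of_int c * psi_cls A t"
  unfolding Psi_def by (cases "c = 0") auto

lemma Psi_sum: "Psi (sum f S) t = (\<Sum>x\<in>S. Psi (f x) t)"
  by (induction S rule: infinite_finite_induct) (simp_all add: Psi_0 Psi_add)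

lemma G_simps:
  "carrier G = {a. Poly_Mapping.keys a \<subseteq> iso_classes n q}" "a \<oplus>\<^bsub>G\<^esub> b = a + b" "\<zero>\<^bsub>G\<^esub> = 0"
  "\<one>\<^bsub>G\<^esub> = Poly_Mapping.single (cls hmod_triv) 1"
  "a \<otimes>\<^bsub>G\<^esub> b = (\<Sum>A\<in>Poly_Mapping.keys a. \<Sum>B\<in>Poly_Mapping.keys b.
       Poly_Mapping.single (class_tensor n q A B) (Poly_Mapping.lookup a A * Poly_Mapping.lookup b B))"
  by (simp_all add: free_green_def)

lemma cls_mem: "hmod M \<Longrightarrow> cls M \<in> iso_classes n q"
  unfolding iso_classes_def by blast

lemma single_carrier: "hmod M \<Longrightarrow> Poly_Mapping.single (cls M) c \<in> carrier G"
  using cls_mem by (simp add: G_simps)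

lemma carrier_add: "a \<in> carrier G \<Longrightarrow> b \<in> carrier G \<Longrightarrow> a + b \<in> carrier G"
  using keys_add[of a b] by (auto simp: G_simps)

lemma carrier_uminus: "a \<in> carrier G \<Longrightarrow> - a \<in> carrier G"
  by (simp add: G_simps)

lemma carrier_sum: "(\<And>x. x \<in> S \<Longrightarrow> f x \<in> carrier G) \<Longrightarrow> sum f S \<in> carrier G"
proof (induction S rule: infinite_finite_induct)
  case (insert x F)
  then show ?case using carrier_add by simp
qed (simp_all add: G_simps)

lemma abelian_group_G: "abelian_group G"
proof (rule abelian_groupI)
  show "\<exists>y\<in>carrier G. y \<oplus>\<^bsub>G\<^esub> x = \<zero>\<^bsub>G\<^esub>" if "x \<in> carrier G" for x
    using carrier_uminus[OF that] by (intro bexI[of _ "- x"]) (simp_all add: G_simps(2,3))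
qed (use carrier_add in \<open>auto simp: G_simps(2,3) algebra_simps\<close>, simp add: G_simps)

lemma class_tensor_mem:
  assumes "A \<in> iso_classes n q" "B \<in> iso_classes n q"
  shows "class_tensor n q A B \<in> iso_classes n q" "psi_cls (class_tensor n q A B) t = psi_cls A t * psi_cls B t"
proof -
  obtain M N where M: "A = cls M" "hmod M" and N: "B = cls N" "hmod N"
    using assms unfolding iso_classes_def by blast
  show "class_tensor n q A B \<in> iso_classes n q"
    unfolding M N class_tensor[OF M(2) N(2)] using hmod_tensor[OF M(2) N(2)] by (rule cls_mem)
  show "psi_cls (class_tensor n q A B) t = psi_cls A t * psi_cls B t"
    unfolding M N class_tensor[OF M(2) N(2)]
    by (simp add: psi_cls M N hmod_tensor psi_tensor)
qed

lemma G_mult: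
  assumes "a \<in> carrier G" "b \<in> carrier G"
  shows "a \<otimes>\<^bsub>G\<^esub> b \<in> carrier G" "Psi (a \<otimes>\<^bsub>G\<^esub> b) t = Psi a t * Psi b t"
proof -
  have ab: "A \<in> Poly_Mapping.keys a \<Longrightarrow> A \<in> iso_classes n q" "B \<in> Poly_Mapping.keys b \<Longrightarrow> B \<in> iso_classes n q" for A B
    using assms by (auto simp: G_simps)
  show "a \<otimes>\<^bsub>G\<^esub> b \<in> carrier G"
    unfolding G_simps(5)
    by (intro carrier_sum) (use class_tensor_mem(1)[OF ab] in \<open>auto simp: G_simps(1)\<close>)
  show "Psi (a \<otimes>\<^bsub>G\<^esub> b) t = Psi a t * Psi b t"
    unfolding G_simps(5) Psi_sum Psi_single
    by (simp add: Psi_def sum_product class_tensor_mem(2)[OF ab] mult_ac)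
qed

abbreviation K where "K \<equiv> generate (add_monoid G) (green_rels n q)"

definition comb :: "(simple_index \<Rightarrow> int) \<Rightarrow> 'k hmod set \<Rightarrow>\<^sub>0 int" where
  "comb c = (\<Sum>x\<in>Simp. Poly_Mapping.single (cls (smod x)) (c x))"

lemma comb: "comb c \<in> carrier G" "Psi (comb c) t = (\<Sum>x\<in>Simp. of_int (c x) * chi x t)"
  by (auto simp: comb_def Psi_sum Psi_single psi_cls hmod_smod psi_smod intro!: carrier_sum single_carrier)

lemma green_rels_carrier: "green_rels n q \<subseteq> carrier G"
proof
  fix r assume "r \<in> green_rels n q"
  then obtain M N where "hmod M" "hmod N" and r: "r = Poly_Mapping.single (cls (hmod_sum M N)) 1
      - (Poly_Mapping.single (cls M) 1 + Poly_Mapping.single (cls N) 1)"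
    unfolding green_rels_def by blast
  then show "r \<in> carrier G"
    unfolding r diff_conv_add_uminus by (intro carrier_add carrier_uminus single_carrier hmod_sum)
qed

lemma subgroup_K: "subgroup K (add_monoid G)"
  by (rule group.generate_is_subgroup[OF abelian_group.a_group[OF abelian_group_G]]) (use green_rels_carrier in simp)

lemma K_add: "a \<in> K \<Longrightarrow> b \<in> K \<Longrightarrow> a + b \<in> K"
  using subgroup.m_closed[OF subgroup_K, of a b] by (simp add: G_simps)

lemma K_carrier: "a \<in> K \<Longrightarrow> a \<in> carrier G"
  using subgroup.subset[OF subgroup_K] by auto

lemma K_uminus:
  assumes "a \<in> K" shows "- a \<in> K"
proof -
  have "a \<in> carrier G" using K_carrier[OF assms] .
  then have "\<ominus>\<^bsub>G\<^esub> a = - a"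
    using abelian_group.minus_equality[OF abelian_group_G, of "- a" a] carrier_uminus by (simp add: G_simps(2,3))
  then show ?thesis
    using subgroup.m_inv_closed[OF subgroup_K assms] by (simp add: a_inv_def)
qed

lemma K_diff: "a \<in> K \<Longrightarrow> b \<in> K \<Longrightarrow> a - b \<in> K"
  using K_add[of a "- b"] K_uminus by simp

lemma K_rel: "hmod M \<Longrightarrow> hmod N \<Longrightarrow> Poly_Mapping.single (cls (hmod_sum M N)) 1
    - (Poly_Mapping.single (cls M) 1 + Poly_Mapping.single (cls N) 1) \<in> K"
  by (rule generate.incl, unfold green_rels_def) blast

lemma comb_uminus: "comb (\<lambda>x. - c x) = - comb c"
  by (simp add: comb_def single_uminus sum_negf)

lemma comb_add: "comb (\<lambda>x. c x + c' x) = comb c + comb c'"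
  by (simp add: comb_def single_add sum.distrib)

lemma comb_unit:
  assumes "x \<in> Simp" shows "comb (\<lambda>y. if y = x then 1 else 0) = Poly_Mapping.single (cls (smod x)) 1"
proof -
  have "comb (\<lambda>y. if y = x then 1 else 0) = (\<Sum>y\<in>Simp. if y = x then Poly_Mapping.single (cls (smod x)) 1 else 0)"
    unfolding comb_def by (intro sum.cong) auto
  then show ?thesis using assms finite_Simp by simp
qed

lemma module_comb:
  assumes "hmod M" shows "\<exists>c. Poly_Mapping.single (cls M) 1 - comb c \<in> K"
  using assms
proof (induction M rule: hmod_induct)
  case (zero M)
  \<comment> \<open>The class of the zero module is a generator of the free group like any other. It
    lies in \<open>K\<close> because the sum of two zero modules is again isomorphic to M, which
    makes the relation collapse to \<open>- [M]\<close>.\<close>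
  have "matrep 0 (Act M)" "matrep 0 (Act (hmod_sum M M))"
    using zero hmod_sum[OF zero(1,1)] by (simp_all add: hmod_iff_matrep)
  then have "iso (hmod_sum M M) M"
    by (intro isoI[of _ _ "1\<^sub>m 0" "1\<^sub>m 0"]) (auto simp: zero matrep.dim intro!: eq_matI)
  then have "cls (hmod_sum M M) = cls M" by (intro cls_eqI hmod_sum zero)
  then have "- Poly_Mapping.single (cls M) 1 \<in> K" using K_rel[OF zero(1,1)] by simp
  then have "Poly_Mapping.single (cls M) 1 - comb (\<lambda>_. 0) \<in> K"
    using K_uminus by (fastforce simp: comb_def)
  then show ?case by blast
next
  case (sum x N M)
  from sum.IH obtain c where c: "Poly_Mapping.single (cls N) 1 - comb c \<in> K" by blast
  have M: "cls (hmod_sum (smod x) N) = cls M" by (intro cls_eqI hmod_sum hmod_smod sum)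
  have "Poly_Mapping.single (cls M) 1 - comb (\<lambda>y. (if y = x then 1 else 0) + c y) \<in> K"
    using K_add[OF K_rel[OF hmod_smod[of x] sum.hyps(2)] c] unfolding M comb_add comb_unit[OF sum.hyps(1)]
    by (simp add: algebra_simps)
  then show ?case by blast
qed

lemma carrier_comb:
  assumes "a \<in> carrier G" shows "\<exists>c. a - comb c \<in> K"
proof -
  have "Poly_Mapping.keys a \<subseteq> iso_classes n q" using assms by (simp add: G_simps)
  then show ?thesis
  proof (induction a rule: frag_induction)
    case zero
    have "0 - comb (\<lambda>_. 0) \<in> K" using subgroup.one_closed[OF subgroup_K] by (simp add: comb_def G_simps)
    then show ?case by blast
  next
    case (one A)
    then obtain M where "A = cls M" "hmod M" unfolding iso_classes_def by blast
    then show ?case using module_comb by simp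
  next
    case (diff a b)
    then obtain c c' where "a - comb c \<in> K" "b - comb c' \<in> K" by blast
    then have "a - b - comb (\<lambda>x. c x + - c' x) \<in> K"
      using K_diff[of "a - comb c" "b - comb c'"] unfolding comb_add comb_uminus by (simp add: algebra_simps)
    then show ?case by blast
  qed
qed

lemma Psi_K:
  assumes "a \<in> K" shows "Psi a t = 0"
proof -
  have "subgroup {a \<in> carrier G. \<forall>t. Psi a t = 0} (add_monoid G)"
  proof (rule group.subgroupI[OF abelian_group.a_group[OF abelian_group_G]])
    show "{a \<in> carrier G. \<forall>t. Psi a t = 0} \<noteq> {}" using Psi_0 by (auto simp: G_simps intro: exI[of _ 0])
    show "inv\<^bsub>add_monoid G\<^esub> a \<in> {a \<in> carrier G. \<forall>t. Psi a t = 0}" if "a \<in> {a \<in> carrier G. \<forall>t. Psi a t = 0}" for a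
    proof -
      have "\<ominus>\<^bsub>G\<^esub> a = - a"
        using that abelian_group.minus_equality[OF abelian_group_G, of "- a" a] carrier_uminus by (simp add: G_simps(2,3))
      then show ?thesis using that carrier_uminus by (simp add: a_inv_def Psi_uminus)
    qed
  qed (use carrier_add in \<open>auto simp: G_simps(2) Psi_add\<close>)
  moreover have "green_rels n q \<subseteq> {a \<in> carrier G. \<forall>t. Psi a t = 0}"
  proof
    fix r assume r: "r \<in> green_rels n q"
    then obtain M N where "hmod M" "hmod N" "r = Poly_Mapping.single (cls (hmod_sum M N)) 1
        - (Poly_Mapping.single (cls M) 1 + Poly_Mapping.single (cls N) 1)"
      unfolding green_rels_def by blast
    then have "Psi r t = 0" for t
      by (simp add: Psi_diff Psi_add Psi_single[of _ 1, simplified] psi_cls hmod_sum psi_sum)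
    then show "r \<in> {a \<in> carrier G. \<forall>t. Psi a t = 0}" using r green_rels_carrier by blast
  qed
  ultimately have "K \<subseteq> {a \<in> carrier G. \<forall>t. Psi a t = 0}"
    using group.generate_subgroup_incl[OF abelian_group.a_group[OF abelian_group_G]] by blast
  then show ?thesis using assms by blast
qed

text \<open>Modulo \<open>K\<close> every element is an integer combination of simple classes, and
  by independence such a combination lies in the kernel only if it is zero. The description as a
  kernel also makes \<open>K\<close> compatible with products.\<close>

lemma K_eq_kernel: "K = {a \<in> carrier G. \<forall>t. Psi a t = 0}"
proof (intro equalityI subsetI)
  fix a assume a: "a \<in> {a \<in> carrier G. \<forall>t. Psi a t = 0}"
  then obtain c where c: "a - comb c \<in> K" using carrier_comb by blast
  have "(\<Sum>x\<in>Simp. of_int (c x) * chi x t) = 0" for t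
    using Psi_K[OF c, of t] a by (simp add: Psi_diff comb)
  then have "(of_int (c x) :: complex) = 0" if "x \<in> Simp" for x
    using chi_independent[of "\<lambda>x. of_int (c x)"] that by simp
  then have "comb c = 0" by (simp add: comb_def)
  then show "a \<in> K" using c by simp
qed (use Psi_K K_carrier in auto)

definition char_span :: "(point \<Rightarrow> complex) set" where
  "char_span = range (\<lambda>c t. \<Sum>x\<in>Simp. of_int (c x :: int) * chi x t)"

theorem green_ring_iso: "green_ring n q \<simeq> fun_ring char_span"
proof -
  have "Psi ` carrier G = char_span"
  proof (intro equalityI subsetI)
    fix f assume "f \<in> Psi ` carrier G"
    then obtain a where a: "a \<in> carrier G" "f = Psi a" by blast
    then obtain c where c: "a - comb c \<in> K" using carrier_comb by blast
    have "f = (\<lambda>t. \<Sum>x\<in>Simp. of_int (c x) * chi x t)"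
      using Psi_K[OF c] a by (auto simp: Psi_diff comb fun_eq_iff)
    then show "f \<in> char_span" by (auto simp: char_span_def)
  next
    fix f assume "f \<in> char_span"
    then obtain c where "f = (\<lambda>t. \<Sum>x\<in>Simp. of_int (c x) * chi x t)" by (auto simp: char_span_def)
    then have "f = Psi (comb c)" by (auto simp: comb fun_eq_iff)
    then show "f \<in> Psi ` carrier G" using comb(1) by blast
  qed
  moreover have "G Quot K \<simeq> fun_ring (Psi ` carrier G)"
  proof (rule quotient_iso_fun_ring[OF abelian_group_G])
    show "\<one>\<^bsub>G\<^esub> \<in> carrier G" unfolding G_simps(4) by (rule single_carrier[OF hmod_triv(1)])
    show "Psi \<one>\<^bsub>G\<^esub> t = 1" for t by (simp add: G_simps Psi_single psi_cls hmod_triv del: psi.simps)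
  qed (simp_all only: G_mult G_simps(2) Psi_add K_eq_kernel)
  ultimately show ?thesis by (simp add: green_ring_def)
qed

end

subsection \<open>Evaluation of integer polynomials\<close>

definition zeval :: "complex \<Rightarrow> complex \<Rightarrow> complex \<Rightarrow> zpoly \<Rightarrow> complex" where
  "zeval x y z P = (\<Sum>m\<in>Poly_Mapping.keys P. of_int (Poly_Mapping.lookup P m) *
     (x ^ Poly_Mapping.lookup m Lx * y ^ Poly_Mapping.lookup m Ly * z ^ Poly_Mapping.lookup m Lz))"

context
  fixes x y z :: complex
begin

lemma zeval_add: "zeval x y z (P + Q) = zeval x y z P + zeval x y z Q"
  unfolding zeval_def
  by (rule sum_keys_add[where F = "\<lambda>m c. of_int c * (x ^ Poly_Mapping.lookup m Lx * y ^ Poly_Mapping.lookup m Ly * z ^ Poly_Mapping.lookup m Lz)"])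
    (simp_all add: distrib_right)

lemma zeval_0: "zeval x y z 0 = 0"
  by (simp add: zeval_def)

lemma zeval_single: "zeval x y z (Poly_Mapping.single m c) =
    of_int c * (x ^ Poly_Mapping.lookup m Lx * y ^ Poly_Mapping.lookup m Ly * z ^ Poly_Mapping.lookup m Lz)"
  by (cases "c = 0") (simp_all add: zeval_def)

lemma zeval_mult: "zeval x y z (P * Q) = zeval x y z P * zeval x y z Q"
proof -
  have 1: "zeval x y z (Poly_Mapping.single m c * Q) = zeval x y z (Poly_Mapping.single m c) * zeval x y z Q" for m c
    by (induction Q rule: poly_mapping_induct_sum)
      (simp_all add: zeval_0 zeval_add zeval_single mult_single lookup_add power_add algebra_simps)
  show ?thesis
    by (induction P rule: poly_mapping_induct_sum) (simp_all add: 1 zeval_0 zeval_add distrib_right)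
qed

lemma zeval_of_int: "zeval x y z (of_int c) = of_int c"
  using zeval_single[of 0 c] by (simp flip: single_of_int)

lemma zeval_1: "zeval x y z 1 = 1"
  using zeval_of_int[of 1] by simp

lemma zeval_diff: "zeval x y z (P - Q) = zeval x y z P - zeval x y z Q"
  using zeval_add[of "P - Q" Q] by simp

lemma zeval_power: "zeval x y z (P ^ k) = zeval x y z P ^ k"
  by (induction k) (simp_all add: zeval_1 zeval_mult)

lemma zeval_sum: "zeval x y z (sum f A) = (\<Sum>a\<in>A. zeval x y z (f a))"
  by (induction A rule: infinite_finite_induct) (simp_all add: zeval_0 zeval_add)

lemma zeval_var: "zeval x y z px = x" "zeval x y z py = y" "zeval x y z pz = z"
  by (simp_all add: zvar_def zeval_single lookup_single)

end

lemmas zeval_simps = zeval_add zeval_0 zeval_mult zeval_of_int zeval_1 zeval_diff zeval_power zeval_sum zeval_var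

lemma zvar_power: "zvar l ^ k = Poly_Mapping.single (Poly_Mapping.single l k) 1"
  by (induction k) (simp_all add: zvar_def mult_single flip: single_add)

lemma zpoly_monomial:
  "Poly_Mapping.single m c = of_int c * (px ^ Poly_Mapping.lookup m Lx * py ^ Poly_Mapping.lookup m Ly * pz ^ Poly_Mapping.lookup m Lz)"
proof -
  let ?l = "Poly_Mapping.lookup m"
  have m: "Poly_Mapping.single Lx (?l Lx) + Poly_Mapping.single Ly (?l Ly) + Poly_Mapping.single Lz (?l Lz) = m"
  proof (rule poly_mapping_eqI)
    fix k show "Poly_Mapping.lookup (Poly_Mapping.single Lx (?l Lx) + Poly_Mapping.single Ly (?l Ly) + Poly_Mapping.single Lz (?l Lz)) k = ?l k"
      by (cases k) (simp_all add: lookup_add lookup_single)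
  qed
  have "of_int c = (Poly_Mapping.single 0 c :: zpoly)" by (simp flip: single_of_int)
  then show ?thesis by (simp only: zvar_power mult_single m mult_1_right add_0)
qed

text \<open>Multiplication by one variable at a time is the form in which the spanning argument can
  be run.\<close>

lemma zpoly_induct [case_names one x y z add uminus]:
  assumes one: "P 1" and x: "\<And>f. P f \<Longrightarrow> P (px * f)" and y: "\<And>f. P f \<Longrightarrow> P (py * f)" and z: "\<And>f. P f \<Longrightarrow> P (pz * f)"
    and add: "\<And>f g. P f \<Longrightarrow> P g \<Longrightarrow> P (f + g)" and uminus: "\<And>f. P f \<Longrightarrow> P (- f)"
  shows "P (f :: zpoly)"
proof -
  have zero: "P 0" using add[OF one uminus[OF one]] by simp
  have z': "P (pz ^ c)" for c by (induction c) (simp_all add: one z)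
  have y': "P (py ^ b * pz ^ c)" for b c by (induction b) (simp_all add: z' y mult.assoc)
  have x': "P (px ^ a * py ^ b * pz ^ c)" for a b c by (induction a) (simp_all add: y' x mult.assoc)
  have nat: "P (of_nat k * g)" if "P g" for k g
    by (induction k) (simp_all add: zero distrib_right add that)
  have int: "P (of_int k * g)" if "P g" for k g
    by (cases k rule: int_cases2) (use nat[OF that] uminus in auto)
  show ?thesis
    by (induction f rule: poly_mapping_induct_sum) (simp_all add: zero add zpoly_monomial int x')
qed

subsection \<open>Chebyshev-like recursions\<close>

lemma F_poly_rec: "F_poly (t + 2) = pz * F_poly (t + 1) - py * F_poly t"
  by (cases t) simp_all

text \<open>
  Summands with \<open>2 * i > t\<close> vanish because of the binomial coefficient, so truncated subtraction in the
  exponents does no harm.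
\<close>

lemma F_poly_closed:
  "F_poly (Suc t) = pz ^ t + (\<Sum>i=1..t div 2. (-1) ^ i * of_nat ((t - i) choose i) * py ^ i * pz ^ (t - 2 * i))"
proof -
  define c :: "nat \<Rightarrow> nat \<Rightarrow> zpoly" where
    "c t i = (-1) ^ i * of_nat ((t - i) choose i) * py ^ i * pz ^ (t - 2 * i)" for t i
  have c0: "c (t + 2) 0 = pz * c (t + 1) 0" for t by (simp add: c_def)
  \<comment> \<open>Pascal's rule, term by term; the y-term of the recursion raises the summation
    index by one.\<close>
  have cS: "c (t + 2) (Suc i) = pz * c (t + 1) (Suc i) - py * c t i" for t i
  proof -
    have p: "(t + 2 - Suc i) choose (Suc i) = ((t + 1 - Suc i) choose Suc i) + ((t - i) choose i)"
    proof (cases "i \<le> t")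
      case True
      then have "t + 2 - Suc i = Suc (t - i)" by simp
      then show ?thesis by simp
    next
      case False
      then show ?thesis by (cases i) auto
    qed
    have z: "of_nat ((t + 1 - Suc i) choose Suc i) * (pz * pz ^ (t + 1 - 2 * Suc i)) = (of_nat ((t + 1 - Suc i) choose Suc i) * pz ^ (t - 2 * i) :: zpoly)"
    proof (cases "2 * i + 1 \<le> t")
      case True
      then have "t - 2 * i = Suc (t + 1 - 2 * Suc i)" by simp
      then show ?thesis by simp
    qed (simp add: binomial_eq_0)
    have "c (t + 2) (Suc i) = (-1) ^ Suc i * py ^ Suc i * (of_nat ((t + 1 - Suc i) choose Suc i) * pz ^ (t - 2 * i))
        + (-1) ^ Suc i * of_nat ((t - i) choose i) * py ^ Suc i * pz ^ (t - 2 * i)"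
      unfolding c_def p of_nat_add by (simp add: algebra_simps)
    also have "\<dots> = pz * c (t + 1) (Suc i) - py * c t i"
      unfolding z[symmetric] by (simp add: c_def algebra_simps)
    finally show ?thesis .
  qed
  have zero: "c t i = 0" if "t < 2 * i" for t i
    using that by (simp add: c_def binomial_eq_0)
  define A where "A t = (\<Sum>i\<le>t div 2. c t i)" for t
  have A: "A t = (\<Sum>i\<le>N. c t i)" if "t div 2 \<le> N" for t N
    unfolding A_def using that by (intro sum.mono_neutral_left) (auto intro!: zero)
  have rec: "A (t + 2) = pz * A (t + 1) - py * A t" for t
  proof -
    have "A (t + 2) = c (t + 2) 0 + (\<Sum>i\<le>t. c (t + 2) (Suc i))"
      by (subst A[of _ "Suc t"], simp, subst sum.atMost_Suc_shift, rule refl)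
    moreover have "A (t + 1) = c (t + 1) 0 + (\<Sum>i\<le>t. c (t + 1) (Suc i))"
      by (subst A[of _ "Suc t"], simp, subst sum.atMost_Suc_shift, rule refl)
    moreover have "A t = (\<Sum>i\<le>t. c t i)" by (rule A) simp
    ultimately show ?thesis
      unfolding c0 cS by (simp add: sum_subtractf sum_distrib_left algebra_simps)
  qed
  have "F_poly (Suc t) = A t \<and> F_poly (Suc (Suc t)) = A (Suc t)"
  proof (induction t)
    case 0
    then show ?case by (simp add: A_def c_def)
  next
    case (Suc t)
    then show ?case using F_poly_rec[of "Suc t"] rec[of t] by simp
  qed
  then have "F_poly (Suc t) = (\<Sum>i\<in>{0..t div 2}. c t i)" by (simp add: A_def atLeast0AtMost)
  then show ?thesis by (simp add: sum.atLeast_Suc_atMost c_def)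
qed

text \<open>
  \<open>wpoly n t\<close> represents the module \<open>simple2 0 t\<close>; in particular \<open>wpoly n 0\<close> is a sum of two one-dimensional
  modules.
\<close>

fun wpoly :: "nat \<Rightarrow> nat \<Rightarrow> zpoly" where
  "wpoly n 0 = 1 + px * py ^ (n - 1)"
| "wpoly n (Suc 0) = pz"
| "wpoly n (Suc (Suc t)) = pz * wpoly n (Suc t) - py * wpoly n t"

text \<open>The relations that allow \<open>F_poly\<close> to be traded for \<open>wpoly\<close>.
  They hold modulo the ideal of the theorem and modulo the kernel of the evaluation, and the locale
  is interpreted for both.\<close>

locale power_rels = two_sided_ideal I for I :: "zpoly set" +
  fixes n m :: nat
  assumes n: "n = 2 * m" and m: "m > 0" and xn: "px ^ n \<doteq> 1" and xy: "px\<^sup>2 \<doteq> py\<^sup>2"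
begin

lemma y_mult_power: "py * py ^ (n - 1) = py ^ n"
proof -
  have "Suc (n - 1) = n" using n m by simp
  then show ?thesis by (metis power_Suc)
qed

lemma yn: "py ^ n \<doteq> 1"
proof -
  have "py ^ n = (py\<^sup>2) ^ m" by (simp add: n power_mult)
  also have "\<dots> \<doteq> (px\<^sup>2) ^ m" by (intro eqv_power eqv_sym[OF xy])
  also have "\<dots> = px ^ n" by (simp add: n power_mult)
  finally show ?thesis using xn eqv_trans by blast
qed

lemma yn_mult: "py ^ n * f \<doteq> f" "f * py ^ n \<doteq> f"
  using eqv_mult[OF yn eqv_refl, of f] eqv_mult[OF eqv_refl yn, of f] by simp_all

text \<open>Both sides satisfy the same recursion. That y has order dividing n enters in the initial
  values, where y times \<open>px * py ^ (n - 1)\<close> becomes x.\<close>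

lemma wpoly_F: "wpoly n (Suc t) \<doteq> F_poly (t + 2) - px * F_poly t"
proof -
  have "wpoly n (Suc t) \<doteq> F_poly (t + 2) - px * F_poly t \<and> wpoly n (Suc (Suc t)) \<doteq> F_poly (t + 3) - px * F_poly (t + 1)"
  proof (induction t)
    case 0
    have "py * (px * py ^ (n - 1)) = px * py ^ n"
      using y_mult_power by (simp add: mult.left_commute)
    also have "\<dots> \<doteq> px" by (rule yn_mult)
    finally have "pz * pz - (py + py * (px * py ^ (n - 1))) \<doteq> pz * pz - (py + px)"
      by (intro eqv_diff eqv_add eqv_refl)
    then show ?case by (simp add: numeral_3_eq_3 algebra_simps)
  next
    case (Suc t)
    have "wpoly n (Suc (Suc (Suc t))) \<doteq> pz * (F_poly (t + 3) - px * F_poly (t + 1)) - py * (F_poly (t + 2) - px * F_poly t)"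
      unfolding wpoly.simps(3)[of n "Suc t"] using Suc by (intro eqv_diff eqv_mult eqv_refl) auto
    also have "\<dots> = F_poly (Suc t + 3) - px * F_poly (Suc t + 1)"
    proof -
      have a: "F_poly (Suc t + 3) = pz * F_poly (t + 3) - py * F_poly (t + 2)"
        using F_poly_rec[of "t + 2"] by (simp add: eval_nat_numeral)
      have b: "F_poly (Suc t + 1) = pz * F_poly (t + 1) - py * F_poly t"
        using F_poly_rec[of t] by simp
      show ?thesis unfolding a b by (simp only: algebra_simps)
    qed
    finally show ?case using Suc by (simp add: eval_nat_numeral)
  qed
  then show ?thesis ..
qed

end

locale green_rels_ideal = power_rels +
  assumes zx: "pz * px \<doteq> pz * py"
    and wm: "wpoly n m * py ^ m \<doteq> wpoly n m"
    and wm1: "wpoly n (m + 1) \<doteq> py ^ (m + 1) * wpoly n (m - 1)"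
begin

lemma wpoly_rec: "t > 0 \<Longrightarrow> wpoly n (t + 1) = pz * wpoly n t - py * wpoly n (t - 1)"
  by (cases t) simp_all

text \<open>x - y annihilates \<open>wpoly n 1\<close> by zx = zy, and \<open>wpoly n 0\<close>
  because x and y have equal squares and the n-th power of y is 1; the recursion passes this on. In
  terms of modules, changing the sign of a one-dimensional tensor factor does not affect a
  two-dimensional module.\<close>

lemma xw: "px * wpoly n t \<doteq> py * wpoly n t"
proof -
  have "px * wpoly n t \<doteq> py * wpoly n t \<and> px * wpoly n (Suc t) \<doteq> py * wpoly n (Suc t)"
  proof (induction t)
    case 0
    note n1 = y_mult_power
    have "px * wpoly n 0 = px + px\<^sup>2 * py ^ (n - 1)" by (simp add: algebra_simps power2_eq_square)
    also have "\<dots> \<doteq> px + py\<^sup>2 * py ^ (n - 1)" by (intro eqv_add eqv_mult eqv_refl xy)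
    also have "\<dots> = px + py * py ^ n" using n1 by (simp add: power2_eq_square mult.assoc)
    also have "\<dots> \<doteq> px + py" by (intro eqv_add eqv_refl yn_mult)
    also have "\<dots> = py + px" by simp
    also have "\<dots> \<doteq> py + px * py ^ n" by (intro eqv_add eqv_refl eqv_sym[OF yn_mult(2)])
    also have "\<dots> = py * wpoly n 0" unfolding n1[symmetric] by (simp add: algebra_simps)
    finally show ?case using zx by (simp add: mult.commute)
  next
    case (Suc t)
    have "px * wpoly n (Suc (Suc t)) = pz * (px * wpoly n (Suc t)) - py * (px * wpoly n t)"
      by (simp add: algebra_simps)
    also have "\<dots> \<doteq> pz * (py * wpoly n (Suc t)) - py * (py * wpoly n t)"
      by (intro eqv_diff eqv_mult[OF eqv_refl] conjunct1[OF Suc] conjunct2[OF Suc])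
    also have "\<dots> = py * wpoly n (Suc (Suc t))" by (simp add: algebra_simps)
    finally show ?case using Suc by blast
  qed
  then show ?thesis ..
qed

text \<open>The recursion read upwards from m + r and downwards from m - r has the same shape, so
  two consecutive reflections give the next one. The bound on r keeps the subtractions from being
  truncated.\<close>

lemma w_reflect_upper: "r + 1 \<le> m \<Longrightarrow> wpoly n (m + r) \<doteq> py ^ (m + r) * wpoly n (m - r) \<and>
    wpoly n (m + r + 1) \<doteq> py ^ (m + r + 1) * wpoly n (m - r - 1)"
proof (induction r)
  case 0
  then show ?case using eqv_sym[OF wm] wm1 by (simp add: mult.commute)
next
  case (Suc r)
  define k where "k = m - r - 2"
  have k: "m - r = k + 2" "m - r - 1 = k + 1" "m - Suc r = k + 1" "m - Suc r - 1 = k" using Suc.prems by (simp_all add: k_def)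
  have IH: "wpoly n (m + r) \<doteq> py ^ (m + r) * wpoly n (k + 2)" "wpoly n (m + r + 1) \<doteq> py ^ (m + r + 1) * wpoly n (k + 1)"
    using Suc k by auto
  have "wpoly n (m + r + 2) = pz * wpoly n (m + r + 1) - py * wpoly n (m + r)" by simp
  also have "\<dots> \<doteq> pz * (py ^ (m + r + 1) * wpoly n (k + 1)) - py * (py ^ (m + r) * wpoly n (k + 2))"
    by (intro eqv_diff eqv_mult eqv_refl IH)
  also have "\<dots> = py ^ (m + r + 2) * wpoly n k" by (simp add: algebra_simps)
  finally show ?case using IH(2) k by simp
qed

text \<open>Below m the reflection is the inverse of the one above m, since the n-th power of y is
  1.\<close>

lemma w_reflect:
  assumes "t \<le> n" shows "wpoly n t \<doteq> py ^ t * wpoly n (n - t)"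
proof -
  have up: "wpoly n t \<doteq> py ^ t * wpoly n (n - t)" if "m \<le> t" "t \<le> n" for t
  proof (cases "t < n")
    case True
    then have "t - m + 1 \<le> m" "m + (t - m) = t" "m - (t - m) = n - t" using that n by auto
    then show ?thesis using w_reflect_upper[of "t - m"] by metis
  next
    case False
    then have "m - 1 + 1 \<le> m" "m + (m - 1) + 1 = t" "m - (m - 1) - 1 = n - t" using that n m by auto
    then show ?thesis using w_reflect_upper[of "m - 1"] by metis
  qed
  show ?thesis
  proof (cases "m \<le> t")
    case True
    then show ?thesis using up assms by blast
  next
    case False
    have "py ^ t * wpoly n (n - t) \<doteq> py ^ t * (py ^ (n - t) * wpoly n (n - (n - t)))"
      by (intro eqv_mult eqv_refl up) (use False n in auto)
    also have "\<dots> = py ^ n * wpoly n t"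
      using assms by (simp flip: mult.assoc power_add)
    also have "\<dots> \<doteq> wpoly n t" by (rule yn_mult)
    finally show ?thesis by (rule eqv_sym)
  qed
qed

text \<open>By the recursion, two consecutive values suffice. At n the reflection returns the value
  at 0; at n + 1 the term \<open>wpoly n (n - 1)\<close> is reflected to a multiple of z, and zx =
  zy makes the surplus cancel.\<close>

lemma w_periodic: "wpoly n (t + n) \<doteq> wpoly n t"
proof -
  have 0: "wpoly n n \<doteq> wpoly n 0"
    using eqv_trans[OF w_reflect[of n] ] yn_mult(1) by simp
  note n1 = y_mult_power
  have "wpoly n (n + 1) = pz * wpoly n n - py * wpoly n (n - 1)" using n m by (intro wpoly_rec) simp
  also have "\<dots> \<doteq> pz * wpoly n 0 - py * (py ^ (n - 1) * wpoly n (n - (n - 1)))"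
    by (intro eqv_diff eqv_mult eqv_refl 0 w_reflect) simp
  also have "\<dots> = pz + pz * px * py ^ (n - 1) - py ^ n * pz"
  proof -
    have "n - (n - 1) = Suc 0" using n m by simp
    moreover have "py * (py ^ (n - 1) * pz) = py ^ n * pz" by (simp only: n1[symmetric] mult.assoc)
    ultimately show ?thesis by (simp only: wpoly.simps distrib_left mult_1_right mult.assoc)
  qed
  also have "\<dots> \<doteq> pz + pz * py * py ^ (n - 1) - py ^ n * pz"
    by (intro eqv_diff eqv_add eqv_mult eqv_refl zx)
  also have "\<dots> = pz" unfolding mult.assoc n1 by (simp add: mult.commute)
  finally have 1: "wpoly n (Suc n) \<doteq> wpoly n (Suc 0)" by simp
  have "wpoly n (t + n) \<doteq> wpoly n t \<and> wpoly n (Suc t + n) \<doteq> wpoly n (Suc t)"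
  proof (induction t)
    case 0
    then show ?case using \<open>wpoly n n \<doteq> wpoly n 0\<close> 1 by simp
  next
    case (Suc t)
    have "pz * wpoly n (Suc t + n) - py * wpoly n (t + n) \<doteq> pz * wpoly n (Suc t) - py * wpoly n t"
      using Suc by (intro eqv_diff eqv_mult eqv_refl) auto
    then show ?case using Suc by simp
  qed
  then show ?thesis ..
qed

lemma w_mod: "wpoly n t \<doteq> wpoly n (t mod n)"
proof -
  have "wpoly n (r + k * n) \<doteq> wpoly n r" for r k
  proof (induction k)
    case (Suc k)
    have "wpoly n (r + k * n + n) \<doteq> wpoly n (r + k * n)" by (rule w_periodic)
    from eqv_trans[OF this Suc] show ?case by (simp add: algebra_simps)
  qed simp
  from this[of "t mod n" "t div n"] show ?thesis by simp
qed

end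

section \<open>Evaluation of polynomials at the characters, and a spanning set of the
  quotient\<close>

context hopf_char
begin

text \<open>px stands for \<open>simple1 1 False\<close>, so the representative of
  \<open>simple1 i False\<close> carries py to the power i - 1 modulo n; adding n avoids truncation
  at i = 0.\<close>

primrec bpoly :: "simple_index \<Rightarrow> zpoly" where
  "bpoly (I1 i s) = (if s then py ^ i else px * py ^ (i + n - 1))"
| "bpoly (I2 a b) = py ^ a * wpoly n (b - a)"

text \<open>The arguments of \<open>zeval\<close> are the values of \<open>chi1 1 False\<close>,
  \<open>chi1 1 True\<close> and \<open>chi2 0 1\<close>, the characters of the modules that px, py
  and pz represent.\<close>

primrec Phi :: "zpoly \<Rightarrow> point \<Rightarrow> complex" where
  "Phi P (PC u v) = zeval (z ^ (u + v)) (z ^ (u + v)) (z ^ u + z ^ v) P"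
| "Phi P (PT w) = zeval (- (z ^ w)) (z ^ w) 0 P"

lemma Phi_simps:
  "Phi (P + Q) t = Phi P t + Phi Q t" "Phi (P * Q) t = Phi P t * Phi Q t" "Phi (P - Q) t = Phi P t - Phi Q t"
  "Phi 1 t = 1" "Phi 0 t = 0" "Phi (of_int c) t = of_int c" "Phi (sum f A) t = (\<Sum>a\<in>A. Phi (f a) t)"
  by (cases t; simp add: zeval_simps)+

lemma z_n_mult: "z ^ (w * n) = 1" "z ^ (n * w) = 1"
  by (simp_all add: power_mult z_n mult.commute[of w])

lemma Phi_wpoly: "Phi (wpoly n t) (PC u v) = z ^ (u * t) + z ^ (v * t)" "Phi (wpoly n t) (PT w) = 0"
proof -
  have n1: "z ^ w * (z ^ w) ^ (n - Suc 0) = 1" for w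
    using power_Suc[of "z ^ w" "n - 1"] z_n_mult(1)[of w] n_gt_1 by (simp flip: power_mult)
  have "(Phi (wpoly n t) (PC u v) = z ^ (u * t) + z ^ (v * t) \<and> Phi (wpoly n (Suc t)) (PC u v) = z ^ (u * Suc t) + z ^ (v * Suc t))
      \<and> Phi (wpoly n t) (PT w) = 0 \<and> Phi (wpoly n (Suc t)) (PT w) = 0"
  proof (induction t)
    case 0
    then show ?case using n1[of "u + v"] n1[of w] by (simp add: zeval_simps)
  next
    case (Suc t)
    then show ?case by (simp add: zeval_simps power_add algebra_simps)
  qed
  then show "Phi (wpoly n t) (PC u v) = z ^ (u * t) + z ^ (v * t)" "Phi (wpoly n t) (PT w) = 0" by blast+
qed

lemma Phi_bpoly:
  assumes "x \<in> Simp" shows "Phi (bpoly x) t = chi x t"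
proof (cases x)
  case (I1 i s)
  have 1: "z ^ w * (z ^ w) ^ (i + n - 1) = z ^ (w * i)" for w
  proof -
    have "z ^ w * (z ^ w) ^ (i + n - 1) = z ^ (w * (i + n))"
      using power_Suc[of "z ^ w" "i + n - 1"] n_gt_1 by (simp flip: power_mult)
    then show ?thesis by (simp add: distrib_left power_add z_n_mult)
  qed
  show ?thesis
    using 1 by (cases t) (auto simp: I1 zeval_simps power_mult)
next
  case (I2 a b)
  then have ab: "a < b" using assms by (auto simp: Simp_def)
  show ?thesis
  proof (cases t)
    case (PC u v)
    have "(z ^ (u + v)) ^ a * z ^ (k * (b - a)) = z ^ (k * b) * z ^ (l * a)" if "u + v = k + l" for k l
    proof -
      have b: "b = a + (b - a)" using ab by simp
      have "(z ^ (k + l)) ^ a * z ^ (k * (b - a)) = z ^ (k * (a + (b - a))) * z ^ (l * a)"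
        by (simp only: power_add power_mult_distrib distrib_left power_mult[symmetric] mult_ac)
      then show ?thesis using that b by simp
    qed
    from this[of u v] this[of v u] show ?thesis
      using Phi_wpoly(1)[of "b - a" u v]
      by (simp add: I2 PC zeval_simps distrib_left power_add add.commute mult.commute)
  next
    case (PT w)
    then show ?thesis using Phi_wpoly(2)[of "b - a" w] by (simp add: I2 zeval_simps)
  qed
qed

definition Phi_kernel :: "zpoly set" where "Phi_kernel = {P. \<forall>t. Phi P t = 0}"

lemma Phi_kernel_ideal: "two_sided_ideal Phi_kernel"
  by unfold_locales (auto simp: Phi_kernel_def Phi_simps)

text \<open>The integer span L of the \<open>bpoly x\<close> modulo I contains 1 and is closed under
  multiplication by the three variables. Periodicity brings exponents of py and indices of
  \<open>wpoly\<close> below n, and reflection handles the products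
  \<open>py ^ j * wpoly n t\<close> with j + t \<ge> n.\<close>

lemma zpoly_spanning:
  assumes "green_rels_ideal I n m"
  shows "\<exists>c. P - (\<Sum>x\<in>Simp. of_int (c x) * bpoly x) \<in> I"
proof -
  interpret green_rels_ideal I n m by fact
  define L where "L = {P. \<exists>c. P \<doteq> (\<Sum>x\<in>Simp. of_int (c x :: int) * bpoly x)}"
  have L_eqv: "Q \<in> L" if "P \<in> L" "Q \<doteq> P" for P Q
    using that eqv_trans by (auto simp: L_def)
  have L_add: "P + Q \<in> L" if "P \<in> L" "Q \<in> L" for P Q
  proof -
    obtain c d where c: "P \<doteq> (\<Sum>x\<in>Simp. of_int (c x :: int) * bpoly x)" and d: "Q \<doteq> (\<Sum>x\<in>Simp. of_int (d x :: int) * bpoly x)"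
      using \<open>P \<in> L\<close> \<open>Q \<in> L\<close> by (auto simp: L_def)
    have "P + Q \<doteq> (\<Sum>x\<in>Simp. of_int (c x + d x) * bpoly x)"
      using eqv_add[OF c d] by (simp add: distrib_right sum.distrib)
    then show ?thesis unfolding L_def by (intro CollectI exI[of _ "\<lambda>x. c x + d x"])
  qed
  have L_uminus: "- P \<in> L" if "P \<in> L" for P
  proof -
    obtain c where c: "P \<doteq> (\<Sum>x\<in>Simp. of_int (c x :: int) * bpoly x)" using \<open>P \<in> L\<close> by (auto simp: L_def)
    have "- P \<doteq> (\<Sum>x\<in>Simp. of_int (- c x) * bpoly x)"
      using eqv_diff[OF eqv_refl[of 0] c] by (simp add: sum_negf)
    then show ?thesis unfolding L_def by (intro CollectI exI[of _ "\<lambda>x. - c x"])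
  qed
  have L_basis: "bpoly x \<in> L" if "x \<in> Simp" for x
  proof -
    have "(\<Sum>y\<in>Simp. of_int (if y = x then 1 else 0) * bpoly y) = (\<Sum>y\<in>Simp. if y = x then bpoly x else 0)"
      by (intro sum.cong) auto
    also have "\<dots> = bpoly x" using that finite_Simp by simp
    finally have "bpoly x \<doteq> (\<Sum>y\<in>Simp. of_int (if y = x then 1 else 0) * bpoly y)" by simp
    then show ?thesis unfolding L_def by (intro CollectI exI[of _ "\<lambda>y. if y = x then 1 else 0"])
  qed
  have L_0: "0 \<in> L" using L_add[OF L_basis L_uminus[OF L_basis], of "I1 0 True" "I1 0 True"] n_gt_1 by (auto simp: Simp_def)
  have L_nat: "of_nat k * Q \<in> L" if "Q \<in> L" for k Q
    by (induction k) (simp_all add: L_0 distrib_right L_add that)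
  have L_int: "of_int k * Q \<in> L" if "Q \<in> L" for k Q
    by (cases k rule: int_cases2) (use L_nat[OF that] L_uminus in auto)
  have L_sum: "(\<Sum>x\<in>S. f x) \<in> L" if "\<And>x. x \<in> S \<Longrightarrow> f x \<in> L" for S and f :: "simple_index \<Rightarrow> zpoly"
    using that by (induction S rule: infinite_finite_induct) (simp_all add: L_0 L_add)
  have n0: "n > 0" using n_gt_1 by simp
  have ymod: "py ^ i \<doteq> py ^ (i mod n)" for i by (rule eqv_power_mod[OF yn])
  have L_y: "py ^ i \<in> L" for i
  proof -
    have "bpoly (I1 (i mod n) True) \<in> L" by (rule L_basis) (use n0 in \<open>auto simp: Simp_def\<close>)
    then show ?thesis using L_eqv[OF _ ymod] by simp
  qed
  have L_xy: "px * py ^ i \<in> L" for i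
  proof -
    \<comment> \<open>Brings the exponent into the form that \<open>bpoly\<close> has for the
      residue of i + 1.\<close>
    have "py ^ i \<doteq> py ^ ((i + 1) mod n + n - 1)"
    proof -
      have "((i + 1) mod n + n - 1) mod n = i mod n"
      proof -
        have "(i + 1) mod n + n - 1 = (i + 1) mod n + (n - 1)" using n0 by simp
        then have "((i + 1) mod n + n - 1) mod n = (i + 1 + (n - 1)) mod n" by (metis mod_add_left_eq)
        also have "i + 1 + (n - 1) = i + n" using n0 by simp
        finally show ?thesis by simp
      qed
      then show ?thesis using ymod eqv_sym eqv_trans by metis
    qed
    then have "px * py ^ i \<doteq> bpoly (I1 ((i + 1) mod n) False)" using eqv_mult[OF eqv_refl] by simp
    moreover have "I1 ((i + 1) mod n) False \<in> Simp" using n0 by (auto simp: Simp_def)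
    ultimately show ?thesis using L_eqv L_basis by blast
  qed
  have L_yw0: "py ^ j * wpoly n t \<in> L" if "j < n" "t < n" for j t
  proof (cases "t = 0")
    case True
    have "py ^ j * wpoly n t = py ^ j + px * py ^ (j + (n - 1))"
      by (simp add: True distrib_left power_add mult_ac)
    then show ?thesis using L_add[OF L_y L_xy] by simp
  next
    case False
    show ?thesis
    proof (cases "j + t < n")
      case True
      then have "I2 j (j + t) \<in> Simp" using False by (auto simp: Simp_def)
      from L_basis[OF this] show ?thesis by simp
    next
      case jt: False
      \<comment> \<open>The weights j and j + t are those of \<open>I2 a j\<close> modulo n; the
        reflection puts the smaller one first.\<close>
      define a where "a = j + t - n"
      have a: "a < j" "j - a = n - t" "j + t = n + a" using jt that by (auto simp: a_def)
      have "py ^ j * wpoly n t \<doteq> py ^ j * (py ^ t * wpoly n (n - t))"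
        by (intro eqv_mult eqv_refl w_reflect) (use that in auto)
      also have "\<dots> = py ^ n * (py ^ a * wpoly n (n - t))"
        by (simp add: a(3)[symmetric] power_add[symmetric] mult.assoc[symmetric])
      also have "\<dots> \<doteq> py ^ a * wpoly n (n - t)" by (rule yn_mult)
      finally have "py ^ j * wpoly n t \<doteq> bpoly (I2 a j)" using a by simp
      moreover have "I2 a j \<in> Simp" using a that by (auto simp: Simp_def)
      ultimately show ?thesis using L_eqv L_basis by blast
    qed
  qed
  have L_yw: "py ^ j * wpoly n t \<in> L" for j t
    using L_eqv[OF L_yw0 eqv_mult[OF ymod w_mod], of j t] n0 by simp
  have gens: "px * bpoly x \<in> L \<and> py * bpoly x \<in> L \<and> pz * bpoly x \<in> L" if "x \<in> Simp" for x
  proof (cases x)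
    case (I1 i s)
    show ?thesis
    proof (cases s)
      case True
      then show ?thesis
        using L_xy[of i] L_y[of "Suc i"] L_yw[of i 1] by (simp add: I1 mult.commute)
    next
      case False
      define k where "k = i + n - 1"
      have b: "bpoly x = px * py ^ k" by (simp add: I1 False k_def)
      have "px * (px * py ^ k) \<doteq> py\<^sup>2 * py ^ k"
        using eqv_mult[OF xy eqv_refl, of "py ^ k"] by (simp add: power2_eq_square mult.assoc)
      then have 1: "px * (px * py ^ k) \<in> L" unfolding power_add[symmetric] by (rule L_eqv[OF L_y])
      have 2: "py * (px * py ^ k) \<in> L" using L_xy[of "Suc k"] by (simp add: mult_ac)
      have "pz * (px * py ^ k) \<doteq> pz * py * py ^ k"
        using eqv_mult[OF zx eqv_refl, of "py ^ k"] by (simp add: mult.assoc)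
      moreover have "pz * py * py ^ k = py ^ Suc k * wpoly n 1" by (simp add: mult_ac)
      ultimately have 3: "pz * (px * py ^ k) \<in> L" using L_eqv L_yw by metis
      show ?thesis unfolding b using 1 2 3 by blast
    qed
  next
    case (I2 a b)
    then have ab: "b - a > 0" using that by (auto simp: Simp_def)
    define t where "t = b - a"
    have bx: "bpoly x = py ^ a * wpoly n t" by (simp add: I2 t_def)
    have "px * (py ^ a * wpoly n t) = py ^ a * (px * wpoly n t)" by (simp add: mult_ac)
    also have "\<dots> \<doteq> py ^ a * (py * wpoly n t)" by (intro eqv_mult eqv_refl xw)
    also have "\<dots> = py ^ Suc a * wpoly n t" by (simp add: mult_ac)
    finally have 1: "px * (py ^ a * wpoly n t) \<in> L" using L_eqv L_yw by blast
    have 2: "py * (py ^ a * wpoly n t) \<in> L" using L_yw[of "Suc a" t] by (simp add: mult_ac)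
    \<comment> \<open>The recursion of \<open>wpoly\<close>, read as a formula for multiplication by
      pz.\<close>
    have "pz * (py ^ a * wpoly n t) = py ^ a * wpoly n (t + 1) + py ^ Suc a * wpoly n (t - 1)"
    proof -
      have "pz * wpoly n t = wpoly n (t + 1) + py * wpoly n (t - 1)"
        using ab wpoly_rec[of t] by (simp add: t_def)
      moreover have "pz * (py ^ a * wpoly n t) = py ^ a * (pz * wpoly n t)" by (simp add: mult_ac)
      ultimately show ?thesis by (simp only: distrib_left power_Suc mult_ac)
    qed
    then have 3: "pz * (py ^ a * wpoly n t) \<in> L" using L_add L_yw by metis
    show ?thesis unfolding bx using 1 2 3 by blast
  qed
  have L_mult: "g * P \<in> L" if "P \<in> L" and g: "\<And>x. x \<in> Simp \<Longrightarrow> g * bpoly x \<in> L" for g P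
  proof -
    obtain c where "P \<doteq> (\<Sum>x\<in>Simp. of_int (c x :: int) * bpoly x)" using \<open>P \<in> L\<close> by (auto simp: L_def)
    then have "g * P \<doteq> g * (\<Sum>x\<in>Simp. of_int (c x) * bpoly x)" by (intro eqv_mult eqv_refl)
    also have "\<dots> = (\<Sum>x\<in>Simp. of_int (c x) * (g * bpoly x))" by (simp add: sum_distrib_left mult_ac)
    finally show ?thesis by (rule L_eqv[rotated]) (intro L_sum L_int g)
  qed
  have "P \<in> L"
  proof (induction P rule: zpoly_induct)
    case one
    show ?case using L_y[of 0] by simp
  next
    case (x f)
    then show ?case by (rule L_mult) (use gens in blast)
  next
    case (y f)
    then show ?case by (rule L_mult) (use gens in blast)
  next
    case (z f)
    then show ?case by (rule L_mult) (use gens in blast)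
  next
    case (add f g)
    then show ?case by (rule L_add)
  next
    case (uminus f)
    then show ?case by (rule L_uminus)
  qed
  then show ?thesis by (auto simp: L_def eqv_def)
qed

text \<open>The spanning elements are sent to independent characters, so nothing outside the ideal
  can vanish at all points.\<close>

lemma zpoly_quot_iso:
  assumes ideal: "green_rels_ideal (Idl\<^bsub>ring_of_type_algebra\<^esub> S) n m" and S: "S \<subseteq> Phi_kernel"
  shows "zpoly_quot S \<simeq> fun_ring char_span"
proof -
  let ?I = "Idl\<^bsub>ring_of_type_algebra\<^esub> S"
  have sub: "?I \<subseteq> Phi_kernel" by (rule genideal_subset[OF Phi_kernel_ideal S])
  have Phi_comb: "Phi (\<Sum>x\<in>Simp. of_int (c x) * bpoly x) t = (\<Sum>x\<in>Simp. of_int (c x) * chi x t)" for c t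
    by (simp add: Phi_simps Phi_bpoly)
  have ker: "?I = {P \<in> carrier ring_of_type_algebra. \<forall>t. Phi P t = 0}"
  proof (intro equalityI subsetI)
    fix P assume "P \<in> {P \<in> carrier ring_of_type_algebra. \<forall>t. Phi P t = 0}"
    then have P: "Phi P t = 0" for t by simp
    obtain c where c: "P - (\<Sum>x\<in>Simp. of_int (c x) * bpoly x) \<in> ?I" using zpoly_spanning[OF ideal] by blast
    then have "Phi (P - (\<Sum>x\<in>Simp. of_int (c x) * bpoly x)) t = 0" for t using sub by (auto simp: Phi_kernel_def)
    then have "(\<Sum>x\<in>Simp. of_int (c x) * chi x t) = 0" for t
      by (simp add: Phi_simps(3) P Phi_comb)
    then have "(of_int (c x) :: complex) = 0" if "x \<in> Simp" for x
      using chi_independent[of "\<lambda>x. of_int (c x)"] that by simp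
    then have "(\<Sum>x\<in>Simp. of_int (c x) * bpoly x) = 0" by (intro sum.neutral) simp
    then show "P \<in> ?I" using c by simp
  qed (use sub in \<open>auto simp: Phi_kernel_def\<close>)
  have im: "Phi ` carrier ring_of_type_algebra = char_span"
  proof (intro equalityI subsetI)
    fix f assume "f \<in> Phi ` carrier ring_of_type_algebra"
    then obtain P where f: "f = Phi P" by blast
    obtain c where c: "P - (\<Sum>x\<in>Simp. of_int (c x) * bpoly x) \<in> ?I" using zpoly_spanning[OF ideal] by blast
    then have "Phi (P - (\<Sum>x\<in>Simp. of_int (c x) * bpoly x)) t = 0" for t using sub by (auto simp: Phi_kernel_def)
    then have "f = (\<lambda>t. \<Sum>x\<in>Simp. of_int (c x) * chi x t)"
      by (simp add: Phi_simps(3) f Phi_comb fun_eq_iff)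
    then show "f \<in> char_span" by (auto simp: char_span_def)
  next
    fix f assume "f \<in> char_span"
    then obtain c where "f = (\<lambda>t. \<Sum>x\<in>Simp. of_int (c x) * chi x t)" by (auto simp: char_span_def)
    then have "f = Phi (\<Sum>x\<in>Simp. of_int (c x) * bpoly x)" by (simp add: Phi_comb fun_eq_iff)
    then show "f \<in> Phi ` carrier ring_of_type_algebra" by simp
  qed
  show ?thesis
    unfolding zpoly_quot_def im[symmetric]
    by (rule quotient_iso_fun_ring[OF ring.is_abelian_group[OF ring_ring_of_type_algebra] _ _ _ _ _ ker])
      (simp_all add: Phi_simps)
qed

lemma green_iso_zpoly:
  assumes "green_rels_ideal (Idl\<^bsub>ring_of_type_algebra\<^esub> S) n m" "S \<subseteq> Phi_kernel"
  shows "green_ring n q \<simeq> zpoly_quot S"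
proof -
  have "ring (zpoly_quot S)"
    unfolding zpoly_quot_def
    by (intro ideal.quotient_is_ring ring.genideal_ideal ring_ring_of_type_algebra) simp
  then show ?thesis
    using ring_iso_trans[OF green_ring_iso ring_iso_sym[OF _ zpoly_quot_iso[OF assms]]] by blast
qed

lemma Phi_kernel_power_rels: "power_rels Phi_kernel n (n div 2)"
proof -
  interpret two_sided_ideal Phi_kernel by (rule Phi_kernel_ideal)
  have "Phi (px ^ n - 1) t = 0" for t
  proof (cases t)
    case (PC u v)
    then show ?thesis using z_n_mult(1)[of "u + v"] by (simp add: zeval_simps flip: power_mult)
  next
    case (PT w)
    \<comment> \<open>Evenness of n removes the sign that px has at the points
      \<open>PT\<close>.\<close>
    have "(- (z ^ w)) ^ n = 1" using z_n_mult(1)[of w] even_n by (simp flip: power_mult)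
    then show ?thesis by (simp add: PT zeval_simps)
  qed
  moreover have "Phi (px\<^sup>2 - py\<^sup>2) t = 0" for t by (cases t) (simp_all add: zeval_simps)
  ultimately have "px ^ n - 1 \<in> Phi_kernel" "px\<^sup>2 - py\<^sup>2 \<in> Phi_kernel"
    by (simp_all add: Phi_kernel_def)
  then show ?thesis
    using even_n n_gt_1 by unfold_locales (auto simp: eqv_def)
qed


text \<open>Shifting the weights (0, l) and (l, 0) by (k, k) gives (k, n) and (n, k), which modulo n
  are the weights represented by \<open>wpoly n k\<close>.\<close>

lemma Phi_reflection:
  assumes "k + l = n" shows "Phi (wpoly n k - py ^ k * wpoly n l) t = 0"
proof (cases t)
  case (PC u v)
  have e: "z ^ (w * k) * z ^ (w * l) = 1" for w
    using z_n_mult(1)[of w] assms by (simp flip: power_add distrib_left)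
  have "(z ^ (u + v)) ^ k * (z ^ (u * l) + z ^ (v * l)) = z ^ (v * k) * (z ^ (u * k) * z ^ (u * l)) + z ^ (u * k) * (z ^ (v * k) * z ^ (v * l))"
    by (simp only: power_add power_mult_distrib distrib_left power_mult[symmetric] mult_ac)
  also have "\<dots> = z ^ (v * k) + z ^ (u * k)" by (simp only: e mult_1_right)
  finally show ?thesis
    using Phi_wpoly(1)[of k u v] Phi_wpoly(1)[of l u v] by (simp add: PC zeval_simps)
next
  case (PT w)
  then show ?thesis using Phi_wpoly(2)[of k w] Phi_wpoly(2)[of l w] by (simp add: zeval_simps)
qed

lemma Phi_kernel_xyz: "px\<^sup>2 - py\<^sup>2 \<in> Phi_kernel" "pz * px - pz * py \<in> Phi_kernel" "px ^ n - 1 \<in> Phi_kernel"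
proof -
  interpret power_rels Phi_kernel n "n div 2" by (rule Phi_kernel_power_rels)
  show "px\<^sup>2 - py\<^sup>2 \<in> Phi_kernel" "px ^ n - 1 \<in> Phi_kernel" using xy xn by (simp_all add: eqv_def)
  have "Phi (pz * px - pz * py) t = 0" for t by (cases t) (simp_all add: zeval_simps)
  then show "pz * px - pz * py \<in> Phi_kernel" by (simp add: Phi_kernel_def)
qed

end

section \<open>The long relations as reflections of \<open>wpoly\<close>\<close>

lemma reflection_poly:
  assumes "m > 0"
  shows "pz ^ m - pz ^ m * py ^ m
           + (\<Sum>i=1..m div 2. (-1) ^ i * of_nat ((m - i) choose i) * py ^ i * pz ^ (m - 2 * i))
           - (\<Sum>i=1..m div 2. (-1) ^ i * of_nat ((m - i) choose i) * py ^ (m + i) * pz ^ (m - 2 * i))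
           - px * F_poly (m - 1) + px * py ^ m * F_poly (m - 1) =
    (F_poly (m + 1) - px * F_poly (m - 1)) - py ^ m * (F_poly (m + 1) - px * F_poly (m - 1))"
proof -
  have "(\<Sum>i=1..m div 2. (-1) ^ i * of_nat ((m - i) choose i) * py ^ (m + i) * pz ^ (m - 2 * i)) =
    py ^ m * (\<Sum>i=1..m div 2. (-1) ^ i * of_nat ((m - i) choose i) * py ^ i * pz ^ (m - 2 * i))"
    by (simp add: sum_distrib_left power_add mult_ac)
  moreover have "F_poly (m + 1) = pz ^ m + (\<Sum>i=1..m div 2. (-1) ^ i * of_nat ((m - i) choose i) * py ^ i * pz ^ (m - 2 * i))"
    using F_poly_closed[of m] by simp
  ultimately show ?thesis by (simp only: algebra_simps)
qed

text \<open>The two sums are the tails of the closed forms of \<open>F_poly (m + 2)\<close> and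
  \<open>F_poly m\<close>; the pure powers of pz are the missing leading terms.\<close>

lemma reflection_poly_Suc:
  assumes "m > 1"
  shows "pz ^ (m + 1) - pz ^ (m - 1) * py ^ (m + 1)
           + (\<Sum>i=1..(m + 1) div 2. (-1) ^ i * of_nat ((m + 1 - i) choose i) * py ^ i * pz ^ (m + 1 - 2 * i))
           - (\<Sum>i=1..(m - 1) div 2. (-1) ^ i * of_nat ((m - 1 - i) choose i) * py ^ (m + 1 + i) * pz ^ (m - 1 - 2 * i))
           - px * F_poly m + px * py ^ (m + 1) * F_poly (m - 2) =
    (F_poly (m + 2) - px * F_poly m) - py ^ (m + 1) * (F_poly m - px * F_poly (m - 2))"
proof -
  have "(\<Sum>i=1..(m - 1) div 2. (-1) ^ i * of_nat ((m - 1 - i) choose i) * py ^ (m + 1 + i) * pz ^ (m - 1 - 2 * i)) =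
    py ^ (m + 1) * (\<Sum>i=1..(m - 1) div 2. (-1) ^ i * of_nat ((m - 1 - i) choose i) * py ^ i * pz ^ (m - 1 - 2 * i))"
    by (simp add: sum_distrib_left power_add mult_ac)
  moreover have "F_poly (m + 2) = pz ^ (m + 1) + (\<Sum>i=1..(m + 1) div 2. (-1) ^ i * of_nat ((m + 1 - i) choose i) * py ^ i * pz ^ (m + 1 - 2 * i))"
    using F_poly_closed[of "m + 1"] by simp
  moreover have "F_poly m = pz ^ (m - 1) + (\<Sum>i=1..(m - 1) div 2. (-1) ^ i * of_nat ((m - 1 - i) choose i) * py ^ i * pz ^ (m - 1 - 2 * i))"
    using F_poly_closed[of "m - 1"] assms by simp
  ultimately show ?thesis by (simp only: algebra_simps)
qed

text \<open>Used in two directions: modulo the ideal of the theorem it turns the relations into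
  reflections, and modulo the kernel it turns reflections into the relations.\<close>

lemma (in power_rels) reflection_eqv:
  assumes "m > 1"
  shows "(F_poly (m + 1) - px * F_poly (m - 1)) - py ^ m * (F_poly (m + 1) - px * F_poly (m - 1)) \<doteq>
      wpoly n m - py ^ m * wpoly n m"
    and "(F_poly (m + 2) - px * F_poly m) - py ^ (m + 1) * (F_poly m - px * F_poly (m - 2)) \<doteq>
      wpoly n (m + 1) - py ^ (m + 1) * wpoly n (m - 1)"
proof -
  have w: "F_poly (m + 1) - px * F_poly (m - 1) \<doteq> wpoly n m" "F_poly (m + 2) - px * F_poly m \<doteq> wpoly n (m + 1)"
    "F_poly m - px * F_poly (m - 2) \<doteq> wpoly n (m - 1)"
    using wpoly_F[of "m - 1"] wpoly_F[of m] wpoly_F[of "m - 2"] assms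
    by (auto intro!: eqv_sym simp: numeral_2_eq_2 Suc_diff_Suc)
  show "(F_poly (m + 1) - px * F_poly (m - 1)) - py ^ m * (F_poly (m + 1) - px * F_poly (m - 1)) \<doteq>
      wpoly n m - py ^ m * wpoly n m"
    by (intro eqv_diff[OF w(1) eqv_mult[OF eqv_refl w(1)]])
  show "(F_poly (m + 2) - px * F_poly m) - py ^ (m + 1) * (F_poly m - px * F_poly (m - 2)) \<doteq>
      wpoly n (m + 1) - py ^ (m + 1) * wpoly n (m - 1)"
    by (intro eqv_diff[OF w(2) eqv_mult[OF eqv_refl w(3)]])
qed

lemma (in power_rels) green_rels_idealI:
  assumes "m > 1" and zx: "pz * px \<doteq> pz * py"
    and g: "(F_poly (m + 1) - px * F_poly (m - 1)) - py ^ m * (F_poly (m + 1) - px * F_poly (m - 1)) \<doteq> 0"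
    and h: "(F_poly (m + 2) - px * F_poly m) - py ^ (m + 1) * (F_poly m - px * F_poly (m - 2)) \<doteq> 0"
  shows "green_rels_ideal I n m"
proof
  show "wpoly n m * py ^ m \<doteq> wpoly n m"
    using eqv_trans[OF eqv_sym[OF reflection_eqv(1)[OF assms(1)]] g] eqv_sym[of "wpoly n m" "py ^ m * wpoly n m"]
    by (simp add: eqv_def mult.commute)
  show "wpoly n (m + 1) \<doteq> py ^ (m + 1) * wpoly n (m - 1)"
    using eqv_trans[OF eqv_sym[OF reflection_eqv(2)[OF assms(1)]] h] by (simp add: eqv_def)
qed (rule zx)

text \<open>For m = 1 the reflection at m is z = zy. The one at m + 1 equates the square of z minus
  y times \<open>wpoly 2 0\<close> with the square of y times \<open>wpoly 2 0\<close>, which the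
  relation for the square of z provides.\<close>

lemma green_rels_idealI_2:
  assumes I: "two_sided_ideal I"
    and S: "py\<^sup>2 - 1 \<in> I" "px\<^sup>2 - py\<^sup>2 \<in> I" "pz * px - pz * py \<in> I" "pz - pz * py \<in> I"
      "pz\<^sup>2 - px - py - px * py - 1 \<in> I"
  shows "green_rels_ideal I 2 1"
proof -
  interpret two_sided_ideal I by fact
  have r: "py\<^sup>2 \<doteq> 1" "px\<^sup>2 \<doteq> py\<^sup>2" "pz * px \<doteq> pz * py" "pz \<doteq> pz * py" "pz\<^sup>2 \<doteq> px + py + px * py + 1"
    using S by (simp_all add: eqv_def diff_diff_eq add.assoc)
  have "px\<^sup>2 \<doteq> 1" using r(2,1) by (rule eqv_trans)
  moreover have "wpoly 2 (1 + 1) \<doteq> py ^ (1 + 1) * wpoly 2 (1 - 1)"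
  proof -
    have "wpoly 2 (1 + 1) = pz\<^sup>2 - (py + px * py\<^sup>2)"
      by (simp add: algebra_simps power2_eq_square)
    also have "\<dots> \<doteq> (px + py + px * py + 1) - (py + px * 1)"
      by (intro eqv_diff[OF r(5)] eqv_add[OF eqv_refl] eqv_mult[OF eqv_refl r(1)])
    also have "\<dots> = 1 * (1 + px * py)" by (simp add: algebra_simps)
    also have "\<dots> \<doteq> py\<^sup>2 * (1 + px * py)" by (rule eqv_mult[OF eqv_sym[OF r(1)] eqv_refl])
    finally show ?thesis by (simp add: power2_eq_square)
  qed
  ultimately show ?thesis
    using r eqv_sym[OF r(4)] by unfold_locales auto
qed

context hopf_char
begin

lemma green_ring_presentation:
  assumes "n > 2" and m: "m = n div 2"
  shows "green_ring n q \<simeq> zpoly_quot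
        {px ^ n - 1, px\<^sup>2 - py\<^sup>2, pz * px - pz * py,
         (F_poly (m + 1) - px * F_poly (m - 1)) - py ^ m * (F_poly (m + 1) - px * F_poly (m - 1)),
         (F_poly (m + 2) - px * F_poly m) - py ^ (m + 1) * (F_poly m - px * F_poly (m - 2))}"
    (is "_ \<simeq> zpoly_quot {_, _, _, ?g, ?h}")
proof (rule green_iso_zpoly)
  let ?S = "{px ^ n - 1, px\<^sup>2 - py\<^sup>2, pz * px - pz * py, ?g, ?h}"
  have nm: "n = 2 * m" "m > 1" using assms even_n by auto
  show "green_rels_ideal (Idl\<^bsub>ring_of_type_algebra\<^esub> ?S) n m"
  proof -
    interpret two_sided_ideal "Idl\<^bsub>ring_of_type_algebra\<^esub> ?S" by (rule two_sided_ideal_genideal)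
    have S: "?S \<subseteq> Idl\<^bsub>ring_of_type_algebra\<^esub> ?S" by (rule subset_genideal)
    have r: "eqv (px ^ n) 1" "eqv (px\<^sup>2) (py\<^sup>2)" "eqv (pz * px) (pz * py)" "eqv ?g 0" "eqv ?h 0"
      unfolding eqv_def by (rule subsetD[OF S], simp)+
    interpret power_rels "Idl\<^bsub>ring_of_type_algebra\<^esub> ?S" n m
      by unfold_locales (rule nm(1) r(1,2) | use nm(2) in simp)+
    show ?thesis by (rule green_rels_idealI[OF nm(2) r(3-5)])
  qed
  show "?S \<subseteq> Phi_kernel"
  proof -
    interpret power_rels Phi_kernel n m using Phi_kernel_power_rels m by simp
    have "wpoly n m - py ^ m * wpoly n m \<in> Phi_kernel" "wpoly n (m + 1) - py ^ (m + 1) * wpoly n (m - 1) \<in> Phi_kernel"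
      using Phi_reflection[of m m] Phi_reflection[of "m + 1" "m - 1"] nm
      by (simp_all add: Phi_kernel_def)
    then have "eqv (wpoly n m - py ^ m * wpoly n m) 0" "eqv (wpoly n (m + 1) - py ^ (m + 1) * wpoly n (m - 1)) 0"
      by (simp_all add: eqv_def)
    then have "eqv ?g 0" "eqv ?h 0"
      using reflection_eqv[OF nm(2)] eqv_trans by blast+
    then show ?thesis using Phi_kernel_xyz by (simp add: eqv_def)
  qed
qed

lemma green_ring_presentation_2:
  assumes n2: "n = 2"
  shows "green_ring n q \<simeq> zpoly_quot
        {py\<^sup>2 - 1, px\<^sup>2 - py\<^sup>2, pz * px - pz * py, pz - pz * py, pz\<^sup>2 - px - py - px * py - 1}"
proof (rule green_iso_zpoly)
  let ?S = "{py\<^sup>2 - 1, px\<^sup>2 - py\<^sup>2, pz * px - pz * py, pz - pz * py, pz\<^sup>2 - px - py - px * py - 1}"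
  show "green_rels_ideal (Idl\<^bsub>ring_of_type_algebra\<^esub> ?S) n 1"
    unfolding n2
    by (rule green_rels_idealI_2[OF two_sided_ideal_genideal]; rule subsetD[OF subset_genideal]; simp)
  have "Phi (py\<^sup>2 - 1) t = 0" "Phi (pz - pz * py) t = 0" "Phi (pz\<^sup>2 - px - py - px * py - 1) t = 0" for t
  proof -
    \<comment> \<open>A primitive square root of unity is -1, so all powers of z are signs and the
      relations reduce to finitely many cases.\<close>
    have z2: "z\<^sup>2 = 1" using z_n n2 by simp
    moreover have "z \<noteq> 1" using z_prim n2 by (auto simp: primitive_root_of_unity_def)
    ultimately have z1: "z = - 1" by (simp add: power2_eq_1_iff)
    have s: "(z ^ w)\<^sup>2 = 1" for w
      using z_n_mult(1)[of w] n2 by (simp add: power_mult)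
    have pm: "z ^ w = 1 \<or> z ^ w = - 1" for w using s[of w] by (simp add: power2_eq_1_iff)
    show "Phi (py\<^sup>2 - 1) t = 0" by (cases t) (simp_all add: zeval_simps s)
    show "Phi (pz - pz * py) t = 0"
    proof (cases t)
      case (PC u v)
      then show ?thesis using pm[of u] pm[of v] by (auto simp: zeval_simps power_add)
    qed (simp add: zeval_simps)
    show "Phi (pz\<^sup>2 - px - py - px * py - 1) t = 0"
    proof (cases t)
      case (PC u v)
      then show ?thesis using pm[of u] pm[of v] by (auto simp: zeval_simps power_add)
    next
      case (PT w)
      then show ?thesis using s[of w] by (simp add: zeval_simps power2_eq_square)
    qed
  qed
  then show "?S \<subseteq> Phi_kernel" using Phi_kernel_xyz by (simp add: Phi_kernel_def)
qed

end

lemma complex_primitive_root: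
  assumes "n > 0" shows "\<exists>z :: complex. primitive_root_of_unity n z"
proof
  let ?z = "cis (2 * pi / real n)"
  have pow: "?z ^ k = cis (2 * pi * real k / real n)" for k
    by (simp add: DeMoivre mult.commute)
  have "?z ^ i \<noteq> 1" if "0 < i" "i < n" for i
  proof
    assume "?z ^ i = 1"
    then have "cis (2 * pi * real i / real n) = cis (2 * pi * real 0 / real n)" by (simp add: pow)
    then have "i = 0"
      using that assms
      by (intro inj_onD[OF bij_betw_imp_inj_on[OF bij_betw_roots_unity[OF assms]]]) auto
    with that show False by simp
  qed
  then show "primitive_root_of_unity n ?z"
    using assms by (simp add: primitive_root_of_unity_def pow)
qed

theorem theorem4p9:
  fixes n :: nat and q :: "'k::field"
  assumes "n > 1"
    and "primitive_root_of_unity n q"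
    and "\<not> CHAR('k) dvd 2 * n\<^sup>2"
    and "\<exists>p. p\<^sup>2 = q"
    and "even n"
  shows "(n = 2 \<longrightarrow>
      green_ring n q \<simeq> zpoly_quot
        {py\<^sup>2 - 1, px\<^sup>2 - py\<^sup>2, pz * px - pz * py, pz - pz * py, pz\<^sup>2 - px - py - px * py - 1}) \<and>
    (n > 2 \<longrightarrow> (let m = n div 2 in
      green_ring n q \<simeq> zpoly_quot
        {px ^ n - 1, px\<^sup>2 - py\<^sup>2, pz * px - pz * py,
         pz ^ m - pz ^ m * py ^ m
           + (\<Sum>i=1..m div 2. (-1) ^ i * of_nat ((m - i) choose i) * py ^ i * pz ^ (m - 2 * i))
           - (\<Sum>i=1..m div 2. (-1) ^ i * of_nat ((m - i) choose i) * py ^ (m + i) * pz ^ (m - 2 * i))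
           - px * F_poly (m - 1) + px * py ^ m * F_poly (m - 1),
         pz ^ (m + 1) - pz ^ (m - 1) * py ^ (m + 1)
           + (\<Sum>i=1..(m + 1) div 2.
                (-1) ^ i * of_nat ((m + 1 - i) choose i) * py ^ i * pz ^ (m + 1 - 2 * i))
           - (\<Sum>i=1..(m - 1) div 2.
                (-1) ^ i * of_nat ((m - 1 - i) choose i) * py ^ (m + 1 + i) * pz ^ (m - 1 - 2 * i))
           - px * F_poly m + px * py ^ (m + 1) * F_poly (m - 2)}))"
proof -
  obtain p where p: "p\<^sup>2 = q" using assms(4) by blast
  obtain z :: complex where z: "primitive_root_of_unity n z" using complex_primitive_root[of n] assms(1) by auto
  have c: "\<not> CHAR('k) dvd 2" "\<not> CHAR('k) dvd n"
    using assms(3) by (auto simp: power2_eq_square)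
  have "(of_nat 2 :: 'k) \<noteq> 0" "(of_nat n :: 'k) \<noteq> 0"
    using c unfolding of_nat_eq_0_iff_char_dvd by auto
  then interpret hopf_char n q p z
    using assms p z by unfold_locales auto
  show ?thesis
  proof (cases "n > 2")
    case True
    then have m: "n div 2 > 0" "n div 2 > 1" using \<open>even n\<close> by auto
    show ?thesis
      unfolding Let_def reflection_poly[OF m(1)] reflection_poly_Suc[OF m(2)]
      using green_ring_presentation_2 green_ring_presentation[OF True refl] by blast
  qed (use green_ring_presentation_2 in blast)
qed

end
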